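(* Let $d=1$ and $\alpha\in(0,2)$. There exists a measurable even function $\kappa:\mathbb{R}\to[1,2]$ such that the heat kernel $p_\kappa(t,x)$ of the operator $\mathscr{L}_\kappa$ satisfies $$\limsup_{|x|\to\infty}|x|^{1+\alpha}\,|\partial_x p_\kappa(1,x)|>0.$$
   Context: Let $\alpha\in(0,2)$. For a measurable even function $\kappa:\mathbb{R}\to[1,2]$, the one-dimensional $\alpha$-stable-like operator $\mathscr{L}_\kappa$ is $$\mathscr{L}_\kappa f(x):=\int_{\mathbb{R}}\bigl(f(x+y)-f(x)-y^{(\alpha)} f'(x)\bigr)\frac{\kappa(y)}{|y|^{1+\alpha}}\,dy,\qquad y^{(\alpha)}:=1_{\alpha\in(1,2)}\,y+1_{\alpha=1}1_{|y|\le 1}\,y.$$ It is known that $\mathscr{L}_\kappa$ has a fundamental solution (heat kernel) $p_\kappa(t,x)$, $t>0$, $x\in\mathbb{R}$, which is smooth in $x$, is a probability density in $x$ for each $t>0$, and satisfies $\partial_t p_\kappa(t,x)=\mathscr{L}_\kappa p_\kappa(t,\cdot)(x)$ with $p_\kappa(t,\cdot)\to\delta_0$ as $t\downarrow0$. Equivalently, $p_\kappa(t,\cdot)$ is the smooth density at time $t$ of the symmetric Lévy process with Lévy measure $\kappa(y)|y|^{-1-\alpha}\,dy$ (no Gaussian part), i.e. $\int_{\mathbb{R}} e^{i\xi x}p_\kappa(t,x)\,dx=\exp\bigl(-t\int_{\mathbb{R}}(1-\cos(\xi y))\kappa(y)|y|^{-1-\alpha}\,dy\bigr)$ for all $\xi\in\mathbb{R}$.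 *)

theory Defs
  imports "HOL-Probability.Probability"
begin

definition compensator :: "real \<Rightarrow> real \<Rightarrow> real" where
  "compensator \<alpha> y = (if \<alpha> > 1 then y else if \<alpha> = 1 \<and> \<bar>y\<bar> \<le> 1 then y else 0)"

definition stable_like_integrand ::
    "real \<Rightarrow> (real \<Rightarrow> real) \<Rightarrow> (real \<Rightarrow> real) \<Rightarrow> real \<Rightarrow> real \<Rightarrow> real" where
  "stable_like_integrand \<alpha> \<kappa> f x y =
     (f (x + y) - f x - compensator \<alpha> y * deriv f x) * (\<kappa> y / \<bar>y\<bar> powr (1 + \<alpha>))"

definition stable_like_op ::
    "real \<Rightarrow> (real \<Rightarrow> real) \<Rightarrow> (real \<Rightarrow> real) \<Rightarrow> real \<Rightarrow> real" where
  "stable_like_op \<alpha> \<kappa> f x = (LBINT y. stable_like_integrand \<alpha> \<kappa> f x y)"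

definition levy_exponent :: "real \<Rightarrow> (real \<Rightarrow> real) \<Rightarrow> real \<Rightarrow> real" where
  "levy_exponent \<alpha> \<kappa> \<xi> = (LBINT y. (1 - cos (\<xi> * y)) * (\<kappa> y / \<bar>y\<bar> powr (1 + \<alpha>)))"

text \<open>
  \<open>p\<close> is the heat kernel of \<open>stable_like_op \<alpha> \<kappa>\<close>: a fundamental solution that is smooth in space and
  a probability density at each positive time. The condition on the characteristic function says
  that \<open>p t\<close> is the law at time \<open>t\<close> of the symmetric Levy process with Levy measure
  \<open>\<kappa> y / \<bar>y\<bar> powr (1 + \<alpha>) dy\<close>; it determines \<open>p t\<close> for \<open>t > 0\<close>, see \<open>is_heat_kernel_unique\<close>
  below. The equation includes absolute convergence of the integral defining the operator, since the
  Bochner integral of a non-integrable function is 0 by convention. Values at \<open>t \<le> 0\<close> are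
  irrelevant.
\<close>

definition is_heat_kernel ::
    "real \<Rightarrow> (real \<Rightarrow> real) \<Rightarrow> (real \<Rightarrow> real \<Rightarrow> real) \<Rightarrow> bool" where
  "is_heat_kernel \<alpha> \<kappa> p \<longleftrightarrow>
     (\<forall>t>0. \<forall>n x. ((deriv ^^ n) (p t)) field_differentiable (at x)) \<and>
     (\<forall>t>0. (\<forall>x. 0 \<le> p t x) \<and> prob_space (density lborel (p t))) \<and>
     (\<forall>t>0. \<forall>x. integrable lborel (stable_like_integrand \<alpha> \<kappa> (p t) x) \<and>
        ((\<lambda>s. p s x) has_real_derivative stable_like_op \<alpha> \<kappa> (p t) x) (at t)) \<and>
     (\<forall>f :: real \<Rightarrow> real. continuous_on UNIV f \<and> bounded (range f) \<longrightarrow>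
        ((\<lambda>t. LBINT x. f x * p t x) \<longlongrightarrow> f 0) (at_right 0)) \<and>
     (\<forall>t>0. \<forall>\<xi>. char (density lborel (p t)) \<xi> = of_real (exp (- t * levy_exponent \<alpha> \<kappa> \<xi>)))"

lemma is_heat_kernel_unique:
  assumes "is_heat_kernel \<alpha> \<kappa> p" "is_heat_kernel \<alpha> \<kappa> q" "t > 0"
  shows "p t = q t"
proof -
  have cont: "continuous_on UNIV (r t)" if "is_heat_kernel \<alpha> \<kappa> r" for r
  proof -
    have "(deriv ^^ 0) (r t) field_differentiable (at x)" for x
      using that \<open>t > 0\<close> unfolding is_heat_kernel_def by blast
    then show ?thesis
      by (auto intro!: continuous_at_imp_continuous_on field_differentiable_imp_continuous_at)
  qed
  have meas: "r t \<in> borel_measurable borel" if "is_heat_kernel \<alpha> \<kappa> r" for r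
    using cont[OF that] by (rule borel_measurable_continuous_onI)
  have dist: "real_distribution (density lborel (r t))" if "is_heat_kernel \<alpha> \<kappa> r" for r
    using that \<open>t > 0\<close>
    by (auto simp: is_heat_kernel_def real_distribution_def real_distribution_axioms_def)
  have "char (density lborel (p t)) = char (density lborel (q t))"
    using assms by (auto simp: is_heat_kernel_def)
  then have eq: "density lborel (p t) = density lborel (q t)"
    using Levy_uniqueness dist assms by blast
  have "AE x in lborel. ennreal (p t x) = ennreal (q t x)"
    using eq meas[OF assms(1)] meas[OF assms(2)]
    by (subst (asm) sigma_finite_measure.density_unique_iff[OF sigma_finite_lborel]) auto
  then have "AE x in lborel. p t x = q t x"
    using assms by (auto simp: is_heat_kernel_def)
  then have ae: "AE x in lborel. x \<in> UNIV \<longrightarrow> p t x - q t x = 0"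
    by auto
  show ?thesis
  proof (rule ccontr)
    assume "p t \<noteq> q t"
    then obtain x where x: "p t x \<noteq> q t x" by auto
    define S where "S = {x. p t x \<noteq> q t x}"
    have "open S"
      unfolding S_def using cont[OF assms(1)] cont[OF assms(2)] by (rule open_Collect_neq)
    moreover have "S \<in> null_sets lborel"
      using ae \<open>open S\<close> by (subst AE_iff_null_sets) (auto simp: S_def elim!: AE_mp)
    ultimately have "S = {}"
      using open_not_negligible[of S] negligible_iff_null_sets null_sets_completionI by blast
    with x show False by (auto simp: S_def)
  qed
qed

end

(*
  For every admissible \<kappa> the kernel is the inverse cosine transform of exp (- t \<psi>), where \<psi> is the
  characteristic exponent; positivity comes from approximating the Levy measure by finite ones.

  If \<kappa> = 1 far out, adding to \<kappa> a bump supported on a \<le> |y| \<le> a + 1 changes p'(1, a), up to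
  o(a^(-1-\<alpha>)) as a tends to infinity, by \<omega> (p(1, 0) - p(1, 1)) with \<omega> of order a^(-1-\<alpha>), and
  p(1, 0) - p(1, 1) has a positive lower bound that depends only on \<alpha>. So for all large a either \<kappa> or
  the modified coefficient satisfies |p'(1, a)| \<ge> c a^(-1-\<alpha>). Since p' depends continuously on \<kappa>,
  uniformly over coefficients that agree on a long interval, later modifications very far out preserve
  this at a up to a factor 2. Iterating, with a sparse sequence of points a, gives \<kappa> in the limit.
*)

theory Submission
  imports Defs
begin

section \<open>Integrability\<close>

text \<open>For constant \<kappa> the kernel is a stable density, whose derivative is of order
  |x|^(-2-\<alpha>); roughness of \<kappa> at arbitrarily large distances destroys this gain. The
  sharp edges of a bump do it: its density is a constant \<omega> on [a, a + 1], so its convolution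
  with p has derivative \<omega> (p(x - a) - p(x - a - 1)), which at x = a is \<omega> (p(0) -
  p(1)). The other first-order terms are \<omega> times values of p or p' far out, hence o(\<omega>)
  by Riemann-Lebesgue, and the remainder is O(\<omega>^2). The derivative of the unmodified kernel
  at a could cancel this contribution. Comparing the two coefficients, instead of estimating either
  one, gets around that. The coefficient changes at every stage, so the constants of the iteration
  (those in \<open>psi_ge\<close> and \<open>psi_le\<close>, \<open>gap\<close>, the integral of
  \<open>charac_bound\<close>) come from \<alpha> and the bounds 1 and 2 alone. The radius up to
  which a stage must be preserved depends on a, since the tolerated error is of order
  a^(-1-\<alpha>); hence the sparse sequence.\<close>

lemma integrable_dominated:
  fixes f g :: "'a \<Rightarrow> real"
  assumes "integrable M g" "f \<in> borel_measurable M" "\<And>x. \<bar>f x\<bar> \<le> g x"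
  shows "integrable M f"
proof (rule Bochner_Integration.integrable_bound[OF assms(1,2)])
  show "AE x in M. norm (f x) \<le> norm (g x)"
    unfolding real_norm_def by (intro AE_I2 order_trans[OF assms(3) abs_ge_self])
qed

text \<open>A majorant is the sum of \<open>h\<close> on \<open>A\<close> and its reflection, so
  one-sided gauge-integral facts about \<open>y powr s\<close> carry over to even functions on the
  line.\<close>

lemma integrable_even_extension:
  fixes h :: "real \<Rightarrow> real"
  assumes h: "h absolutely_integrable_on A" and [measurable]: "A \<in> sets borel"
    and [measurable]: "h \<in> borel_measurable borel"
  shows "integrable lborel (\<lambda>y. indicator A \<bar>y\<bar> * h \<bar>y\<bar>)"
proof -
  have 1: "integrable lborel (\<lambda>y. indicator A y * h y)"
    using h by (simp add: set_integrable_def integrable_completion)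
  have 2: "integrable lborel (\<lambda>y. indicator A (0 + (-1) * y) * h (0 + (-1) * y))"
    by (rule lborel_integrable_real_affine[OF 1]) simp
  have "integrable lborel (\<lambda>y. \<bar>indicator A y * h y\<bar> + \<bar>indicator A (-y) * h (-y)\<bar>)"
    using 1 2 by (auto intro!: Bochner_Integration.integrable_add integrable_abs)
  then show ?thesis
    by (rule Bochner_Integration.integrable_bound) (auto split: split_indicator simp: abs_real_def)
qed

lemma integrable_powr_near_0:
  fixes s :: real
  assumes "s > -1"
  shows "integrable lborel (\<lambda>y. indicator {-1..1} y * \<bar>y\<bar> powr s)"
proof -
  have "(\<lambda>y. y powr s) absolutely_integrable_on {0..1}"
    using integrable_on_powr_from_0[OF assms, of 1] by (auto intro!: nonnegative_absolutely_integrable_1)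
  from integrable_even_extension[OF this] have "integrable lborel (\<lambda>y. indicator {0..1} \<bar>y\<bar> * \<bar>y\<bar> powr s)"
    by auto
  also have "(\<lambda>y. indicator {0..1} \<bar>y\<bar> * \<bar>y\<bar> powr s) = (\<lambda>y::real. indicator {-1..1} y * \<bar>y\<bar> powr s)"
    by (auto simp: fun_eq_iff split: split_indicator)
  finally show ?thesis .
qed

lemma integrable_powr_at_infinity:
  fixes s :: real
  assumes "s < -1"
  shows "integrable lborel (\<lambda>y. indicator (-{-1..1}) y * \<bar>y\<bar> powr s)"
proof -
  have "(\<lambda>y. y powr s) absolutely_integrable_on {1..}"
    using has_integral_powr_to_inf[OF assms, of 1]
    by (auto intro!: nonnegative_absolutely_integrable_1 simp: integrable_on_def)
  from integrable_even_extension[OF this] have "integrable lborel (\<lambda>y. indicator {1..} \<bar>y\<bar> * \<bar>y\<bar> powr s)"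
    by auto
  then show ?thesis
    by (rule Bochner_Integration.integrable_bound) (auto split: split_indicator)
qed

lemma integrable_inverse_square: "integrable lborel (\<lambda>\<xi>::real. C / (1 + \<xi>\<^sup>2))"
proof -
  have "integrable lborel (\<lambda>\<xi>::real. inverse (1 + \<xi>\<^sup>2))"
    using integrable_inverse_1_plus_square by (simp add: set_integrable_def)
  from integrable_mult_right[OF this, of C] show ?thesis by (simp add: divide_inverse)
qed

lemma integrable_decay:
  fixes f :: "real \<Rightarrow> real"
  assumes "f \<in> borel_measurable borel" "\<And>\<xi>. \<bar>f \<xi>\<bar> \<le> C / (1 + \<xi>\<^sup>2)"
  shows "integrable lborel f"
  by (rule integrable_dominated[OF integrable_inverse_square _ assms(2)]) (use assms(1) in simp)

text \<open>A single term u^m / m! of the exponential series, with u = c x^\<alpha>, suffices once m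
  \<alpha> \<ge> k + 2: the two surplus powers give the inverse square.\<close>

lemma power_exp_decay:
  fixes c \<alpha> :: real
  assumes "0 < c" "0 < \<alpha>"
  obtains C where "\<And>\<xi>. \<bar>\<xi>\<bar> ^ k * exp (- (c * \<bar>\<xi>\<bar> powr \<alpha>)) \<le> C / (1 + \<xi>\<^sup>2)"
proof -
  obtain m :: nat where m: "real k + 2 \<le> real m * \<alpha>"
    using \<open>0 < \<alpha>\<close> by (metis ex_less_of_nat_mult less_le)
  \<comment> \<open>The first 2 serves \<bar>\<xi>\<bar> \<le> 1, where 1 + \<xi>^2 \<le> 2; the
    other summand serves the tail, where 1 + x^2 \<le> 2 x^2.\<close>
  define C where "C = 2 + 2 * (fact m / c ^ m)"
  have "\<bar>\<xi>\<bar> ^ k * exp (- (c * \<bar>\<xi>\<bar> powr \<alpha>)) \<le> C / (1 + \<xi>\<^sup>2)" for \<xi>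
  proof (cases "\<bar>\<xi>\<bar> \<le> 1")
    case True
    have "\<bar>\<xi>\<bar> ^ k * exp (- (c * \<bar>\<xi>\<bar> powr \<alpha>)) \<le> 1 * 1"
      using True \<open>0 < c\<close> by (intro mult_mono) (auto simp: power_le_one)
    also have "1 * 1 \<le> C / (1 + \<xi>\<^sup>2)"
    proof -
      have "\<xi>\<^sup>2 \<le> 1" using True by (simp add: abs_square_le_1)
      moreover have "2 \<le> C" using \<open>0 < c\<close> by (simp add: C_def)
      ultimately show ?thesis by (simp add: add_pos_nonneg pos_le_divide_eq)
    qed
    finally show ?thesis .
  next
    case False
    define x where "x = \<bar>\<xi>\<bar>"
    have x: "x > 1" using False by (simp add: x_def)
    define u where "u = c * x powr \<alpha>"
    have u: "u > 0" using \<open>0 < c\<close> x by (simp add: u_def)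
    have "u ^ m / fact m \<le> exp u"
    proof -
      have "(\<Sum>n\<in>{m}. u ^ n /\<^sub>R fact n) \<le> (\<Sum>n. u ^ n /\<^sub>R fact n)"
        using u by (intro sum_le_suminf summable_exp_generic) auto
      then show ?thesis by (simp add: exp_def divide_inverse mult.commute)
    qed
    then have "exp (-u) \<le> fact m / u ^ m"
      using u by (simp add: exp_minus field_simps)
    also have "u ^ m = c ^ m * x powr (real m * \<alpha>)"
      using x by (simp add: u_def power_mult_distrib powr_power mult.commute)
    also have "fact m / (c ^ m * x powr (real m * \<alpha>)) \<le> fact m / (c ^ m * x powr (real k + 2))"
      using x m \<open>0 < c\<close> by (intro divide_left_mono mult_left_mono powr_mono mult_pos_pos) auto
    also have "x powr (real k + 2) = x ^ k * x\<^sup>2"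
      using x by (simp add: powr_add powr_realpow)
    finally have "x ^ k * exp (-u) \<le> x ^ k * (fact m / (c ^ m * (x ^ k * x\<^sup>2)))"
      using x by (intro mult_left_mono) auto
    also have "\<dots> = (fact m / c ^ m) / x\<^sup>2"
      using x \<open>0 < c\<close> by (simp add: field_simps)
    also have "\<dots> \<le> C / (1 + x\<^sup>2)"
    proof -
      define F where "F = fact m / c ^ m"
      have F: "0 \<le> F" using \<open>0 < c\<close> by (simp add: F_def)
      have "F * 1 \<le> F * x\<^sup>2" using F x by (intro mult_left_mono) (auto simp: one_le_power)
      then have "F * (1 + x\<^sup>2) \<le> C * x\<^sup>2"
        using zero_le_power2[of x] unfolding C_def F_def[symmetric] distrib_left distrib_right by linarith
      then show ?thesis using x unfolding F_def[symmetric] by (simp add: field_simps add_pos_nonneg)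
    qed
    finally show ?thesis by (simp add: x_def u_def)
  qed
  then show ?thesis by (rule that)
qed

section \<open>Trigonometric estimates\<close>

lemma one_minus_cos_bounds: "0 \<le> 1 - cos (x::real)" "1 - cos x \<le> 2" "1 - cos x \<le> x\<^sup>2 / 2"
proof -
  show "0 \<le> 1 - cos x" "1 - cos x \<le> 2" using cos_le_one[of x] cos_ge_minus_one[of x] by auto
  have "1 - cos x = 2 * (sin (x/2))\<^sup>2"
    using cos_double_sin[of "x/2"] by simp
  also have "(sin (x/2))\<^sup>2 \<le> (x/2)\<^sup>2"
    using abs_sin_x_le_abs_x[of "x/2"] abs_le_square_iff by blast
  finally show "1 - cos x \<le> x\<^sup>2 / 2" by (simp add: power2_eq_square)
qed

lemma abs_sin_minus_arg: "\<bar>sin x - x\<bar> \<le> (x::real)\<^sup>2 / 2"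
proof -
  have "cmod (iexp x - (\<Sum>k\<le>1. (\<i> * x) ^ k / fact k)) \<le> \<bar>x\<bar> ^ Suc 1 / fact (Suc 1)"
    by (rule iexp_approx1)
  also have "\<dots> = x\<^sup>2 / 2" by (simp add: power2_eq_square)
  finally have "cmod (iexp x - (\<Sum>k\<le>1. (\<i> * x) ^ k / fact k)) \<le> x\<^sup>2 / 2" .
  from order_trans[OF abs_Im_le_cmod this] show ?thesis by (simp add: Im_exp)
qed

lemma abs_cos_remainder: "\<bar>cos (x + h) - cos x + h * sin x\<bar> \<le> (h::real)\<^sup>2"
proof -
  have "cos (x + h) - cos x + h * sin x = - cos x * (1 - cos h) - sin x * (sin h - h)"
    by (simp add: cos_add algebra_simps)
  also have "\<bar>\<dots>\<bar> \<le> \<bar>cos x\<bar> * \<bar>1 - cos h\<bar> + \<bar>sin x\<bar> * \<bar>sin h - h\<bar>"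
    by (rule order_trans[OF abs_triangle_ineq4]) (simp add: abs_mult)
  also have "\<dots> \<le> 1 * (h\<^sup>2 / 2) + 1 * (h\<^sup>2 / 2)"
    using one_minus_cos_bounds[of h] abs_sin_minus_arg[of h]
    by (intro add_mono mult_mono) auto
  finally show ?thesis by simp
qed

lemma abs_cos_diff_le: "\<bar>cos (x + h) - cos x\<bar> \<le> \<bar>h::real\<bar>"
proof -
  have "\<bar>cos (x + h) - cos x\<bar> = 2 * \<bar>sin ((x + h + x) / 2)\<bar> * \<bar>sin (h / 2)\<bar>"
    by (simp add: cos_diff_cos abs_mult)
  also have "\<dots> \<le> 2 * 1 * \<bar>h / 2\<bar>"
    using abs_sin_x_le_abs_x[of "h/2"] by (intro mult_mono) auto
  finally show ?thesis by simp
qed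

section \<open>The characteristic exponent\<close>

text \<open>A power of \<open>\<bar>y\<bar>\<close> near 0 and another one at infinity, chosen so that \<open>jump_size\<close> dominates the
  compensated increment of a smooth bounded function and is integrable against the Levy measure.\<close>

definition jump_size :: "real \<Rightarrow> real \<Rightarrow> real" where
  "jump_size \<alpha> y = (if \<bar>y\<bar> \<le> 1 then if \<alpha> < 1 then \<bar>y\<bar> else y\<^sup>2 else if \<alpha> > 1 then \<bar>y\<bar> else 1)"

lemma jump_size_nonneg: "0 \<le> jump_size \<alpha> y"
  by (simp add: jump_size_def)

lemma measurable_jump_size [measurable]: "jump_size \<alpha> \<in> borel_measurable borel"
  unfolding jump_size_def[abs_def] by measurable

lemma measurable_compensator [measurable]: "compensator \<alpha> \<in> borel_measurable borel"
  unfolding compensator_def[abs_def] by measurable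

lemma integrable_jump_size:
  assumes "0 < \<alpha>" "\<alpha> < 2"
  shows "integrable lborel (\<lambda>y. jump_size \<alpha> y / \<bar>y\<bar> powr (1 + \<alpha>))"
proof -
  have eq: "jump_size \<alpha> y / \<bar>y\<bar> powr (1 + \<alpha>) =
     indicator {-1..1} y * \<bar>y\<bar> powr (if \<alpha> < 1 then -\<alpha> else 1 - \<alpha>) +
     indicator (-{-1..1}) y * \<bar>y\<bar> powr (if \<alpha> > 1 then -\<alpha> else -1 - \<alpha>)" for y
  proof (cases "y = 0")
    case False
    have p: "\<bar>y\<bar> / \<bar>y\<bar> powr (1 + \<alpha>) = \<bar>y\<bar> powr (-\<alpha>)" "y\<^sup>2 / \<bar>y\<bar> powr (1 + \<alpha>) = \<bar>y\<bar> powr (1-\<alpha>)"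
      "1 / \<bar>y\<bar> powr (1 + \<alpha>) = \<bar>y\<bar> powr (-1-\<alpha>)"
      using powr_diff[of "\<bar>y\<bar>" 1 "1+\<alpha>"] powr_diff[of "\<bar>y\<bar>" 2 "1+\<alpha>"] powr_diff[of "\<bar>y\<bar>" 0 "1+\<alpha>"] False
      by (simp_all add: powr_numeral algebra_simps)
    have "y \<in> {-1..1} \<longleftrightarrow> \<bar>y\<bar> \<le> 1" by auto
    then show ?thesis
      unfolding jump_size_def by (cases "\<bar>y\<bar> \<le> 1") (simp_all add: p)
  qed (simp add: jump_size_def)
  show ?thesis
    unfolding eq using assms
    by (intro Bochner_Integration.integrable_add integrable_powr_near_0 integrable_powr_at_infinity) auto
qed

lemma abs_le_one_plus_square: "\<bar>x::real\<bar> \<le> 1 + x\<^sup>2"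
proof -
  have "0 \<le> (\<bar>x\<bar> - 1)\<^sup>2 + \<bar>x\<bar>\<^sup>2" by simp
  then show ?thesis by (auto simp: power2_eq_square algebra_simps abs_real_def)
qed

lemma one_minus_cos_le_jump_size: "1 - cos (\<xi> * y) \<le> 2 * (1 + \<xi>\<^sup>2) * jump_size \<alpha> y"
proof (cases "\<bar>y\<bar> \<le> 1")
  case True
  have "1 - cos (\<xi> * y) \<le> \<xi>\<^sup>2 * y\<^sup>2 / 2"
    using one_minus_cos_bounds(3)[of "\<xi> * y"] by (simp add: power_mult_distrib)
  also have "\<dots> \<le> 2 * (1 + \<xi>\<^sup>2) * y\<^sup>2"
  proof -
    have "0 \<le> \<xi>\<^sup>2 * y\<^sup>2" "0 \<le> y\<^sup>2" by simp_all
    then show ?thesis unfolding distrib_left distrib_right mult.assoc by linarith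
  qed
  also have "y\<^sup>2 \<le> jump_size \<alpha> y"
    using True mult_left_le[of "\<bar>y\<bar>" "\<bar>y\<bar>"] by (auto simp: jump_size_def power2_eq_square abs_real_def split: if_splits)
  finally show ?thesis by (simp add: mult_left_mono)
next
  case False
  have "1 - cos (\<xi> * y) \<le> 2 * 1 * 1" using one_minus_cos_bounds(2) by simp
  also have "\<dots> \<le> 2 * (1 + \<xi>\<^sup>2) * jump_size \<alpha> y"
    using False by (intro mult_mono) (auto simp: jump_size_def)
  finally show ?thesis .
qed

text \<open>The four cases are those in which \<open>compensator\<close> and
  \<open>jump_size\<close> change form: a first-order bound for small jumps if \<alpha> < 1, a
  second-order bound if \<alpha> \<ge> 1, the bound 2 for large uncompensated jumps, and linear
  growth from the compensator for large jumps if \<alpha> > 1. The dependence on \<xi> stays within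
  1 + \<xi>^2, which the characteristic function absorbs.\<close>

lemma compensated_cos_le_jump_size:
  assumes "0 < \<alpha>"
  shows "\<bar>cos (\<xi> * (x + y)) - cos (\<xi> * x) + compensator \<alpha> y * (\<xi> * sin (\<xi> * x))\<bar>
     \<le> 3 * (1 + \<xi>\<^sup>2) * jump_size \<alpha> y"
proof -
  have 0: "\<bar>cos (\<xi> * (x + y)) - cos (\<xi> * x)\<bar> \<le> \<bar>\<xi>\<bar> * \<bar>y\<bar>"
    using abs_cos_diff_le[of "\<xi> * x" "\<xi> * y"] by (simp add: abs_mult algebra_simps)
  have 1: "\<bar>cos (\<xi> * (x + y)) - cos (\<xi> * x)\<bar> \<le> 2"
    using cos_le_one[of "\<xi> * (x + y)"] cos_ge_minus_one[of "\<xi> * (x + y)"]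
      cos_le_one[of "\<xi> * x"] cos_ge_minus_one[of "\<xi> * x"] by linarith
  have 2: "\<bar>cos (\<xi> * (x + y)) - cos (\<xi> * x) + y * (\<xi> * sin (\<xi> * x))\<bar> \<le> \<xi>\<^sup>2 * y\<^sup>2"
    using abs_cos_remainder[of "\<xi> * x" "\<xi> * y"] by (simp add: algebra_simps power_mult_distrib)
  have 3: "\<bar>\<xi>\<bar> \<le> 1 + \<xi>\<^sup>2" by (rule abs_le_one_plus_square)
  have *: "a \<le> A \<Longrightarrow> a * b \<le> 3 * A * b" if "0 \<le> b" "0 \<le> A" for a A b :: real
    using mult_right_mono[of a A b] mult_nonneg_nonneg[OF that(2,1)] that by linarith
  consider "\<bar>y\<bar> \<le> 1" "\<alpha> < 1" | "\<bar>y\<bar> \<le> 1" "\<alpha> \<ge> 1" | "\<bar>y\<bar> > 1" "\<alpha> \<le> 1" | "\<bar>y\<bar> > 1" "\<alpha> > 1" by linarith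
  then show ?thesis
  proof cases
    case 1
    with order_trans[OF 0 *[OF _ _ 3, of "\<bar>y\<bar>"]] show ?thesis
      by (simp add: jump_size_def compensator_def)
  next
    case 2
    with order_trans[OF \<open>\<bar>cos (\<xi> * (x + y)) - cos (\<xi> * x) + y * (\<xi> * sin (\<xi> * x))\<bar> \<le> \<xi>\<^sup>2 * y\<^sup>2\<close>
          *[of "y\<^sup>2" "1 + \<xi>\<^sup>2" "\<xi>\<^sup>2"]]
    show ?thesis by (auto simp: jump_size_def compensator_def)
  next
    case 3
    with 1 show ?thesis by (auto simp: jump_size_def compensator_def intro: order_trans)
  next
    case 4
    have "\<bar>cos (\<xi> * (x + y)) - cos (\<xi> * x) + y * (\<xi> * sin (\<xi> * x))\<bar> \<le> 2 + \<bar>y\<bar> * (\<bar>\<xi>\<bar> * 1)"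
      by (rule order_trans[OF abs_triangle_ineq])
         (auto intro!: add_mono 1 mult_left_mono mult_left_le simp: abs_mult)
    also have "\<dots> \<le> 2 * \<bar>y\<bar> + \<bar>y\<bar> * (1 + \<xi>\<^sup>2)"
      using 4 by (intro add_mono mult_left_mono) (auto simp: abs_le_one_plus_square)
    also have "\<dots> \<le> 3 * (1 + \<xi>\<^sup>2) * \<bar>y\<bar>"
      by (simp add: algebra_simps)
    finally show ?thesis using 4 by (simp add: jump_size_def compensator_def)
  qed
qed

locale stable_like =
  fixes \<alpha> :: real and \<kappa> :: "real \<Rightarrow> real"
  assumes alpha: "0 < \<alpha>" "\<alpha> < 2"
    and measurable_kappa [measurable]: "\<kappa> \<in> borel_measurable borel"
    and kappa_even: "\<kappa> (- y) = \<kappa> y"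
    and kappa_bounds: "1 \<le> \<kappa> y" "\<kappa> y \<le> 2"
begin

abbreviation nu :: "real \<Rightarrow> real" where
  "nu y \<equiv> \<kappa> y / \<bar>y\<bar> powr (1 + \<alpha>)"

abbreviation psi :: "real \<Rightarrow> real" where
  "psi \<equiv> levy_exponent \<alpha> \<kappa>"

lemma nu_nonneg: "0 \<le> nu y"
  using kappa_bounds(1)[of y] by simp

text \<open>Turns a bound by \<open>jump_size\<close> into an integrable majorant that is the same
  for all \<kappa>; the factor 2 is the upper bound of \<kappa>.\<close>

lemma jump_domination:
  assumes "\<bar>a\<bar> \<le> B * jump_size \<alpha> y" "0 \<le> B"
  shows "\<bar>a * nu y\<bar> \<le> 2 * B * (jump_size \<alpha> y / \<bar>y\<bar> powr (1 + \<alpha>))"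
proof -
  have "\<bar>a * nu y\<bar> = \<bar>a\<bar> * \<kappa> y / \<bar>y\<bar> powr (1 + \<alpha>)"
    using kappa_bounds(1)[of y] by (simp add: abs_mult)
  also have "\<dots> \<le> (B * jump_size \<alpha> y) * 2 / \<bar>y\<bar> powr (1 + \<alpha>)"
    using kappa_bounds[of y] assms jump_size_nonneg[of \<alpha> y]
    by (intro divide_right_mono mult_mono) auto
  finally show ?thesis by (simp add: mult_ac)
qed

lemma cos_domination:
  "\<bar>(1 - cos (\<xi> * y)) * nu y\<bar> \<le> 4 * (1 + \<xi>\<^sup>2) * (jump_size \<alpha> y / \<bar>y\<bar> powr (1 + \<alpha>))"
  using jump_domination[of "1 - cos (\<xi> * y)" "2 * (1 + \<xi>\<^sup>2)" y]
    one_minus_cos_le_jump_size[of \<xi> y \<alpha>] one_minus_cos_bounds(1)[of "\<xi> * y"] by simp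

lemma integrable_levy: "integrable lborel (\<lambda>y. (1 - cos (\<xi> * y)) * nu y)"
  by (rule Bochner_Integration.integrable_bound[OF
        integrable_mult_right[OF integrable_jump_size[OF alpha], of "4 * (1 + \<xi>\<^sup>2)"]])
     (use cos_domination[of \<xi>] in \<open>auto simp: jump_size_nonneg\<close>)

lemma psi_nonneg: "0 \<le> psi \<xi>"
  unfolding levy_exponent_def
  by (intro integral_nonneg_AE AE_I2 mult_nonneg_nonneg nu_nonneg one_minus_cos_bounds)

lemma psi_even: "psi (- \<xi>) = psi \<xi>"
  by (simp add: levy_exponent_def)

lemma psi_0 [simp]: "psi 0 = 0"
  by (simp add: levy_exponent_def)

text \<open>The constant involves \<alpha> only. This is what makes \<open>gap\<close> a lower bound
  for all coefficients at once.\<close>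

lemma psi_le:
  "psi \<xi> \<le> 4 * (LBINT y. jump_size \<alpha> y / \<bar>y\<bar> powr (1 + \<alpha>)) * (1 + \<xi>\<^sup>2)"
proof -
  have "psi \<xi> \<le> (LBINT y. 4 * (1 + \<xi>\<^sup>2) * (jump_size \<alpha> y / \<bar>y\<bar> powr (1 + \<alpha>)))"
    unfolding levy_exponent_def
    by (intro integral_mono integrable_levy integrable_mult_right integrable_jump_size alpha
          order_trans[OF abs_ge_self cos_domination])
  also have "\<dots> = 4 * (1 + \<xi>\<^sup>2) * (LBINT y. jump_size \<alpha> y / \<bar>y\<bar> powr (1 + \<alpha>))"
    by (rule integral_mult_right_zero)
  finally show ?thesis by (simp only: mult_ac)
qed

text \<open>Only jumps between r/2 and r with r = 1/\<bar>\<xi>\<bar> are kept. There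
  \<bar>\<xi>\<bar> y lies in [1/2, 1] and the Levy density is at least r^(-1-\<alpha>) because
  \<kappa> \<ge> 1; the interval has length r/2. All decay of the characteristic function comes from
  this bound.\<close>

lemma psi_ge: "(1 - cos (1/2)) / 2 * \<bar>\<xi>\<bar> powr \<alpha> \<le> psi \<xi>"
proof (cases "\<xi> = 0")
  case False
  define r where "r = 1 / \<bar>\<xi>\<bar>"
  have r: "r > 0" using False by (simp add: r_def)
  define k where "k = (1 - cos (1/2)) / r powr (1 + \<alpha>)"
  have "k * (r / 2) = (LBINT y. k * indicator {r/2..r} y)"
    using r by simp
  also have "\<dots> \<le> (LBINT y. (1 - cos (\<xi> * y)) * nu y)"
  proof (intro integral_mono integrable_levy)
    show "integrable lborel (\<lambda>y. k * indicator {r / 2..r} y)"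
      using r by (intro integrable_mult_right integrable_real_indicator) auto
    fix y
    show "k * indicator {r / 2..r} y \<le> (1 - cos (\<xi> * y)) * nu y"
    proof (cases "y \<in> {r/2..r}")
      case True
      then have y: "0 < y" "r/2 \<le> y" "y \<le> r" using r by auto
      have "1/2 \<le> \<bar>\<xi>\<bar> * y" "\<bar>\<xi>\<bar> * y \<le> 1"
        using y False by (simp_all add: r_def field_simps)
      then have "cos (\<bar>\<xi>\<bar> * y) \<le> cos (1/2)"
        using pi_gt3 by (intro cos_monotone_0_pi_le) auto
      moreover have "cos (\<bar>\<xi>\<bar> * y) = cos (\<xi> * y)"
        using y by (metis abs_mult abs_of_pos cos_abs_real)
      ultimately have "1 - cos (1/2) \<le> 1 - cos (\<xi> * y)" by simp
      moreover have "1 / r powr (1 + \<alpha>) \<le> nu y"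
        using y r alpha kappa_bounds(1)[of y] by (intro frac_le powr_mono2) auto
      ultimately have "(1 - cos (1/2)) * (1 / r powr (1 + \<alpha>)) \<le> (1 - cos (\<xi> * y)) * nu y"
        using one_minus_cos_bounds(1) by (intro mult_mono) auto
      then show ?thesis using True by (simp add: k_def)
    next
      case False
      then show ?thesis
        using mult_nonneg_nonneg[OF one_minus_cos_bounds(1)[of "\<xi> * y"] nu_nonneg[of y]] by simp
    qed
  qed
  also have "\<dots> = psi \<xi>" by (simp add: levy_exponent_def)
  also have "k * (r / 2) = (1 - cos (1/2)) / 2 * \<bar>\<xi>\<bar> powr \<alpha>"
  proof -
    have "r powr (1 + \<alpha>) = r * r powr \<alpha>" using r by (simp add: powr_add)
    moreover have "r powr \<alpha> = 1 / \<bar>\<xi>\<bar> powr \<alpha>" by (simp add: r_def powr_divide)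
    ultimately show ?thesis using r by (simp add: k_def)
  qed
  finally show ?thesis .
qed simp

lemma continuous_psi: "continuous_on UNIV psi"
proof (rule continuous_at_imp_continuous_on, rule ballI)
  fix \<xi> :: real
  show "isCont psi \<xi>"
    unfolding continuous_at_sequentially comp_def
  proof (intro allI impI)
    fix f :: "nat \<Rightarrow> real" assume f: "f \<longlonglongrightarrow> \<xi>"
    \<comment> \<open>Boundedness of the convergent sequence makes the quadratic majorant uniform in
      n.\<close>
    then obtain M where M: "\<And>n. \<bar>f n\<bar> \<le> M"
      using convergent_imp_Bseq[of f] unfolding Bseq_def convergent_def by auto
    show "(\<lambda>n. psi (f n)) \<longlonglongrightarrow> psi \<xi>"
      unfolding levy_exponent_def
    proof (rule integral_dominated_convergence)
      show "integrable lborel (\<lambda>y. 4 * (1 + M\<^sup>2) * (jump_size \<alpha> y / \<bar>y\<bar> powr (1 + \<alpha>)))"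
        by (intro integrable_mult_right integrable_jump_size alpha)
      show "AE y in lborel. (\<lambda>n. (1 - cos (f n * y)) * nu y) \<longlonglongrightarrow> (1 - cos (\<xi> * y)) * nu y"
        by (intro AE_I2 tendsto_intros f)
      fix n
      have "(f n)\<^sup>2 \<le> M\<^sup>2" using M[of n] by (metis abs_ge_zero power2_abs power_mono)
      then have "4 * (1 + (f n)\<^sup>2) * (jump_size \<alpha> y / \<bar>y\<bar> powr (1 + \<alpha>)) \<le>
          4 * (1 + M\<^sup>2) * (jump_size \<alpha> y / \<bar>y\<bar> powr (1 + \<alpha>))" for y
        by (intro mult_right_mono) (auto simp: jump_size_nonneg)
      then show "AE y in lborel. norm ((1 - cos (f n * y)) * nu y) \<le>
          4 * (1 + M\<^sup>2) * (jump_size \<alpha> y / \<bar>y\<bar> powr (1 + \<alpha>))"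
        using cos_domination[of "f n"] by (intro AE_I2) (auto intro: order_trans)
    qed auto
  qed
qed

lemma measurable_psi [measurable]: "psi \<in> borel_measurable borel"
  by (rule borel_measurable_continuous_onI[OF continuous_psi])

end

section \<open>Cosine transforms\<close>

lemma integrable_bounded_mult:
  fixes f g :: "real \<Rightarrow> real"
  assumes "integrable lborel f" and [measurable]: "g \<in> borel_measurable borel"
    and "\<And>\<xi>. \<bar>g \<xi>\<bar> \<le> B"
  shows "integrable lborel (\<lambda>\<xi>. g \<xi> * f \<xi>)"
proof (rule Bochner_Integration.integrable_bound[OF integrable_mult_right[OF integrable_abs[OF assms(1)], of B]])
  have "0 \<le> B" using assms(3)[of 0] by linarith
  then show "AE \<xi> in lborel. norm (g \<xi> * f \<xi>) \<le> norm (B * \<bar>f \<xi>\<bar>)"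
    using assms(3) by (intro AE_I2) (auto simp: abs_mult intro!: mult_right_mono)
qed (use assms(1) in measurable)

lemma integrable_cos_mult:
  fixes f g :: "real \<Rightarrow> real"
  assumes "integrable lborel f" and [measurable]: "g \<in> borel_measurable borel"
  shows "integrable lborel (\<lambda>\<xi>. cos (g \<xi>) * f \<xi>)"
  by (rule integrable_bounded_mult[OF assms(1), where B = 1]) auto

lemma integrable_pair_mult:
  fixes f g :: "real \<Rightarrow> real"
  assumes f: "integrable lborel f" and g: "integrable lborel g"
  shows "integrable (lborel \<Otimes>\<^sub>M lborel) (\<lambda>(x, y). f x * g y)"
proof (rule lborel_pair.Fubini_integrable)
  have [measurable]: "f \<in> borel_measurable borel" "g \<in> borel_measurable borel" using f g by auto
  show "(\<lambda>(x, y). f x * g y) \<in> borel_measurable (lborel \<Otimes>\<^sub>M lborel)" by measurable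
qed (use f g in \<open>auto simp: abs_mult intro!: integrable_mult_left integrable_abs\<close>)

text \<open>Replaces differentiation under the integral sign: it is enough to integrate a pointwise
  bound of the second-order remainder.\<close>

lemma DERIV_quadratic_remainder:
  fixes f :: "real \<Rightarrow> real"
  assumes "\<And>h. \<bar>h\<bar> < \<delta> \<Longrightarrow> \<bar>f (x + h) - f x - h * D\<bar> \<le> M * h\<^sup>2" "0 < \<delta>"
  shows "(f has_real_derivative D) (at x)"
  unfolding DERIV_def
proof (rule LIM_zero_cancel, rule tendsto_0_le[where K = 1])
  show "((\<lambda>h. M * \<bar>h\<bar>) \<longlongrightarrow> 0) (at 0)"
    by (rule tendsto_eq_intros refl | simp)+
  have "norm ((f (x + h) - f x) / h - D) \<le> norm (M * \<bar>h\<bar>) * 1" if "h \<noteq> 0" "\<bar>h\<bar> < \<delta>" for h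
  proof -
    have "norm ((f (x + h) - f x) / h - D) = \<bar>f (x + h) - f x - h * D\<bar> / \<bar>h\<bar>"
      using that by (simp add: field_simps flip: abs_divide)
    also have "\<dots> \<le> (M * h\<^sup>2) / \<bar>h\<bar>"
      by (intro divide_right_mono assms that) auto
    also have "\<dots> = M * \<bar>h\<bar>" using that by (simp add: power2_eq_square abs_real_def)
    finally show ?thesis by simp
  qed
  then show "\<forall>\<^sub>F h in at 0. norm ((f (x + h) - f x) / h - D) \<le> norm (M * \<bar>h\<bar>) * 1"
    using assms(2) by (auto simp: eventually_at dist_real_def intro!: exI[of _ \<delta>])
qed

text \<open>The phase n pi / 2 encodes the n-th derivative of the cosine, so that differentiation in
  x just raises n. The factor 1 / (2 pi) is that of Fourier inversion.\<close>

definition cos_transform :: "nat \<Rightarrow> (real \<Rightarrow> real) \<Rightarrow> real \<Rightarrow> real" where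
  "cos_transform n G x = (LBINT \<xi>. cos (\<xi> * x + n * (pi / 2)) * (\<xi> ^ n * G \<xi>)) / (2 * pi)"

lemma cos_transform_0: "cos_transform 0 G x = (LBINT \<xi>. cos (\<xi> * x) * G \<xi>) / (2 * pi)"
  by (simp add: cos_transform_def)

lemma cos_transform_1: "cos_transform 1 G x = - (LBINT \<xi>. sin (\<xi> * x) * (\<xi> * G \<xi>)) / (2 * pi)"
  by (simp add: cos_transform_def cos_add)

text \<open>Under the integral the remainder is that of the cosine, at most h^2 times the moment of
  order n + 2.\<close>

lemma cos_transform_has_derivative:
  assumes int: "\<And>k. integrable lborel (\<lambda>\<xi>. \<xi> ^ k * G \<xi>)"
  shows "(cos_transform n G has_real_derivative cos_transform (Suc n) G x) (at x)"
proof (rule DERIV_quadratic_remainder[of 1])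
  define M where "M = (LBINT \<xi>. \<bar>\<xi> ^ (n + 2) * G \<xi>\<bar>) / (2 * pi)"
  fix h :: real
  define f where "f k x \<xi> = cos (\<xi> * x + real k * (pi / 2)) * (\<xi> ^ k * G \<xi>)" for k x \<xi>
  have f: "integrable lborel (f k x)" for k x
    unfolding f_def by (intro integrable_cos_mult int) auto
  have ct: "cos_transform k G x = (LBINT \<xi>. f k x \<xi>) / (2 * pi)" for k x
    by (simp only: cos_transform_def f_def)
  have bound: "\<bar>f n (x + h) \<xi> - f n x \<xi> - h * f (Suc n) x \<xi>\<bar> \<le> h\<^sup>2 * \<bar>\<xi> ^ (n + 2) * G \<xi>\<bar>" for \<xi>
  proof -
    define u where "u = \<xi> * x + real n * (pi / 2)"
    have "cos (\<xi> * (x + h) + real n * (pi / 2)) = cos (u + \<xi> * h)"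
      by (simp add: u_def algebra_simps)
    moreover have "cos (\<xi> * x + real (Suc n) * (pi / 2)) = - sin u"
    proof -
      have "\<xi> * x + real (Suc n) * (pi / 2) = u + pi / 2" by (simp add: u_def algebra_simps)
      then show ?thesis by (simp only: cos_add) simp
    qed
    ultimately have "f n (x + h) \<xi> - f n x \<xi> - h * f (Suc n) x \<xi> =
        (cos (u + \<xi> * h) - cos u + (\<xi> * h) * sin u) * (\<xi> ^ n * G \<xi>)"
      by (simp add: f_def u_def algebra_simps)
    also have "\<bar>\<dots>\<bar> \<le> (\<xi> * h)\<^sup>2 * \<bar>\<xi> ^ n * G \<xi>\<bar>"
      unfolding abs_mult[of "_ + _"] by (intro mult_right_mono abs_cos_remainder) auto
    also have "\<dots> = h\<^sup>2 * \<bar>\<xi> ^ (n + 2) * G \<xi>\<bar>"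
      by (simp add: abs_mult power_mult_distrib power_add power2_eq_square)
    finally show ?thesis .
  qed
  have "cos_transform n G (x + h) - cos_transform n G x - h * cos_transform (Suc n) G x =
      (LBINT \<xi>. f n (x + h) \<xi> - f n x \<xi> - h * f (Suc n) x \<xi>) / (2 * pi)"
    using f by (simp add: ct diff_divide_distrib)
  also have "\<bar>\<dots>\<bar> \<le> (LBINT \<xi>. h\<^sup>2 * \<bar>\<xi> ^ (n + 2) * G \<xi>\<bar>) / (2 * pi)"
    unfolding abs_divide
  proof (rule frac_le)
    show "\<bar>LBINT \<xi>. f n (x + h) \<xi> - f n x \<xi> - h * f (Suc n) x \<xi>\<bar>
        \<le> (LBINT \<xi>. h\<^sup>2 * \<bar>\<xi> ^ (n + 2) * G \<xi>\<bar>)"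
      by (rule order_trans[OF integral_abs_bound], rule integral_mono)
         (use f int[of "n + 2"] bound in \<open>auto intro!: integrable_mult_right integrable_abs Bochner_Integration.integrable_diff\<close>)
  qed auto
  also have "\<dots> = M * h\<^sup>2" by (simp add: M_def)
  finally show "\<bar>cos_transform n G (x + h) - cos_transform n G x - h * cos_transform (Suc n) G x\<bar> \<le> M * h\<^sup>2" .
qed simp

lemma deriv_cos_transform:
  assumes "\<And>k. integrable lborel (\<lambda>\<xi>. \<xi> ^ k * G \<xi>)"
  shows "(deriv ^^ n) (cos_transform 0 G) = cos_transform n G"
proof (induction n)
  case (Suc n)
  have "deriv (cos_transform n G) = cos_transform (Suc n) G"
    by (intro ext DERIV_imp_deriv cos_transform_has_derivative assms)
  then show ?case by (simp add: Suc.IH)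
qed simp

section \<open>Gaussian integrals\<close>

lemma integral_cos_std_normal: "(LBINT x. cos (t * x) * std_normal_density x) = exp (- t\<^sup>2 / 2)"
proof -
  interpret real_distribution std_normal_distribution by (rule real_dist_normal_dist)
  have "Re (char std_normal_distribution t) = (LINT x|std_normal_distribution. Re (iexp (t * x)))"
    unfolding char_def by (rule integral_Re[symmetric]) (rule integrable_iexp, auto)
  also have "\<dots> = (LBINT x. std_normal_density x * cos (t * x))"
    by (subst integral_density) (auto simp: Re_exp)
  finally show ?thesis by (simp add: char_std_normal_distribution mult.commute)
qed

lemma integrable_gaussian: "\<sigma> > 0 \<Longrightarrow> integrable lborel (\<lambda>x::real. exp (- (\<sigma> * x)\<^sup>2 / 2))"
proof -
  assume "\<sigma> > 0"
  then have "integrable lborel (\<lambda>x. std_normal_density (0 + \<sigma> * x))"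
    by (intro lborel_integrable_real_affine) auto
  from integrable_mult_right[OF this, of "sqrt (2 * pi)"] show ?thesis
    by (simp add: std_normal_density_def)
qed

lemma integral_cos_gaussian:
  assumes "\<sigma> > 0"
  shows "(LBINT x. cos (\<xi> * x) * exp (- (\<sigma> * x)\<^sup>2 / 2)) = 2 * pi * (std_normal_density (\<xi> / \<sigma>) / \<sigma>)"
proof -
  have "(LBINT x. cos (\<xi> / \<sigma> * x) * std_normal_density x) =
      \<bar>\<sigma>\<bar> *\<^sub>R (LBINT x. cos (\<xi> / \<sigma> * (0 + \<sigma> * x)) * std_normal_density (0 + \<sigma> * x))"
    using assms by (intro lborel_integral_real_affine) auto
  also have "\<dots> = \<sigma> * (LBINT x. (1 / sqrt (2 * pi)) * (cos (\<xi> * x) * exp (- (\<sigma> * x)\<^sup>2 / 2)))"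
    using assms by (simp add: std_normal_density_def mult_ac)
  also have "\<dots> = \<sigma> / sqrt (2 * pi) * (LBINT x. cos (\<xi> * x) * exp (- (\<sigma> * x)\<^sup>2 / 2))"
    by (subst integral_mult_right_zero) simp
  finally have "\<sigma> / sqrt (2 * pi) * (LBINT x. cos (\<xi> * x) * exp (- (\<sigma> * x)\<^sup>2 / 2)) = exp (- (\<xi> / \<sigma>)\<^sup>2 / 2)"
    unfolding integral_cos_std_normal by simp
  then have "(LBINT x. cos (\<xi> * x) * exp (- (\<sigma> * x)\<^sup>2 / 2)) = sqrt (2 * pi) / \<sigma> * exp (- (\<xi> / \<sigma>)\<^sup>2 / 2)"
    using assms by (simp add: field_simps)
  also have "\<dots> = 2 * pi * (std_normal_density (\<xi> / \<sigma>) / \<sigma>)"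
    using assms by (simp add: std_normal_density_def field_simps flip: power2_eq_square)
  finally show ?thesis .
qed

section \<open>Positivity\<close>

text \<open>For even integrable \<open>G\<close> this is nonnegativity of the inverse Fourier
  transform; only the sign is recorded, so that it passes easily to limits.\<close>

definition nonneg_cos_transform :: "(real \<Rightarrow> real) \<Rightarrow> bool" where
  "nonneg_cos_transform G \<longleftrightarrow> (\<forall>x. 0 \<le> (LBINT \<xi>. cos (\<xi> * x) * G \<xi>))"

text \<open>Dominated convergence. It serves three limits: powers to exponential, cut-off Levy
  measures to the full one, and the removal of a Gaussian factor.\<close>

lemma nonneg_cos_transform_limit:
  assumes "\<And>n. nonneg_cos_transform (s n)" "integrable lborel w"
    and "\<And>n. s n \<in> borel_measurable borel" "G \<in> borel_measurable borel"
    and "\<And>\<xi>. (\<lambda>n. s n \<xi>) \<longlonglongrightarrow> G \<xi>" "\<And>n \<xi>. \<bar>s n \<xi>\<bar> \<le> w \<xi>"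
  shows "nonneg_cos_transform G"
  unfolding nonneg_cos_transform_def
proof
  fix x
  note [measurable] = assms(3,4)
  have "(\<lambda>n. LBINT \<xi>. cos (\<xi> * x) * s n \<xi>) \<longlonglongrightarrow> (LBINT \<xi>. cos (\<xi> * x) * G \<xi>)"
  proof (rule integral_dominated_convergence[OF _ _ assms(2)])
    show "AE \<xi> in lborel. (\<lambda>n. cos (\<xi> * x) * s n \<xi>) \<longlonglongrightarrow> cos (\<xi> * x) * G \<xi>"
      by (intro AE_I2 tendsto_intros assms)
    have "\<bar>cos (\<xi> * x)\<bar> * \<bar>s n \<xi>\<bar> \<le> 1 * w \<xi>" for n \<xi>
      by (intro mult_mono assms) auto
    then show "AE \<xi> in lborel. norm (cos (\<xi> * x) * s n \<xi>) \<le> w \<xi>" for n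
      by (simp add: abs_mult)
  qed auto
  then show "0 \<le> (LBINT \<xi>. cos (\<xi> * x) * G \<xi>)"
    using assms(1) by (intro LIMSEQ_le_const) (auto simp: nonneg_cos_transform_def)
qed

lemma cos_integral_bound:
  fixes w :: "real \<Rightarrow> real"
  assumes "\<And>y. 0 \<le> w y" "integrable lborel w"
  shows "\<bar>LBINT y. cos (\<xi> * y) * w y\<bar> \<le> (LBINT y. w y)"
proof -
  have "\<bar>cos (\<xi> * y)\<bar> * w y \<le> 1 * w y" for y
    by (intro mult_right_mono assms) auto
  then show ?thesis
    by (intro order_trans[OF integral_abs_bound] integral_mono integrable_abs integrable_cos_mult assms)
       (auto simp: abs_mult assms)
qed

text \<open>Multiplication by the cosine transform of \<open>w\<close> is convolution with the
  symmetrized \<open>w\<close>. After Fubini, the product formula for cosines leaves, for each y, w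
  y / 2 times the sum of the transform of \<open>H\<close> at x - y and at x + y.\<close>

lemma nonneg_cos_transform_mult:
  assumes H: "integrable lborel H" "nonneg_cos_transform H"
    and w: "\<And>y. 0 \<le> w y" "integrable lborel w"
  shows "nonneg_cos_transform (\<lambda>\<xi>. H \<xi> * (LBINT y. cos (\<xi> * y) * w y))"
  unfolding nonneg_cos_transform_def
proof
  fix x
  have [measurable]: "H \<in> borel_measurable borel" "w \<in> borel_measurable borel"
    using H(1) w(2) by auto
  define F where "F = (\<lambda>(\<xi>, y). cos (\<xi> * x) * H \<xi> * (cos (\<xi> * y) * w y))"
  have F [measurable]: "F \<in> borel_measurable (lborel \<Otimes>\<^sub>M lborel)"
    unfolding F_def by measurable
  have "integrable (lborel \<Otimes>\<^sub>M lborel) (\<lambda>(\<xi>, y). H \<xi> * w y)"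
    by (rule integrable_pair_mult[OF H(1) w(2)])
  then have int: "integrable (lborel \<Otimes>\<^sub>M lborel) F"
  proof (rule Bochner_Integration.integrable_bound)
    have "\<bar>cos (\<xi> * x)\<bar> * \<bar>cos (\<xi> * y)\<bar> * (\<bar>H \<xi>\<bar> * \<bar>w y\<bar>) \<le> 1 * 1 * (\<bar>H \<xi>\<bar> * \<bar>w y\<bar>)" for \<xi> y
      by (intro mult_right_mono mult_mono) auto
    then show "AE z in lborel \<Otimes>\<^sub>M lborel. norm (F z) \<le> norm (case z of (\<xi>, y) \<Rightarrow> H \<xi> * w y)"
      by (intro AE_I2) (auto simp: F_def abs_mult mult_ac)
  qed simp
  have "(LBINT \<xi>. cos (\<xi> * x) * (H \<xi> * (LBINT y. cos (\<xi> * y) * w y))) = (LBINT \<xi>. LBINT y. F (\<xi>, y))"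
    by (simp add: F_def flip: mult.assoc integral_mult_right_zero)
  also have "\<dots> = (LBINT y. LBINT \<xi>. F (\<xi>, y))"
    using lborel_pair.Fubini_integral[of "\<lambda>\<xi> y. F (\<xi>, y)"] int by simp
  also have "\<dots> \<ge> 0"
  proof (rule integral_nonneg_AE, rule AE_I2)
    fix y
    have "F (\<xi>, y) = w y / 2 * (cos (\<xi> * (x - y)) * H \<xi> + cos (\<xi> * (x + y)) * H \<xi>)" for \<xi>
      by (simp add: F_def right_diff_distrib distrib_left cos_add cos_diff field_simps)
    then have "(LBINT \<xi>. F (\<xi>, y)) =
        w y / 2 * ((LBINT \<xi>. cos (\<xi> * (x - y)) * H \<xi>) + (LBINT \<xi>. cos (\<xi> * (x + y)) * H \<xi>))"
      using integrable_cos_mult[OF H(1)] by (simp only:) simp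
    also have "\<dots> \<ge> 0"
      using H(2) w(1) by (auto simp: nonneg_cos_transform_def intro!: mult_nonneg_nonneg add_nonneg_nonneg)
    finally show "0 \<le> (LBINT \<xi>. F (\<xi>, y))" .
  qed
  finally show "0 \<le> (LBINT \<xi>. cos (\<xi> * x) * (H \<xi> * (LBINT y. cos (\<xi> * y) * w y)))" .
qed

text \<open>The constant \<open>c\<close> stands for an atom at the origin, so the base of the power
  is the transform of a positive measure and each further factor is one more convolution.\<close>

lemma nonneg_cos_transform_power:
  assumes H: "integrable lborel H" "nonneg_cos_transform H"
    and w: "\<And>y. 0 \<le> w y" "integrable lborel w" and c: "0 \<le> c"
  shows "integrable lborel (\<lambda>\<xi>. H \<xi> * (c + (LBINT y. cos (\<xi> * y) * w y)) ^ n)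
    \<and> nonneg_cos_transform (\<lambda>\<xi>. H \<xi> * (c + (LBINT y. cos (\<xi> * y) * w y)) ^ n)"
proof (induction n)
  case (Suc n)
  define K where "K \<xi> = H \<xi> * (c + (LBINT y. cos (\<xi> * y) * w y)) ^ n" for \<xi>
  define W where "W \<xi> = (LBINT y. cos (\<xi> * y) * w y)" for \<xi>
  have [measurable]: "w \<in> borel_measurable borel" using w(2) by auto
  have [measurable]: "W \<in> borel_measurable borel" unfolding W_def by measurable
  have K: "integrable lborel K" "nonneg_cos_transform K" using Suc by (simp_all add: K_def[abs_def])
  have WK: "integrable lborel (\<lambda>\<xi>. W \<xi> * K \<xi>)"
    by (rule integrable_bounded_mult[OF K(1), where B = "LBINT y. w y"])
       (use cos_integral_bound[OF w] in \<open>auto simp: W_def\<close>)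
  have eq: "H \<xi> * (c + (LBINT y. cos (\<xi> * y) * w y)) ^ Suc n = c * K \<xi> + W \<xi> * K \<xi>" for \<xi>
    by (simp add: K_def W_def algebra_simps)
  have "(LBINT \<xi>. cos (\<xi> * x) * (c * K \<xi> + W \<xi> * K \<xi>)) =
     c * (LBINT \<xi>. cos (\<xi> * x) * K \<xi>) + (LBINT \<xi>. cos (\<xi> * x) * (W \<xi> * K \<xi>))" for x
  proof -
    have "(LBINT \<xi>. cos (\<xi> * x) * (c * K \<xi> + W \<xi> * K \<xi>)) =
       (LBINT \<xi>. c * (cos (\<xi> * x) * K \<xi>) + cos (\<xi> * x) * (W \<xi> * K \<xi>))"
      by (intro Bochner_Integration.integral_cong) (simp_all add: algebra_simps)
    also have "\<dots> = (LBINT \<xi>. c * (cos (\<xi> * x) * K \<xi>)) + (LBINT \<xi>. cos (\<xi> * x) * (W \<xi> * K \<xi>))"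
      by (intro Bochner_Integration.integral_add integrable_mult_right integrable_cos_mult K WK) auto
    finally show ?thesis by simp
  qed
  moreover have "nonneg_cos_transform (\<lambda>\<xi>. W \<xi> * K \<xi>)"
    using nonneg_cos_transform_mult[OF K w] by (simp add: W_def mult.commute)
  ultimately have "nonneg_cos_transform (\<lambda>\<xi>. c * K \<xi> + W \<xi> * K \<xi>)"
    using K(2) c by (auto simp: nonneg_cos_transform_def)
  then show ?case
    unfolding eq using K(1) WK by (auto intro!: Bochner_Integration.integrable_add integrable_mult_right)
qed (use H in simp)

text \<open>A compound Poisson factor is the limit of the powers \<open>(1 - \<psi>/n)^n\<close>, each of which multiplies
  the transform by a positive measure once \<open>n\<close> exceeds the total mass.\<close>

lemma nonneg_cos_transform_compound_Poisson:
  assumes H: "integrable lborel H" "nonneg_cos_transform H"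
    and w: "\<And>y. 0 \<le> w y" "integrable lborel w"
  shows "nonneg_cos_transform (\<lambda>\<xi>. H \<xi> * exp (- (LBINT y. (1 - cos (\<xi> * y)) * w y)))"
proof -
  define m where "m = (LBINT y. w y)"
  define W where "W \<xi> = (LBINT y. cos (\<xi> * y) * w y)" for \<xi>
  \<comment> \<open>Shifting the index by \<open>N\<close> makes n + N at least the total mass
    \<open>m\<close> for every n.\<close>
  define N where "N = nat \<lceil>m\<rceil> + 1"
  have N: "m \<le> real (n + N)" "0 < real (n + N)" for n unfolding N_def by linarith+
  have [measurable]: "H \<in> borel_measurable borel" "w \<in> borel_measurable borel"
    using H(1) w(2) by auto
  have [measurable]: "W \<in> borel_measurable borel" unfolding W_def by measurable
  have psi: "(LBINT y. (1 - cos (\<xi> * y)) * w y) = m - W \<xi>" for \<xi>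
    using w(2) integrable_cos_mult[OF w(2), of "\<lambda>y. \<xi> * y"]
    by (simp add: left_diff_distrib W_def m_def)
  have W: "\<bar>W \<xi>\<bar> \<le> m" for \<xi> unfolding W_def m_def by (rule cos_integral_bound[OF w])
  \<comment> \<open>Atom of weight 1 - m / (n + N) at the origin plus density w / (n + N); the
    weight is nonnegative by the choice of \<open>N\<close>.\<close>
  have eq: "1 + - (m - W \<xi>) / real (n + N) =
      (1 - m / real (n + N)) + (LBINT y. cos (\<xi> * y) * (w y / real (n + N)))" for \<xi> n
    unfolding times_divide_eq_right integral_divide_zero W_def by (simp add: diff_divide_distrib)
  show ?thesis
    unfolding psi
  proof (rule nonneg_cos_transform_limit[where w = "\<lambda>\<xi>. \<bar>H \<xi>\<bar>" and
        s = "\<lambda>n \<xi>. H \<xi> * (1 + - (m - W \<xi>) / real (n + N)) ^ (n + N)"])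
    fix n \<xi>
    show "nonneg_cos_transform (\<lambda>\<xi>. H \<xi> * (1 + - (m - W \<xi>) / real (n + N)) ^ (n + N))"
      unfolding eq using N[of n] w
      by (intro nonneg_cos_transform_power[THEN conjunct2] H) (auto simp: divide_le_eq)
    show "(\<lambda>n. H \<xi> * (1 + - (m - W \<xi>) / real (n + N)) ^ (n + N)) \<longlonglongrightarrow> H \<xi> * exp (- (m - W \<xi>))"
      by (intro tendsto_intros LIMSEQ_ignore_initial_segment[OF tendsto_exp_limit_sequentially])
    \<comment> \<open>The base of the power stays in [-1, 1], so \<open>H\<close> itself supplies
      the majorant.\<close>
    have "0 \<le> m - W \<xi>" "m - W \<xi> \<le> 2 * real (n + N)" using W[of \<xi>] N(1)[of n] by auto
    then have "\<bar>1 + - (m - W \<xi>) / real (n + N)\<bar> \<le> 1"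
      using N(2)[of n] by (auto simp: abs_le_iff field_simps)
    then have "\<bar>H \<xi>\<bar> * \<bar>1 + - (m - W \<xi>) / real (n + N)\<bar> ^ (n + N) \<le> \<bar>H \<xi>\<bar> * 1"
      by (intro mult_left_mono power_le_one) auto
    then show "\<bar>H \<xi> * (1 + - (m - W \<xi>) / real (n + N)) ^ (n + N)\<bar> \<le> \<bar>H \<xi>\<bar>"
      by (simp add: abs_mult power_abs)
  qed (use H(1) in auto)
qed

lemma nonneg_cos_transform_gaussian:
  assumes "\<sigma> > 0"
  shows "nonneg_cos_transform (\<lambda>\<xi>. exp (- (\<sigma> * \<xi>)\<^sup>2 / 2))"
  using assms integral_cos_gaussian[OF assms]
  by (auto simp: nonneg_cos_transform_def mult.commute std_normal_density_def)

text \<open>Inversion with Gaussian summation: damping the transform by \<open>exp (- (\<sigma> x)\<^sup>2 / 2)\<close> averages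
  \<open>G\<close> against a Gaussian of width \<open>\<sigma>\<close>.\<close>

lemma measurable_cos_transform [measurable]:
  assumes [measurable]: "G \<in> borel_measurable borel"
  shows "cos_transform n G \<in> borel_measurable borel"
  unfolding cos_transform_def[abs_def] by measurable

lemma gaussian_inversion:
  assumes G: "integrable lborel G" and "\<sigma> > 0"
  shows "(LBINT x. cos (\<eta> * x) * exp (- (\<sigma> * x)\<^sup>2 / 2) * cos_transform 0 G x) =
    ((LBINT z. G (\<eta> + \<sigma> * z) * std_normal_density z)
      + (LBINT z. G (- \<eta> + \<sigma> * z) * std_normal_density z)) / 2"
proof -
  define e where "e x = exp (- (\<sigma> * x)\<^sup>2 / 2)" for x
  have e: "integrable lborel e" unfolding e_def[abs_def] by (rule integrable_gaussian) fact
  have [measurable]: "G \<in> borel_measurable borel" "e \<in> borel_measurable borel" using G e by auto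
  define F where "F = (\<lambda>(x, \<xi>). cos (\<eta> * x) * e x * (cos (\<xi> * x) * G \<xi>))"
  have F [measurable]: "F \<in> borel_measurable (lborel \<Otimes>\<^sub>M lborel)"
    unfolding F_def by measurable
  have "integrable (lborel \<Otimes>\<^sub>M lborel) (\<lambda>(x, \<xi>). e x * G \<xi>)"
    by (rule integrable_pair_mult[OF e G])
  then have int: "integrable (lborel \<Otimes>\<^sub>M lborel) F"
  proof (rule Bochner_Integration.integrable_bound)
    have "\<bar>cos (\<eta> * x)\<bar> * \<bar>cos (\<xi> * x)\<bar> * (\<bar>e x\<bar> * \<bar>G \<xi>\<bar>) \<le> 1 * 1 * (\<bar>e x\<bar> * \<bar>G \<xi>\<bar>)" for \<xi> x
      by (intro mult_right_mono mult_mono) auto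
    then show "AE z in lborel \<Otimes>\<^sub>M lborel. norm (F z) \<le> norm (case z of (x, \<xi>) \<Rightarrow> e x * G \<xi>)"
      by (intro AE_I2) (auto simp: F_def abs_mult mult_ac)
  qed simp
  \<comment> \<open>The product of cosines splits into frequencies \<xi> - \<eta> and \<xi> +
    \<eta>, which gives one Gaussian centred at \<eta> and one at -\<eta>.\<close>
  have inner: "(LBINT x. F (x, \<xi>)) = pi * (G \<xi> * std_normal_density ((\<xi> - \<eta>) / \<sigma>) / \<sigma>)
      + pi * (G \<xi> * std_normal_density ((\<xi> - (- \<eta>)) / \<sigma>) / \<sigma>)" for \<xi>
  proof -
    have "F (x, \<xi>) = G \<xi> / 2 * (cos ((\<xi> - \<eta>) * x) * e x + cos ((\<xi> - (- \<eta>)) * x) * e x)" for x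
      by (simp add: F_def left_diff_distrib distrib_right cos_add cos_diff field_simps)
    then have "(LBINT x. F (x, \<xi>)) =
        G \<xi> / 2 * ((LBINT x. cos ((\<xi> - \<eta>) * x) * e x) + (LBINT x. cos ((\<xi> - (- \<eta>)) * x) * e x))"
      using integrable_cos_mult[OF e] by (simp only:) simp
    then show ?thesis
      unfolding e_def integral_cos_gaussian[OF \<open>\<sigma> > 0\<close>] by (simp add: algebra_simps)
  qed
  have "(LBINT x. cos (\<eta> * x) * e x * cos_transform 0 G x) = (LBINT x. (LBINT \<xi>. F (x, \<xi>)) / (2 * pi))"
    by (simp add: F_def cos_transform_0)
  also have "\<dots> = (LBINT x. LBINT \<xi>. F (x, \<xi>)) / (2 * pi)"
    by (rule integral_divide_zero)
  also have "(LBINT x. LBINT \<xi>. F (x, \<xi>)) = (LBINT \<xi>. LBINT x. F (x, \<xi>))"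
    using lborel_pair.Fubini_integral[of "\<lambda>x \<xi>. F (x, \<xi>)"] int by simp
  also have "(LBINT \<xi>. LBINT x. F (x, \<xi>)) = (LBINT \<xi>. pi * (G \<xi> * std_normal_density ((\<xi> - \<eta>) / \<sigma>) / \<sigma>)
      + pi * (G \<xi> * std_normal_density ((\<xi> - (- \<eta>)) / \<sigma>) / \<sigma>))"
    by (simp only: inner)
  also have "(LBINT \<xi>. pi * (G \<xi> * std_normal_density ((\<xi> - \<eta>) / \<sigma>) / \<sigma>)
      + pi * (G \<xi> * std_normal_density ((\<xi> - (- \<eta>)) / \<sigma>) / \<sigma>)) =
      pi * (LBINT z. G (\<eta> + \<sigma> * z) * std_normal_density z)
      + pi * (LBINT z. G (- \<eta> + \<sigma> * z) * std_normal_density z)"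
  proof -
    have 1: "integrable lborel (\<lambda>\<xi>. G \<xi> * std_normal_density ((\<xi> - a) / \<sigma>) / \<sigma>)" for a
    proof -
      have "1 \<le> sqrt (2 * pi)" using pi_gt3 by (intro real_le_rsqrt) simp
      then have "\<bar>std_normal_density x\<bar> \<le> 1" for x
        by (simp add: std_normal_density_def divide_le_eq order_trans[of _ 1])
      from integrable_bounded_mult[OF G _ this, of "\<lambda>\<xi>. (\<xi> - a) / \<sigma>"] show ?thesis
        by (simp add: mult.commute)
    qed
    have 2: "(LBINT \<xi>. G \<xi> * std_normal_density ((\<xi> - a) / \<sigma>) / \<sigma>) =
        (LBINT z. G (a + \<sigma> * z) * std_normal_density z)" for a
      using lborel_integral_real_affine[of \<sigma> "\<lambda>\<xi>. G \<xi> * std_normal_density ((\<xi> - a) / \<sigma>) / \<sigma>" a] \<open>\<sigma> > 0\<close>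
      by simp
    show ?thesis
      by (subst Bochner_Integration.integral_add)
         (intro integrable_mult_right 1, intro integrable_mult_right 1, simp only: integral_mult_right_zero 2)
  qed
  also have "(pi * (LBINT z. G (\<eta> + \<sigma> * z) * std_normal_density z)
      + pi * (LBINT z. G (- \<eta> + \<sigma> * z) * std_normal_density z)) / (2 * pi) =
      ((LBINT z. G (\<eta> + \<sigma> * z) * std_normal_density z)
      + (LBINT z. G (- \<eta> + \<sigma> * z) * std_normal_density z)) / 2"
    by (simp only: distrib_left[symmetric]) simp
  finally show ?thesis by (simp only: e_def)
qed

text \<open>Integrability of the inverse transform p is a conclusion here. Since p \<ge> 0, the
  Gaussian-damped functions increase to p as \<sigma> decreases, and their integrals converge to G
  0, so monotone convergence applies. After that p is its own majorant, and dominated convergence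
  removes the damping at every frequency.\<close>

lemma nonneg_cos_transform_inversion:
  assumes G: "integrable lborel G" "continuous_on UNIV G" "\<And>\<xi>. G (- \<xi>) = G \<xi>" "\<And>\<xi>. \<bar>G \<xi>\<bar> \<le> B"
    and pos: "nonneg_cos_transform G"
  shows "integrable lborel (cos_transform 0 G)"
    and "(LBINT x. cos (\<eta> * x) * cos_transform 0 G x) = G \<eta>"
proof -
  define \<sigma> where "\<sigma> n = 1 / real (Suc n)" for n
  define p where "p = cos_transform 0 G"
  have \<sigma>: "\<sigma> n > 0" for n by (simp add: \<sigma>_def)
  have \<sigma>_lim: "\<sigma> \<longlonglongrightarrow> 0" unfolding \<sigma>_def[abs_def] by (rule LIMSEQ_Suc[OF lim_1_over_n])
  have \<sigma>_mono: "\<sigma> n \<le> \<sigma> m" if "m \<le> n" for m n using that by (simp add: \<sigma>_def frac_le)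
  have [measurable]: "G \<in> borel_measurable borel" using G(1) by auto
  have [measurable]: "p \<in> borel_measurable borel" unfolding p_def by measurable
  have p_nonneg: "0 \<le> p x" for x
    using pos by (simp add: p_def cos_transform_0 nonneg_cos_transform_def)
  have p_bound: "\<bar>p x\<bar> \<le> (LBINT \<xi>. \<bar>G \<xi>\<bar>) / (2 * pi)" for x
    unfolding p_def cos_transform_0 abs_divide
  proof (rule frac_le)
    have "\<bar>cos (\<xi> * x)\<bar> * \<bar>G \<xi>\<bar> \<le> 1 * \<bar>G \<xi>\<bar>" for \<xi>
      by (intro mult_right_mono) auto
    then show "\<bar>LBINT \<xi>. cos (\<xi> * x) * G \<xi>\<bar> \<le> (LBINT \<xi>. \<bar>G \<xi>\<bar>)"
      by (intro order_trans[OF integral_abs_bound] integral_mono integrable_abs integrable_cos_mult G)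
         (auto simp: abs_mult)
  qed auto
  have average: "(\<lambda>n. LBINT z. G (a + \<sigma> n * z) * std_normal_density z) \<longlonglongrightarrow> G a" for a
  proof -
    have "(\<lambda>n. LBINT z. G (a + \<sigma> n * z) * std_normal_density z) \<longlonglongrightarrow> (LBINT z. G a * std_normal_density z)"
    proof (rule integral_dominated_convergence[where w = "\<lambda>z. B * std_normal_density z"])
      have "(\<lambda>n. G (a + \<sigma> n * z)) \<longlonglongrightarrow> G a" for z
      proof -
        have "(\<lambda>n. a + \<sigma> n * z) \<longlonglongrightarrow> a + 0 * z" by (intro tendsto_intros \<sigma>_lim)
        then show ?thesis using G(2) by (intro continuous_on_tendsto_compose[OF G(2)]) auto
      qed
      then show "AE z in lborel. (\<lambda>n. G (a + \<sigma> n * z) * std_normal_density z) \<longlonglongrightarrow> G a * std_normal_density z"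
        by (intro AE_I2 tendsto_intros)
      show "AE z in lborel. norm (G (a + \<sigma> n * z) * std_normal_density z) \<le> B * std_normal_density z" for n
        by (intro AE_I2) (auto simp: abs_mult intro!: mult_right_mono G)
    qed auto
    then show ?thesis by simp
  qed
  have damped: "(\<lambda>n. LBINT x. cos (\<eta> * x) * exp (- (\<sigma> n * x)\<^sup>2 / 2) * p x) \<longlonglongrightarrow> G \<eta>" for \<eta>
  proof -
    have "(\<lambda>n. ((LBINT z. G (\<eta> + \<sigma> n * z) * std_normal_density z)
      + (LBINT z. G (- \<eta> + \<sigma> n * z) * std_normal_density z)) / 2) \<longlonglongrightarrow> (G \<eta> + G (- \<eta>)) / 2"
      by (intro tendsto_intros average) auto
    then show ?thesis
      unfolding p_def gaussian_inversion[OF G(1) \<sigma>] by (simp add: G(3))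
  qed
  have exp_lim: "(\<lambda>n. exp (- (\<sigma> n * x)\<^sup>2 / 2)) \<longlonglongrightarrow> 1" for x
  proof -
    have "(\<lambda>n. exp (- (\<sigma> n * x)\<^sup>2 / 2)) \<longlonglongrightarrow> exp (- (0 * x)\<^sup>2 / 2)" by (intro tendsto_intros \<sigma>_lim) auto
    then show ?thesis by simp
  qed
  show int: "integrable lborel (cos_transform 0 G)"
    unfolding p_def[symmetric]
  proof (rule integrable_monotone_convergence[where f = "\<lambda>n x. exp (- (\<sigma> n * x)\<^sup>2 / 2) * p x" and x = "G 0"])
    show "integrable lborel (\<lambda>x. exp (- (\<sigma> n * x)\<^sup>2 / 2) * p x)" for n
      using integrable_bounded_mult[OF integrable_gaussian[OF \<sigma>[of n]] _ p_bound] by (simp add: mult.commute)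
    show "AE x in lborel. mono (\<lambda>n. exp (- (\<sigma> n * x)\<^sup>2 / 2) * p x)"
    proof (intro AE_I2 monoI mult_right_mono p_nonneg)
      fix x :: real and m n :: nat assume "m \<le> n"
      then have "(\<sigma> n * x)\<^sup>2 \<le> (\<sigma> m * x)\<^sup>2"
        using \<sigma>[of n] \<sigma>_mono[of m n] by (simp add: power_mult_distrib mult_right_mono power_mono less_imp_le)
      then show "exp (- (\<sigma> m * x)\<^sup>2 / 2) \<le> exp (- (\<sigma> n * x)\<^sup>2 / 2)" by simp
    qed
    show "AE x in lborel. (\<lambda>n. exp (- (\<sigma> n * x)\<^sup>2 / 2) * p x) \<longlonglongrightarrow> p x"
      using tendsto_mult_right[OF exp_lim] by (intro AE_I2) fastforce
    show "(\<lambda>n. LBINT x. exp (- (\<sigma> n * x)\<^sup>2 / 2) * p x) \<longlonglongrightarrow> G 0"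
      using damped[of 0] by simp
  qed simp
  have "(\<lambda>n. LBINT x. cos (\<eta> * x) * exp (- (\<sigma> n * x)\<^sup>2 / 2) * p x) \<longlonglongrightarrow> (LBINT x. cos (\<eta> * x) * p x)"
  proof (rule integral_dominated_convergence[where w = p])
    show "AE x in lborel. (\<lambda>n. cos (\<eta> * x) * exp (- (\<sigma> n * x)\<^sup>2 / 2) * p x) \<longlonglongrightarrow> cos (\<eta> * x) * p x"
    proof (rule AE_I2)
      fix x
      have "(\<lambda>n. cos (\<eta> * x) * exp (- (\<sigma> n * x)\<^sup>2 / 2) * p x) \<longlonglongrightarrow> cos (\<eta> * x) * 1 * p x"
        by (intro tendsto_intros exp_lim)
      then show "(\<lambda>n. cos (\<eta> * x) * exp (- (\<sigma> n * x)\<^sup>2 / 2) * p x) \<longlonglongrightarrow> cos (\<eta> * x) * p x" by simp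
    qed
    have "\<bar>cos (\<eta> * x)\<bar> * exp (- (\<sigma> n * x)\<^sup>2 / 2) * p x \<le> 1 * 1 * p x" for n x
      by (intro mult_right_mono mult_mono p_nonneg) auto
    then show "AE x in lborel. norm (cos (\<eta> * x) * exp (- (\<sigma> n * x)\<^sup>2 / 2) * p x) \<le> p x" for n
      by (intro AE_I2) (simp add: abs_mult p_nonneg)
  qed (use int in \<open>auto simp: p_def\<close>)
  from LIMSEQ_unique[OF this damped] show "(LBINT x. cos (\<eta> * x) * cos_transform 0 G x) = G \<eta>"
    by (simp add: p_def)
qed

section \<open>The heat kernel\<close>

lemma exp_quadratic_remainder: "\<bar>exp x - 1 - x\<bar> \<le> exp \<bar>x\<bar> / 2 * (x::real)\<^sup>2"
proof -
  obtain t where t: "\<bar>t\<bar> \<le> \<bar>x\<bar>" "exp x = (\<Sum>m<2. x ^ m / fact m) + exp t / fact 2 * x ^ 2"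
    using Maclaurin_exp_le[of x 2] by blast
  have "exp x - 1 - x = exp t / 2 * x\<^sup>2"
    using t(2) by (simp add: numeral_2_eq_2)
  also have "\<bar>\<dots>\<bar> \<le> exp \<bar>x\<bar> / 2 * x\<^sup>2"
    using t(1) by (simp add: abs_mult mult_right_mono)
  finally show ?thesis .
qed

lemma integral_odd_eq_0:
  fixes f :: "real \<Rightarrow> real"
  assumes "\<And>y. f (- y) = - f y"
  shows "(LBINT y. f y) = 0"
proof -
  have "(LBINT y. f y) = \<bar>-1\<bar> *\<^sub>R (LBINT y. f (0 + (-1) * y))"
    by (rule lborel_integral_real_affine) simp
  also have "\<dots> = - (LBINT y. f y)" by (simp add: assms)
  finally show ?thesis by simp
qed

context stable_like
begin

abbreviation charac :: "real \<Rightarrow> real \<Rightarrow> real" where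
  "charac t \<xi> \<equiv> exp (- (t * psi \<xi>))"

definition heat_kernel :: "real \<Rightarrow> real \<Rightarrow> real" where
  "heat_kernel t = cos_transform 0 (charac t)"

lemma power_charac_decay:
  assumes "t > 0"
  obtains C where "\<And>\<xi>. \<bar>\<xi> ^ k * charac t \<xi>\<bar> \<le> C / (1 + \<xi>\<^sup>2)"
proof -
  define c where "c = t * ((1 - cos (1/2)) / 2)"
  have "cos (1/2::real) < cos 0" using pi_gt3 by (intro cos_monotone_0_pi) auto
  then have "0 < c" using assms by (simp add: c_def)
  from power_exp_decay[OF this alpha(1)]
  obtain C where C: "\<And>\<xi>. \<bar>\<xi>\<bar> ^ k * exp (- (c * \<bar>\<xi>\<bar> powr \<alpha>)) \<le> C / (1 + \<xi>\<^sup>2)" by blast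
  have "\<bar>\<xi> ^ k * charac t \<xi>\<bar> \<le> C / (1 + \<xi>\<^sup>2)" for \<xi>
  proof -
    have "c * \<bar>\<xi>\<bar> powr \<alpha> \<le> t * psi \<xi>"
      using mult_left_mono[OF psi_ge, of t \<xi>] assms by (simp add: c_def)
    then have "\<bar>\<xi> ^ k * charac t \<xi>\<bar> \<le> \<bar>\<xi>\<bar> ^ k * exp (- (c * \<bar>\<xi>\<bar> powr \<alpha>))"
      by (simp add: abs_mult power_abs mult_left_mono)
    then show ?thesis using C order_trans by blast
  qed
  then show ?thesis by (rule that)
qed

lemma integrable_power_charac:
  assumes "t > 0"
  shows "integrable lborel (\<lambda>\<xi>. \<xi> ^ k * charac t \<xi>)"
proof -
  obtain C where "\<And>\<xi>. \<bar>\<xi> ^ k * charac t \<xi>\<bar> \<le> C / (1 + \<xi>\<^sup>2)"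
    using power_charac_decay[OF assms] by blast
  then show ?thesis by (intro integrable_decay[of _ C]) simp_all
qed

lemma integrable_charac: "t > 0 \<Longrightarrow> integrable lborel (charac t)"
  using integrable_power_charac[of t 0] by simp

lemma charac_bounds: "0 \<le> t \<Longrightarrow> \<bar>charac t \<xi>\<bar> \<le> 1"
  using psi_nonneg by simp

lemma integrable_charac_quadratic:
  assumes "t > 0"
  shows "integrable lborel (\<lambda>\<xi>. (1 + \<xi>\<^sup>2) * charac t \<xi>)"
proof -
  have "integrable lborel (\<lambda>\<xi>. \<xi> ^ 0 * charac t \<xi> + \<xi> ^ 2 * charac t \<xi>)"
    by (intro Bochner_Integration.integrable_add integrable_power_charac assms)
  then show ?thesis by (simp add: distrib_right)
qed

lemma integrable_psi_charac:
  assumes "t > 0"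
  shows "integrable lborel (\<lambda>\<xi>. psi \<xi> * charac t \<xi>)"
proof -
  define C where "C = 4 * (LBINT y. jump_size \<alpha> y / \<bar>y\<bar> powr (1 + \<alpha>))"
  have "integrable lborel (\<lambda>\<xi>. C * ((1 + \<xi>\<^sup>2) * charac t \<xi>))"
    by (intro integrable_mult_right integrable_charac_quadratic assms)
  then show ?thesis
  proof (rule integrable_dominated)
    have "psi \<xi> * charac t \<xi> \<le> C * (1 + \<xi>\<^sup>2) * charac t \<xi>" for \<xi>
      using psi_le[of \<xi>] by (intro mult_right_mono) (auto simp: C_def)
    then show "\<bar>psi \<xi> * charac t \<xi>\<bar> \<le> C * ((1 + \<xi>\<^sup>2) * charac t \<xi>)" for \<xi>
      using psi_nonneg by (simp add: abs_mult mult.assoc)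
  qed simp
qed

text \<open>Half of the time pays for the polynomial factor: with u = t \<psi> / 2, u^2 / 2 \<le>
  exp u, and the other exp (-u) is \<open>charac (t / 2)\<close>.\<close>

lemma integrable_psi2_charac:
  assumes "t > 0"
  shows "integrable lborel (\<lambda>\<xi>. (psi \<xi>)\<^sup>2 * charac t \<xi>)"
proof -
  have "integrable lborel (\<lambda>\<xi>. 8 / t\<^sup>2 * charac (t / 2) \<xi>)"
    using assms by (intro integrable_mult_right integrable_charac) simp
  then show ?thesis
  proof (rule integrable_dominated)
    have "(psi \<xi>)\<^sup>2 * charac t \<xi> \<le> 8 / t\<^sup>2 * charac (t / 2) \<xi>" for \<xi>
    proof -
      define u where "u = t / 2 * psi \<xi>"
      have u: "0 \<le> u" using assms psi_nonneg by (simp add: u_def)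
      have "u\<^sup>2 / 2 \<le> exp u" using exp_lower_Taylor_quadratic[OF u] u by linarith
      then have "u\<^sup>2 / 2 * exp (- u) \<le> 1" by (simp add: exp_minus field_simps)
      then have "(u\<^sup>2 / 2 * exp (- u)) * (8 / t\<^sup>2 * exp (- u)) \<le> 1 * (8 / t\<^sup>2 * exp (- u))"
        by (intro mult_right_mono) auto
      moreover have "charac t \<xi> = exp (- u) * exp (- u)"
        by (simp add: u_def flip: exp_add)
      moreover have "(psi \<xi>)\<^sup>2 = u\<^sup>2 / 2 * (8 / t\<^sup>2)"
        using assms by (simp add: u_def power2_eq_square)
      moreover have "charac (t / 2) \<xi> = exp (- u)" by (simp add: u_def)
      ultimately show ?thesis by (simp only: mult_ac mult_1_left mult_1_right)
    qed
    then show "\<bar>(psi \<xi>)\<^sup>2 * charac t \<xi>\<bar> \<le> 8 / t\<^sup>2 * charac (t / 2) \<xi>" for \<xi>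
      by (simp add: abs_mult)
  qed simp
qed

section \<open>Smoothness and the heat equation\<close>

lemma heat_kernel_smooth:
  assumes "t > 0"
  shows "((deriv ^^ n) (heat_kernel t)) field_differentiable (at x)"
    and "deriv (heat_kernel t) = cos_transform 1 (charac t)"
proof -
  show "((deriv ^^ n) (heat_kernel t)) field_differentiable (at x)"
    unfolding heat_kernel_def deriv_cos_transform[OF integrable_power_charac[OF assms]]
    using cos_transform_has_derivative[OF integrable_power_charac[OF assms]]
    by (auto simp: field_differentiable_def)
  show "deriv (heat_kernel t) = cos_transform 1 (charac t)"
    using deriv_cos_transform[OF integrable_power_charac[OF assms], of 1]
    by (simp add: heat_kernel_def)
qed

text \<open>For \<bar>h\<bar> < t/2 the factor exp \<bar>h \<psi>\<bar> in the Taylor remainder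
  costs at most half of the time, leaving h^2 \<psi>^2 \<open>charac (t / 2)\<close>, which is
  integrable.\<close>

lemma heat_kernel_time_derivative:
  assumes "t > 0"
  shows "((\<lambda>s. heat_kernel s x) has_real_derivative
    - (LBINT \<xi>. cos (\<xi> * x) * (psi \<xi> * charac t \<xi>)) / (2 * pi)) (at t)"
proof (rule DERIV_quadratic_remainder)
  show "0 < t / 2" using assms by simp
  fix h :: real assume h: "\<bar>h\<bar> < t / 2"
  have th: "t + h > 0" using h assms by linarith
  have bound: "\<bar>cos (\<xi> * x) * charac (t + h) \<xi> - cos (\<xi> * x) * charac t \<xi> + h * (cos (\<xi> * x) * (psi \<xi> * charac t \<xi>))\<bar>
      \<le> h\<^sup>2 * ((psi \<xi>)\<^sup>2 * charac (t / 2) \<xi>)" for \<xi>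
  proof -
    define u where "u = - (h * psi \<xi>)"
    have "charac (t + h) \<xi> = charac t \<xi> * exp u"
      by (simp add: u_def algebra_simps flip: exp_add)
    then have "cos (\<xi> * x) * charac (t + h) \<xi> - cos (\<xi> * x) * charac t \<xi> + h * (cos (\<xi> * x) * (psi \<xi> * charac t \<xi>)) =
      cos (\<xi> * x) * (charac t \<xi> * (exp u - 1 - u))"
      by (simp add: u_def algebra_simps)
    also have "\<bar>\<dots>\<bar> \<le> 1 * (charac t \<xi> * (exp \<bar>u\<bar> / 2 * u\<^sup>2))"
      unfolding abs_mult using exp_quadratic_remainder[of u] by (intro mult_mono) auto
    also have "\<dots> = (charac t \<xi> * exp \<bar>u\<bar>) * (u\<^sup>2 / 2)" by simp
    also have "\<dots> \<le> charac (t / 2) \<xi> * u\<^sup>2"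
    proof (intro mult_mono)
      have "\<bar>u\<bar> \<le> t / 2 * psi \<xi>"
        using mult_right_mono[OF less_imp_le[OF h] psi_nonneg[of \<xi>]] psi_nonneg[of \<xi>] by (simp add: u_def abs_mult)
      then show "charac t \<xi> * exp \<bar>u\<bar> \<le> charac (t / 2) \<xi>"
        by (simp flip: exp_add)
    qed auto
    also have "\<dots> = h\<^sup>2 * ((psi \<xi>)\<^sup>2 * charac (t / 2) \<xi>)" by (simp add: u_def power_mult_distrib)
    finally show ?thesis .
  qed
  have int: "integrable lborel (\<lambda>\<xi>. cos (\<xi> * x) * charac (t + h) \<xi>)" "integrable lborel (\<lambda>\<xi>. cos (\<xi> * x) * charac t \<xi>)"
    "integrable lborel (\<lambda>\<xi>. cos (\<xi> * x) * (psi \<xi> * charac t \<xi>))"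
    by (intro integrable_cos_mult integrable_charac integrable_psi_charac assms th; simp)+
  have int2: "integrable lborel (\<lambda>\<xi>. h\<^sup>2 * ((psi \<xi>)\<^sup>2 * charac (t / 2) \<xi>))"
    using assms by (intro integrable_mult_right integrable_psi2_charac) simp
  have eq: "heat_kernel (t + h) x - heat_kernel t x - h * (- (LBINT \<xi>. cos (\<xi> * x) * (psi \<xi> * charac t \<xi>)) / (2 * pi))
    = (LBINT \<xi>. cos (\<xi> * x) * charac (t + h) \<xi> - cos (\<xi> * x) * charac t \<xi> + h * (cos (\<xi> * x) * (psi \<xi> * charac t \<xi>))) / (2 * pi)"
    using int unfolding heat_kernel_def cos_transform_0 by (simp add: diff_divide_distrib add_divide_distrib)
  have "\<bar>heat_kernel (t + h) x - heat_kernel t x - h * (- (LBINT \<xi>. cos (\<xi> * x) * (psi \<xi> * charac t \<xi>)) / (2 * pi))\<bar>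
      \<le> (LBINT \<xi>. h\<^sup>2 * ((psi \<xi>)\<^sup>2 * charac (t / 2) \<xi>)) / (2 * pi)"
    unfolding eq abs_divide
  proof (rule frac_le)
    show "\<bar>LBINT \<xi>. cos (\<xi> * x) * charac (t + h) \<xi> - cos (\<xi> * x) * charac t \<xi> + h * (cos (\<xi> * x) * (psi \<xi> * charac t \<xi>))\<bar>
        \<le> (LBINT \<xi>. h\<^sup>2 * ((psi \<xi>)\<^sup>2 * charac (t / 2) \<xi>))"
    proof (rule order_trans[OF integral_abs_bound], rule integral_mono)
      show "integrable lborel (\<lambda>\<xi>. \<bar>cos (\<xi> * x) * charac (t + h) \<xi> - cos (\<xi> * x) * charac t \<xi> + h * (cos (\<xi> * x) * (psi \<xi> * charac t \<xi>))\<bar>)"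
        by (rule integrable_abs[OF Bochner_Integration.integrable_add[OF
              Bochner_Integration.integrable_diff[OF int(1,2)] integrable_mult_right[OF int(3)]]])
    next
      show "integrable lborel (\<lambda>\<xi>. h\<^sup>2 * ((psi \<xi>)\<^sup>2 * charac (t / 2) \<xi>))" by (rule int2)
    next
      fix \<xi>
      show "\<bar>cos (\<xi> * x) * charac (t + h) \<xi> - cos (\<xi> * x) * charac t \<xi> + h * (cos (\<xi> * x) * (psi \<xi> * charac t \<xi>))\<bar>
          \<le> h\<^sup>2 * ((psi \<xi>)\<^sup>2 * charac (t / 2) \<xi>)" by (rule bound)
    qed
    show "0 \<le> (LBINT \<xi>. h\<^sup>2 * ((psi \<xi>)\<^sup>2 * charac (t / 2) \<xi>))"
      by (rule integral_nonneg_AE, rule AE_I2) simp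
    show "0 < 2 * pi" "2 * pi \<le> \<bar>2 * pi\<bar>" by simp_all
  qed
  also have "\<dots> = (LBINT \<xi>. (psi \<xi>)\<^sup>2 * charac (t / 2) \<xi>) / (2 * pi) * h\<^sup>2"
    unfolding integral_mult_right_zero times_divide_eq_left by (rule arg_cong[OF mult.commute])
  finally show "\<bar>heat_kernel (t + h) x - heat_kernel t x - h * (- (LBINT \<xi>. cos (\<xi> * x) * (psi \<xi> * charac t \<xi>)) / (2 * pi))\<bar>
      \<le> (LBINT \<xi>. (psi \<xi>)\<^sup>2 * charac (t / 2) \<xi>) / (2 * pi) * h\<^sup>2" .
qed

text \<open>The operator maps the wave cos (\<xi> x) to -\<psi>(\<xi>) cos (\<xi> x). Fubini for
  \<open>F\<close> transfers this to the kernel: integrating over \<xi> first gives the integrand of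
  the operator, over y first the time derivative.\<close>

lemma heat_equation:
  assumes "t > 0"
  shows "integrable lborel (stable_like_integrand \<alpha> \<kappa> (heat_kernel t) x)"
    and "((\<lambda>s. heat_kernel s x) has_real_derivative stable_like_op \<alpha> \<kappa> (heat_kernel t) x) (at t)"
proof -
  \<comment> \<open>Compensated increment of cos (\<xi> x); the sign is plus because the derivative
    of the wave is -\<xi> sin (\<xi> x).\<close>
  define D where "D \<xi> y = cos (\<xi> * (x + y)) - cos (\<xi> * x) + compensator \<alpha> y * (\<xi> * sin (\<xi> * x))" for \<xi> y
  define F where "F = (\<lambda>(\<xi>, y). D \<xi> y * charac t \<xi> * nu y)"
  define J where "J y = jump_size \<alpha> y / \<bar>y\<bar> powr (1 + \<alpha>)" for y
  have D_measurable [measurable]: "(\<lambda>(\<xi>, y). D \<xi> y) \<in> borel_measurable (borel \<Otimes>\<^sub>M borel)"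
    unfolding D_def by measurable
  have J: "integrable lborel J" unfolding J_def by (intro integrable_jump_size alpha)
  have F_measurable [measurable]: "F \<in> borel_measurable (lborel \<Otimes>\<^sub>M lborel)"
    unfolding F_def D_def by measurable
  have D_bound: "\<bar>D \<xi> y * nu y\<bar> \<le> 6 * (1 + \<xi>\<^sup>2) * J y" for \<xi> y
    using jump_domination[OF compensated_cos_le_jump_size[OF alpha(1), of \<xi> x y]] by (simp add: D_def J_def)
  have "integrable (lborel \<Otimes>\<^sub>M lborel) (\<lambda>(\<xi>, y). 6 * ((1 + \<xi>\<^sup>2) * charac t \<xi>) * J y)"
    by (intro integrable_pair_mult integrable_mult_right integrable_charac_quadratic assms J)
  then have int: "integrable (lborel \<Otimes>\<^sub>M lborel) F"
  proof (rule integrable_dominated)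
    have "\<bar>F (\<xi>, y)\<bar> \<le> 6 * ((1 + \<xi>\<^sup>2) * charac t \<xi>) * J y" for \<xi> y
    proof -
      have "\<bar>F (\<xi>, y)\<bar> = \<bar>D \<xi> y * nu y\<bar> * charac t \<xi>" by (simp add: F_def abs_mult)
      also have "\<dots> \<le> 6 * (1 + \<xi>\<^sup>2) * J y * charac t \<xi>"
        by (intro mult_right_mono D_bound) simp
      finally show ?thesis by (simp only: mult_ac)
    qed
    then show "\<bar>F z\<bar> \<le> (case z of (\<xi>, y) \<Rightarrow> 6 * ((1 + \<xi>\<^sup>2) * charac t \<xi>) * J y)" for z
      by (cases z) (simp only: prod.case)
  qed simp
  have F_xi: "(LBINT \<xi>. F (\<xi>, y)) = 2 * pi * stable_like_integrand \<alpha> \<kappa> (heat_kernel t) x y" for y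
  proof -
    have alg: "n * (A - B + c * C) = 2 * pi * ((A / (2 * pi) - B / (2 * pi) - c * (- C / (2 * pi))) * n)"
      for n A B c C :: real by (simp add: field_simps)
    have d: "deriv (heat_kernel t) x = - (LBINT \<xi>. sin (\<xi> * x) * (\<xi> * charac t \<xi>)) / (2 * pi)"
      by (simp only: heat_kernel_smooth(2)[OF assms] cos_transform_1)
    have h: "heat_kernel t z = (LBINT \<xi>. cos (\<xi> * z) * charac t \<xi>) / (2 * pi)" for z
      by (simp only: heat_kernel_def cos_transform_0)
    have i: "integrable lborel (\<lambda>\<xi>. cos (\<xi> * z) * charac t \<xi>)" for z
      by (intro integrable_cos_mult integrable_charac assms) auto
    have i': "integrable lborel (\<lambda>\<xi>. sin (\<xi> * x) * (\<xi> * charac t \<xi>))"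
      using integrable_bounded_mult[OF integrable_power_charac[OF assms, of 1], of "\<lambda>\<xi>. sin (\<xi> * x)" 1] by simp
    have "(LBINT \<xi>. F (\<xi>, y)) = (LBINT \<xi>. nu y * (cos (\<xi> * (x + y)) * charac t \<xi> - cos (\<xi> * x) * charac t \<xi>
        + compensator \<alpha> y * (sin (\<xi> * x) * (\<xi> * charac t \<xi>))))"
      by (intro Bochner_Integration.integral_cong) (simp_all add: F_def D_def algebra_simps)
    also have "\<dots> = nu y * ((LBINT \<xi>. cos (\<xi> * (x + y)) * charac t \<xi>) - (LBINT \<xi>. cos (\<xi> * x) * charac t \<xi>)
        + compensator \<alpha> y * (LBINT \<xi>. sin (\<xi> * x) * (\<xi> * charac t \<xi>)))"
      using i i' by simp
    also have "\<dots> = 2 * pi * stable_like_integrand \<alpha> \<kappa> (heat_kernel t) x y"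
      unfolding stable_like_integrand_def d h by (rule alg)
    finally show ?thesis .
  qed
  have F_y: "(LBINT y. F (\<xi>, y)) = - (cos (\<xi> * x) * (psi \<xi> * charac t \<xi>))" for \<xi>
  proof -
    \<comment> \<open>The part of \<open>D\<close> odd in y. Its integral vanishes because \<kappa>
      is even and the compensator odd. The sine and the compensator are kept together: only their
      difference is controlled near 0 and at infinity, and its integrability follows from that of
      \<open>D\<close> and of the even part.\<close>
    define O1 where "O1 y = sin (\<xi> * x) * (\<xi> * compensator \<alpha> y - sin (\<xi> * y)) * nu y" for y
    have "integrable lborel (\<lambda>y. D \<xi> y * nu y)"
      by (rule integrable_dominated[OF integrable_mult_right[OF J] _ D_bound]) (simp add: D_def)
    moreover have cint: "integrable lborel (\<lambda>y. cos (\<xi> * x) * ((1 - cos (\<xi> * y)) * nu y))"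
      by (intro integrable_mult_right integrable_levy)
    moreover have D_eq: "D \<xi> y * nu y = O1 y - cos (\<xi> * x) * ((1 - cos (\<xi> * y)) * nu y)" for y
      by (simp add: D_def O1_def distrib_left cos_add algebra_simps add_divide_distrib diff_divide_distrib)
    ultimately have O1: "integrable lborel O1"
      using Bochner_Integration.integrable_add[of lborel "\<lambda>y. D \<xi> y * nu y" "\<lambda>y. cos (\<xi> * x) * ((1 - cos (\<xi> * y)) * nu y)"]
      by simp
    have "(LBINT y. O1 y) = 0"
      by (rule integral_odd_eq_0) (auto simp: O1_def compensator_def kappa_even algebra_simps)
    then have "(LBINT y. D \<xi> y * nu y) = - (cos (\<xi> * x) * psi \<xi>)"
      by (simp only: D_eq Bochner_Integration.integral_diff[OF O1 cint] integral_mult_right_zero levy_exponent_def)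
    moreover have "(LBINT y. F (\<xi>, y)) = charac t \<xi> * (LBINT y. D \<xi> y * nu y)"
    proof -
      have "(LBINT y. F (\<xi>, y)) = (LBINT y. charac t \<xi> * (D \<xi> y * nu y))"
        by (simp only: F_def prod.case mult_ac)
      then show ?thesis by (simp only: integral_mult_right_zero)
    qed
    ultimately show ?thesis by simp
  qed
  \<comment> \<open>Fubini also yields the absolute convergence that \<open>is_heat_kernel\<close>
    demands.\<close>
  have "integrable lborel (\<lambda>y. LBINT \<xi>. F (\<xi>, y))"
    using lborel_pair.integrable_snd[of "\<lambda>\<xi> y. F (\<xi>, y)"] int by simp
  from integrable_divide[OF this[unfolded F_xi], of "2 * pi"]
  show "integrable lborel (stable_like_integrand \<alpha> \<kappa> (heat_kernel t) x)" by simp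
  have "2 * pi * stable_like_op \<alpha> \<kappa> (heat_kernel t) x = (LBINT y. LBINT \<xi>. F (\<xi>, y))"
    unfolding stable_like_op_def F_xi by simp
  also have "\<dots> = (LBINT \<xi>. LBINT y. F (\<xi>, y))"
    using lborel_pair.Fubini_integral[of "\<lambda>\<xi> y. F (\<xi>, y)"] int by simp
  also have "\<dots> = - (LBINT \<xi>. cos (\<xi> * x) * (psi \<xi> * charac t \<xi>))"
    unfolding F_y by simp
  finally have "stable_like_op \<alpha> \<kappa> (heat_kernel t) x = - (LBINT \<xi>. cos (\<xi> * x) * (psi \<xi> * charac t \<xi>)) / (2 * pi)"
    by (simp add: field_simps)
  with heat_kernel_time_derivative[OF assms, of x]
  show "((\<lambda>s. heat_kernel s x) has_real_derivative stable_like_op \<alpha> \<kappa> (heat_kernel t) x) (at t)" by simp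
qed

text \<open>Removing the jumps up to 1 / (k + 1) leaves a finite Levy measure, hence a compound
  Poisson factor. Such a factor is bounded below by a positive constant and so not integrable; a
  Gaussian factor supplies the integrability. The cutoff is removed first, dominated by the
  Gaussian, and then the Gaussian, dominated by \<open>charac t\<close>.\<close>

lemma nonneg_cos_transform_charac:
  assumes "t > 0"
  shows "nonneg_cos_transform (charac t)"
proof -
  define w where "w k y = t * (indicator {y. \<bar>y\<bar> > 1 / real (Suc k)} y * nu y)" for k y
  have w_nonneg: "0 \<le> w k y" for k y using mult_nonneg_nonneg[OF less_imp_le[OF assms] nu_nonneg[of y]] by (simp add: w_def split: split_indicator)
  have [measurable]: "w k \<in> borel_measurable borel" for k unfolding w_def[abs_def] by measurable
  have w_int: "integrable lborel (w k)" for k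
  proof (rule integrable_dominated[OF integrable_mult_right[OF integrable_jump_size[OF alpha], of "t * (2 * (real (Suc k))\<^sup>2)"]])
    \<comment> \<open>Beyond the cutoff both y^2 and 1 are at least (k + 1)^(-2), and
      \<open>jump_size\<close> dominates one of the two.\<close>
    have "indicator {y. \<bar>y\<bar> > 1 / real (Suc k)} y \<le> (real (Suc k))\<^sup>2 * jump_size \<alpha> y" for y :: real
    proof (cases "\<bar>y\<bar> > 1 / real (Suc k)")
      case True
      then have 1: "1 \<le> real (Suc k) * \<bar>y\<bar>" by (simp add: field_simps)
      have "1 \<le> (real (Suc k) * \<bar>y\<bar>)\<^sup>2" using 1 by (simp only: one_le_power)
      also have "\<dots> = (real (Suc k))\<^sup>2 * y\<^sup>2" by (simp only: power_mult_distrib power2_abs)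
      finally have 2: "1 \<le> (real (Suc k))\<^sup>2 * y\<^sup>2" .
      have 3: "y\<^sup>2 \<le> jump_size \<alpha> y \<or> 1 \<le> jump_size \<alpha> y"
        using mult_left_le[of "\<bar>y\<bar>" "\<bar>y\<bar>"] by (auto simp: jump_size_def power2_eq_square abs_real_def split: if_splits)
      have "1 \<le> (real (Suc k))\<^sup>2" by (simp add: one_le_power)
      with 2 3 have "1 \<le> (real (Suc k))\<^sup>2 * jump_size \<alpha> y"
        using mult_left_mono[of "y\<^sup>2" "jump_size \<alpha> y" "(real (Suc k))\<^sup>2"] mult_mono[of 1 "(real (Suc k))\<^sup>2" 1 "jump_size \<alpha> y"]
        by (elim disjE) (linarith | simp only: zero_le_power2 zero_le_one mult_1_left; linarith)+
      then show ?thesis using True by simp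
    qed (simp add: jump_size_nonneg)
    from jump_domination[OF order_trans[OF _ this]] have
      "\<bar>indicator {y. \<bar>y\<bar> > 1 / real (Suc k)} y * nu y\<bar> \<le> 2 * (real (Suc k))\<^sup>2 * (jump_size \<alpha> y / \<bar>y\<bar> powr (1 + \<alpha>))" for y
      by simp
    from mult_left_mono[OF this, of t] show "\<bar>w k y\<bar> \<le> t * (2 * (real (Suc k))\<^sup>2) * (jump_size \<alpha> y / \<bar>y\<bar> powr (1 + \<alpha>))" for y
      unfolding w_def abs_mult[of t] using assms by (simp only: abs_of_pos less_imp_le mult.assoc)
  qed simp
  define G where "G k \<xi> = exp (- (LBINT y. (1 - cos (\<xi> * y)) * w k y))" for k \<xi>
  have [measurable]: "G k \<in> borel_measurable borel" for k unfolding G_def[abs_def] by measurable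
  have G_bound: "0 \<le> G k \<xi>" "G k \<xi> \<le> 1" for k \<xi>
    unfolding G_def by (auto intro!: integral_nonneg_AE AE_I2 mult_nonneg_nonneg one_minus_cos_bounds w_nonneg)
  have G_lim: "(\<lambda>k. G k \<xi>) \<longlonglongrightarrow> charac t \<xi>" for \<xi>
  proof -
    have "(\<lambda>k. LBINT y. (1 - cos (\<xi> * y)) * w k y) \<longlonglongrightarrow> (LBINT y. t * ((1 - cos (\<xi> * y)) * nu y))"
    proof (rule integral_dominated_convergence[where w = "\<lambda>y. t * ((1 - cos (\<xi> * y)) * nu y)"])
      show "AE y in lborel. (\<lambda>k. (1 - cos (\<xi> * y)) * w k y) \<longlonglongrightarrow> t * ((1 - cos (\<xi> * y)) * nu y)"
      proof (rule AE_I2)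
        fix y :: real
        show "(\<lambda>k. (1 - cos (\<xi> * y)) * w k y) \<longlonglongrightarrow> t * ((1 - cos (\<xi> * y)) * nu y)"
        proof (cases "y = 0")
          case False
          have "eventually (\<lambda>k. 1 / real (Suc k) < \<bar>y\<bar>) sequentially"
            using False LIMSEQ_Suc[OF lim_1_over_n] by (intro order_tendstoD(2)) auto
          then have "eventually (\<lambda>k. (1 - cos (\<xi> * y)) * w k y = t * ((1 - cos (\<xi> * y)) * nu y)) sequentially"
            by eventually_elim (simp add: w_def)
          then show ?thesis by (rule tendsto_eventually)
        qed (simp add: w_def)
      qed
      have "w k y \<le> t * nu y" for k y
        using mult_nonneg_nonneg[OF less_imp_le[OF assms] nu_nonneg[of y]] by (simp add: w_def split: split_indicator)
      from mult_left_mono[OF this one_minus_cos_bounds(1)]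
      have "\<bar>1 - cos (\<xi> * y)\<bar> * \<bar>w k y\<bar> \<le> t * ((1 - cos (\<xi> * y)) * nu y)" for k y
        unfolding abs_of_nonneg[OF w_nonneg] abs_of_nonneg[OF one_minus_cos_bounds(1)] by (simp only: mult.left_commute)
      then show "AE y in lborel. norm ((1 - cos (\<xi> * y)) * w k y) \<le> t * ((1 - cos (\<xi> * y)) * nu y)" for k
        by (simp only: real_norm_def abs_mult AE_I2)
      show "integrable lborel (\<lambda>y. t * ((1 - cos (\<xi> * y)) * nu y))"
        by (intro integrable_mult_right integrable_levy)
    qed measurable
    then show ?thesis
      unfolding G_def integral_mult_right_zero levy_exponent_def by (rule tendsto_exp[OF tendsto_minus])
  qed
  have damped: "nonneg_cos_transform (\<lambda>\<xi>. exp (- (\<sigma> * \<xi>)\<^sup>2 / 2) * charac t \<xi>)" if "\<sigma> > 0" for \<sigma>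
  proof (rule nonneg_cos_transform_limit[where w = "\<lambda>\<xi>. exp (- (\<sigma> * \<xi>)\<^sup>2 / 2)" and
        s = "\<lambda>k \<xi>. exp (- (\<sigma> * \<xi>)\<^sup>2 / 2) * G k \<xi>"])
    show "nonneg_cos_transform (\<lambda>\<xi>. exp (- (\<sigma> * \<xi>)\<^sup>2 / 2) * G k \<xi>)" for k
      unfolding G_def
      by (intro nonneg_cos_transform_compound_Poisson integrable_gaussian nonneg_cos_transform_gaussian that w_nonneg w_int)
    show "(\<lambda>k. exp (- (\<sigma> * \<xi>)\<^sup>2 / 2) * G k \<xi>) \<longlonglongrightarrow> exp (- (\<sigma> * \<xi>)\<^sup>2 / 2) * charac t \<xi>" for \<xi>
      by (intro tendsto_intros G_lim)
    show "\<bar>exp (- (\<sigma> * \<xi>)\<^sup>2 / 2) * G k \<xi>\<bar> \<le> exp (- (\<sigma> * \<xi>)\<^sup>2 / 2)" for k \<xi>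
      using G_bound[of k \<xi>] by (simp add: abs_mult mult_left_le)
    show "integrable lborel (\<lambda>\<xi>. exp (- (\<sigma> * \<xi>)\<^sup>2 / 2))" by (rule integrable_gaussian[OF that])
  qed measurable
  show ?thesis
  proof (rule nonneg_cos_transform_limit[where w = "charac t" and
        s = "\<lambda>n \<xi>. exp (- (1 / real (Suc n) * \<xi>)\<^sup>2 / 2) * charac t \<xi>"])
    show "(\<lambda>n. exp (- (1 / real (Suc n) * \<xi>)\<^sup>2 / 2) * charac t \<xi>) \<longlonglongrightarrow> charac t \<xi>" for \<xi>
    proof -
      have "(\<lambda>n. exp (- (1 / real (Suc n) * \<xi>)\<^sup>2 / 2) * charac t \<xi>) \<longlonglongrightarrow> exp (- (0 * \<xi>)\<^sup>2 / 2) * charac t \<xi>"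
        by (intro tendsto_intros LIMSEQ_Suc[OF lim_1_over_n]) auto
      then show ?thesis by simp
    qed
    show "nonneg_cos_transform (\<lambda>\<xi>. exp (- (1 / real (Suc n) * \<xi>)\<^sup>2 / 2) * charac t \<xi>)" for n
      by (rule damped) simp
    show "\<bar>exp (- (1 / real (Suc n) * \<xi>)\<^sup>2 / 2) * charac t \<xi>\<bar> \<le> charac t \<xi>" for n \<xi>
      unfolding abs_mult abs_exp_cancel by (rule mult_left_le_one_le) simp_all
    show "integrable lborel (charac t)" by (rule integrable_charac[OF assms])
  qed measurable
qed

section \<open>The kernel as a probability density and its initial value\<close>

lemma heat_kernel_nonneg: "t > 0 \<Longrightarrow> 0 \<le> heat_kernel t x"
  using nonneg_cos_transform_charac[of t]
  by (simp add: heat_kernel_def cos_transform_0 nonneg_cos_transform_def)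

lemma measurable_heat_kernel [measurable]: "heat_kernel t \<in> borel_measurable borel"
  unfolding heat_kernel_def by measurable

lemma heat_kernel_fourier:
  assumes "t > 0"
  shows "integrable lborel (heat_kernel t)" "(LBINT x. cos (\<xi> * x) * heat_kernel t x) = charac t \<xi>"
proof -
  have *: "continuous_on UNIV (charac t)" by (intro continuous_intros continuous_psi)
  note inv = nonneg_cos_transform_inversion[OF integrable_charac[OF assms] * _ charac_bounds nonneg_cos_transform_charac[OF assms]]
  show "integrable lborel (heat_kernel t)" "(LBINT x. cos (\<xi> * x) * heat_kernel t x) = charac t \<xi>"
    unfolding heat_kernel_def using assms by (auto intro!: inv simp: psi_even)
qed

lemma heat_kernel_prob_space:
  assumes "t > 0"
  shows "prob_space (density lborel (heat_kernel t))"
proof (rule prob_spaceI)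
  have "emeasure (density lborel (heat_kernel t)) (space (density lborel (heat_kernel t))) =
      (\<integral>\<^sup>+x. ennreal (heat_kernel t x) \<partial>lborel)"
    by (subst emeasure_density) auto
  also have "\<dots> = ennreal (LBINT x. heat_kernel t x)"
    by (intro nn_integral_eq_integral heat_kernel_fourier assms AE_I2 heat_kernel_nonneg)
  also have "(LBINT x. heat_kernel t x) = 1"
    using heat_kernel_fourier(2)[OF assms, of 0] by simp
  finally show "emeasure (density lborel (heat_kernel t)) (space (density lborel (heat_kernel t))) = 1" by simp
qed

lemma heat_kernel_real_distribution:
  "t > 0 \<Longrightarrow> real_distribution (density lborel (heat_kernel t))"
  using heat_kernel_prob_space by (simp add: real_distribution_def real_distribution_axioms_def)

text \<open>Real and imaginary part are a cosine and a sine integral: the first is Fourier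
  inversion, the second vanishes because the kernel is even.\<close>

lemma heat_kernel_char:
  assumes "t > 0"
  shows "char (density lborel (heat_kernel t)) \<xi> = of_real (charac t \<xi>)"
proof -
  interpret real_distribution "density lborel (heat_kernel t)"
    by (rule heat_kernel_real_distribution[OF assms])
  have int: "integrable (density lborel (heat_kernel t)) (\<lambda>x. iexp (\<xi> * x))"
    by (rule integrable_iexp) auto
  have "Re (char (density lborel (heat_kernel t)) \<xi>) = (LINT x|density lborel (heat_kernel t). cos (\<xi> * x))"
    unfolding char_def by (subst integral_Re[OF int, symmetric]) (simp add: Re_exp)
  also have "\<dots> = (LBINT x. cos (\<xi> * x) * heat_kernel t x)"
    by (subst integral_density) (auto simp: heat_kernel_nonneg assms mult.commute)
  also have "\<dots> = charac t \<xi>" by (rule heat_kernel_fourier[OF assms])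
  finally have Re: "Re (char (density lborel (heat_kernel t)) \<xi>) = charac t \<xi>" .
  have "Im (char (density lborel (heat_kernel t)) \<xi>) = (LINT x|density lborel (heat_kernel t). sin (\<xi> * x))"
    unfolding char_def by (subst integral_Im[OF int, symmetric]) (simp add: Im_exp)
  also have "\<dots> = (LBINT x. heat_kernel t x * sin (\<xi> * x))"
    by (subst integral_density) (auto simp: heat_kernel_nonneg assms)
  also have "\<dots> = 0"
    by (rule integral_odd_eq_0) (simp add: heat_kernel_def cos_transform_0)
  finally show ?thesis using Re by (simp add: complex_eq_iff)
qed

text \<open>Along any sequence of times decreasing to 0 in the limit, the characteristic functions
  tend to 1, so Levy continuity gives weak convergence to the point mass at 0.\<close>

lemma heat_kernel_tendsto_delta:
  fixes f :: "real \<Rightarrow> real"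
  assumes "continuous_on UNIV f" "bounded (range f)"
  shows "((\<lambda>t. LBINT x. f x * heat_kernel t x) \<longlongrightarrow> f 0) (at_right 0)"
  unfolding tendsto_at_iff_sequentially
proof (intro allI impI)
  fix X :: "nat \<Rightarrow> real" assume X: "\<forall>i. X i \<in> {0<..} - {0}" "X \<longlonglongrightarrow> 0"
  have pos: "X i > 0" for i using X(1) by auto
  define M where "M n = density lborel (heat_kernel (X n))" for n
  have M: "real_distribution (M n)" for n unfolding M_def by (rule heat_kernel_real_distribution[OF pos])
  interpret D: prob_space "return borel (0::real)" by (rule prob_space_return) simp
  have D: "real_distribution (return borel (0::real))" by unfold_locales auto
  have "char (return borel (0::real)) \<xi> = 1" for \<xi>
    by (simp add: char_def integral_return)
  moreover have "(\<lambda>n. char (M n) \<xi>) \<longlonglongrightarrow> of_real (exp (- (0 * psi \<xi>)))" for \<xi>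
    unfolding M_def heat_kernel_char[OF pos] by (intro tendsto_intros X)
  ultimately have "weak_conv_m M (return borel 0)"
    by (intro levy_continuity M D) simp
  obtain B where B: "\<And>x. norm (f x) \<le> B" using assms(2) by (auto simp: bounded_iff)
  have [measurable]: "f \<in> borel_measurable borel" by (rule borel_measurable_continuous_onI[OF assms(1)])
  have "(\<lambda>n. integral\<^sup>L (M n) f) \<longlonglongrightarrow> integral\<^sup>L (return borel 0) f"
    by (rule weak_conv_imp_integral_bdd_continuous_conv[OF M D \<open>weak_conv_m M (return borel 0)\<close> _ B])
       (use assms(1) in \<open>simp add: continuous_on_eq_continuous_at\<close>)
  moreover have "integral\<^sup>L (M n) f = (LBINT x. f x * heat_kernel (X n) x)" for n
    unfolding M_def by (subst integral_density) (auto simp: heat_kernel_nonneg pos mult.commute)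
  ultimately show "((\<lambda>t. LBINT x. f x * heat_kernel t x) \<circ> X) \<longlonglongrightarrow> f 0"
    by (simp add: comp_def integral_return)
qed

lemma is_heat_kernel_heat_kernel: "is_heat_kernel \<alpha> \<kappa> heat_kernel"
  unfolding is_heat_kernel_def
proof (intro conjI allI impI)
  fix f :: "real \<Rightarrow> real" assume "continuous_on UNIV f \<and> bounded (range f)"
  then show "((\<lambda>t. LBINT x. f x * heat_kernel t x) \<longlongrightarrow> f 0) (at_right 0)"
    using heat_kernel_tendsto_delta by blast
next
  fix t \<xi> :: real assume "0 < t"
  then show "char (density lborel (heat_kernel t)) \<xi> = of_real (exp (- t * psi \<xi>))"
    using heat_kernel_char[of t \<xi>] by simp
next
  fix t x :: real and n assume t: "0 < t"
  show "((deriv ^^ n) (heat_kernel t)) field_differentiable (at x)"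
    by (rule heat_kernel_smooth(1)[OF t])
  show "0 \<le> heat_kernel t x" by (rule heat_kernel_nonneg[OF t])
  show "prob_space (density lborel (heat_kernel t))" by (rule heat_kernel_prob_space[OF t])
  show "integrable lborel (stable_like_integrand \<alpha> \<kappa> (heat_kernel t) x)"
    by (rule heat_equation(1)[OF t])
  show "((\<lambda>s. heat_kernel s x) has_real_derivative stable_like_op \<alpha> \<kappa> (heat_kernel t) x) (at t)"
    by (rule heat_equation(2)[OF t])
qed

end

section \<open>Dependence of the heat kernel on the coefficient\<close>

text \<open>Translation by half a period pi / x reverses the sign of the cosine, so twice the
  integral is one against g - g(. + pi / x). This difference tends to 0 in L1 by continuity and the
  decay of \<open>g\<close>. The phase \<open>c\<close> covers both the kernel (0) and its
  derivative (pi / 2).\<close>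

lemma riemann_lebesgue:
  fixes g :: "real \<Rightarrow> real"
  assumes cont: "continuous_on UNIV g" and bound: "\<And>\<xi>. \<bar>g \<xi>\<bar> \<le> C / (1 + \<xi>\<^sup>2)"
  shows "((\<lambda>x. LBINT \<xi>. cos (\<xi> * x + c) * g \<xi>) \<longlongrightarrow> 0) at_top"
proof -
  have [measurable]: "g \<in> borel_measurable borel" by (rule borel_measurable_continuous_onI[OF cont])
  have g: "integrable lborel g" by (rule integrable_decay[OF _ bound]) simp
  have C: "0 \<le> C" using bound[of 0] by simp
  define T where "T x = (LBINT \<xi>. \<bar>g \<xi> - g (pi / x + 1 * \<xi>)\<bar>)" for x
  have g': "integrable lborel (\<lambda>\<xi>. g (a + 1 * \<xi>))" for a
    by (rule lborel_integrable_real_affine[OF g]) simp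
  have le: "\<bar>LBINT \<xi>. cos (\<xi> * x + c) * g \<xi>\<bar> \<le> T x / 2" if "x > 0" for x
  proof -
    define I where "I = (LBINT \<xi>. cos (\<xi> * x + c) * g \<xi>)"
    have "I = \<bar>1\<bar> *\<^sub>R (LBINT \<xi>. cos ((pi / x + 1 * \<xi>) * x + c) * g (pi / x + 1 * \<xi>))"
      unfolding I_def by (rule lborel_integral_real_affine) simp
    also have "(\<lambda>\<xi>. cos ((pi / x + 1 * \<xi>) * x + c) * g (pi / x + 1 * \<xi>)) = (\<lambda>\<xi>. - (cos (\<xi> * x + c) * g (pi / x + 1 * \<xi>)))"
    proof
      fix \<xi>
      have "(pi / x + 1 * \<xi>) * x + c = (\<xi> * x + c) + pi" using that by (simp add: field_simps)
      then show "cos ((pi / x + 1 * \<xi>) * x + c) * g (pi / x + 1 * \<xi>) = - (cos (\<xi> * x + c) * g (pi / x + 1 * \<xi>))"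
        by (simp only: cos_periodic_pi mult_minus_left)
    qed
    finally have "I = - (LBINT \<xi>. cos (\<xi> * x + c) * g (pi / x + 1 * \<xi>))" by simp
    then have "2 * I = (LBINT \<xi>. cos (\<xi> * x + c) * g \<xi>) - (LBINT \<xi>. cos (\<xi> * x + c) * g (pi / x + 1 * \<xi>))"
      by (simp add: I_def)
    also have "\<dots> = (LBINT \<xi>. cos (\<xi> * x + c) * g \<xi> - cos (\<xi> * x + c) * g (pi / x + 1 * \<xi>))"
      by (intro Bochner_Integration.integral_diff[symmetric] integrable_cos_mult g g') auto
    also have "\<dots> = (LBINT \<xi>. cos (\<xi> * x + c) * (g \<xi> - g (pi / x + 1 * \<xi>)))"
      by (simp only: right_diff_distrib)
    finally have "2 * \<bar>I\<bar> = \<bar>LBINT \<xi>. cos (\<xi> * x + c) * (g \<xi> - g (pi / x + 1 * \<xi>))\<bar>" by linarith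
    also have "\<dots> \<le> T x"
      unfolding T_def
    proof (rule order_trans[OF integral_abs_bound], rule integral_mono)
      have d: "integrable lborel (\<lambda>\<xi>. g \<xi> - g (pi / x + 1 * \<xi>))"
        by (intro Bochner_Integration.integrable_diff g g')
      show "integrable lborel (\<lambda>\<xi>. \<bar>cos (\<xi> * x + c) * (g \<xi> - g (pi / x + 1 * \<xi>))\<bar>)"
        by (intro integrable_abs integrable_cos_mult d) simp
      show "integrable lborel (\<lambda>\<xi>. \<bar>g \<xi> - g (pi / x + 1 * \<xi>)\<bar>)"
        by (rule integrable_abs[OF d])
      show "\<bar>cos (\<xi> * x + c) * (g \<xi> - g (pi / x + 1 * \<xi>))\<bar> \<le> \<bar>g \<xi> - g (pi / x + 1 * \<xi>)\<bar>" for \<xi>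
        unfolding abs_mult by (rule mult_left_le_one_le) auto
    qed
    finally show ?thesis by (simp add: I_def)
  qed
  have "(T \<longlongrightarrow> (LBINT \<xi>::real. 0)) at_top"
    unfolding T_def
  proof (rule integral_dominated_convergence_at_top[where w = "\<lambda>\<xi>. 4 * C / (1 + \<xi>\<^sup>2)"])
    show "integrable lborel (\<lambda>\<xi>. 4 * C / (1 + \<xi>\<^sup>2))" by (rule integrable_inverse_square)
    have "((\<lambda>x. \<bar>g \<xi> - g (pi / x + 1 * \<xi>)\<bar>) \<longlongrightarrow> 0) at_top" for \<xi>
    proof -
      have "((\<lambda>x. pi / x + 1 * \<xi>) \<longlongrightarrow> 0 + 1 * \<xi>) at_top"
        by (intro tendsto_intros tendsto_divide_0[OF tendsto_const] filterlim_at_top_imp_at_infinity filterlim_ident)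
      then have "((\<lambda>x. g (pi / x + 1 * \<xi>)) \<longlongrightarrow> g \<xi>) at_top"
        by (intro continuous_on_tendsto_compose[OF cont]) auto
      from tendsto_rabs[OF tendsto_diff[OF tendsto_const this, of "g \<xi>"]] show ?thesis by simp
    qed
    then show "AE \<xi> in lborel. ((\<lambda>x. \<bar>g \<xi> - g (pi / x + 1 * \<xi>)\<bar>) \<longlongrightarrow> 0) at_top" by simp
    have shift: "\<bar>g (h + 1 * \<xi>)\<bar> \<le> 3 * C / (1 + \<xi>\<^sup>2)" if "\<bar>h\<bar> \<le> 1" for h \<xi>
    proof -
      have "h\<^sup>2 \<le> 1" using that by (simp add: abs_square_le_1)
      \<comment> \<open>Completing the square: 3 (1 + (h + \<xi>)^2) - (1 + \<xi>^2) = 2 - 3 h^2 / 2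
        + (2 \<xi> + 3 h)^2 / 2, positive for h^2 \<le> 1.\<close>
      moreover have "0 \<le> (2 * \<xi> + 3 * h)\<^sup>2" by simp
      ultimately have "1 + \<xi>\<^sup>2 \<le> 3 * (1 + (h + 1 * \<xi>)\<^sup>2)"
        by (simp add: power2_eq_square algebra_simps)
      then have "C / (1 + (h + 1 * \<xi>)\<^sup>2) \<le> 3 * C / (1 + \<xi>\<^sup>2)"
        using C mult_left_mono[of "1 + \<xi>\<^sup>2" "3 * (1 + (h + 1 * \<xi>)\<^sup>2)" C]
        by (simp add: pos_divide_le_eq pos_le_divide_eq add_pos_nonneg field_simps)
      with bound show ?thesis using order_trans by blast
    qed
    show "\<forall>\<^sub>F x in at_top. AE \<xi> in lborel. norm \<bar>g \<xi> - g (pi / x + 1 * \<xi>)\<bar> \<le> 4 * C / (1 + \<xi>\<^sup>2)"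
      using eventually_ge_at_top[of pi]
    proof eventually_elim
      case (elim x)
      have "0 < x" using elim pi_gt_zero by linarith
      then have "\<bar>pi / x\<bar> \<le> 1" using elim by simp
      have "\<bar>g \<xi> - g (pi / x + 1 * \<xi>)\<bar> \<le> 4 * C / (1 + \<xi>\<^sup>2)" for \<xi>
      proof -
        have "4 * C / (1 + \<xi>\<^sup>2) = C / (1 + \<xi>\<^sup>2) + 3 * C / (1 + \<xi>\<^sup>2)"
          by (simp flip: add_divide_distrib)
        then show ?thesis using shift[OF \<open>\<bar>pi / x\<bar> \<le> 1\<close>, of \<xi>] bound[of \<xi>] by linarith
      qed
      then show ?case by simp
    qed
  qed auto
  then have "((\<lambda>x. T x / 2) \<longlongrightarrow> 0) at_top" using tendsto_divide[of T 0 at_top "\<lambda>_. 2" 2] by simp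
  then show ?thesis
  proof (rule tendsto_0_le[where K = 1])
    show "\<forall>\<^sub>F x in at_top. norm (LBINT \<xi>. cos (\<xi> * x + c) * g \<xi>) \<le> norm (T x / 2) * 1"
      using eventually_gt_at_top[of 0]
    proof eventually_elim
      case (elim x)
      show ?case using le[OF elim] by simp
    qed
  qed
qed

lemma abs_exp_minus_diff_le:
  fixes u v w :: real
  assumes "w \<le> u" "w \<le> v"
  shows "\<bar>exp (- u) - exp (- v)\<bar> \<le> \<bar>u - v\<bar> * exp (- w)"
proof -
  have *: "\<bar>exp (- u) - exp (- v)\<bar> \<le> \<bar>u - v\<bar> * exp (- w)" if "w \<le> u" "u \<le> v" for u v
  proof -
    have "exp (- u) - exp (- v) = exp (- u) * (1 - exp (- (v - u)))"
      by (simp add: right_diff_distrib flip: exp_add)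
    also have "\<dots> \<le> exp (- w) * (v - u)"
    proof (rule mult_mono)
      show "1 - exp (- (v - u)) \<le> v - u" using exp_ge_add_one_self[of "- (v - u)"] by linarith
    qed (use that in auto)
    finally show ?thesis using that by (simp add: mult.commute)
  qed
  show ?thesis
    using *[of u v] *[of v u] assms by (cases "u \<le> v") (auto simp: abs_minus_commute)
qed

context stable_like
begin

lemma heat_kernel_tendsto_0: "(heat_kernel 1 \<longlongrightarrow> 0) at_top"
proof -
  obtain C where "\<And>\<xi>. \<bar>\<xi> ^ 0 * charac 1 \<xi>\<bar> \<le> C / (1 + \<xi>\<^sup>2)" using power_charac_decay[of 1 0] by auto
  then have "((\<lambda>x. LBINT \<xi>. cos (\<xi> * x + 0) * charac 1 \<xi>) \<longlongrightarrow> 0) at_top"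
    by (intro riemann_lebesgue[of _ C] continuous_intros continuous_psi) simp
  from tendsto_divide[OF this tendsto_const, of "2 * pi"] show ?thesis
    by (simp add: heat_kernel_def cos_transform_0[abs_def])
qed

lemma deriv_heat_kernel_eq:
  "deriv (heat_kernel 1) x = - (LBINT \<xi>. sin (\<xi> * x) * (\<xi> * charac 1 \<xi>)) / (2 * pi)"
  by (simp only: heat_kernel_smooth(2)[OF zero_less_one] cos_transform_1)

lemma deriv_heat_kernel_tendsto_0: "(deriv (heat_kernel 1) \<longlongrightarrow> 0) at_top"
proof -
  obtain C where "\<And>\<xi>. \<bar>\<xi> ^ 1 * charac 1 \<xi>\<bar> \<le> C / (1 + \<xi>\<^sup>2)" using power_charac_decay[of 1 1] by auto
  then have "((\<lambda>x. LBINT \<xi>. cos (\<xi> * x + pi / 2) * (\<xi> * charac 1 \<xi>)) \<longlongrightarrow> 0) at_top"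
    by (intro riemann_lebesgue[of _ C] continuous_intros continuous_psi) simp
  from tendsto_divide[OF this tendsto_const, of "2 * pi"] show ?thesis
    by (simp add: deriv_heat_kernel_eq[abs_def] cos_add)
qed

end

text \<open>Common majorant of the time-1 characteristic functions of all admissible coefficients,
  read off from \<open>psi_ge\<close>.\<close>

definition charac_bound :: "real \<Rightarrow> real \<Rightarrow> real" where
  "charac_bound \<alpha> \<xi> = exp (- ((1 - cos (1/2)) / 2 * \<bar>\<xi>\<bar> powr \<alpha>))"

lemma integrable_charac_bound:
  assumes "0 < \<alpha>"
  shows "integrable lborel (\<lambda>\<xi>. \<bar>\<xi>\<bar> * charac_bound \<alpha> \<xi>)"
proof -
  have "cos (1/2::real) < cos 0" using pi_gt3 by (intro cos_monotone_0_pi) auto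
  then have "0 < (1 - cos (1/2::real)) / 2" by simp
  from power_exp_decay[OF this assms, of 1]
  obtain C where "\<And>\<xi>. \<bar>\<xi>\<bar> ^ 1 * exp (- ((1 - cos (1/2)) / 2 * \<bar>\<xi>\<bar> powr \<alpha>)) \<le> C / (1 + \<xi>\<^sup>2)" by blast
  then show ?thesis
    by (intro integrable_decay[of _ C]) (simp_all add: charac_bound_def abs_mult)
qed

text \<open>The exponential is Lipschitz with the weight \<open>charac_bound\<close>, whichever of
  the two exponents is larger. The integral on the right is therefore a constant of \<alpha> alone;
  the factor 1 / (2 pi) is estimated by 1.\<close>

lemma deriv_heat_kernel_diff_le:
  assumes "stable_like \<alpha> \<kappa>" "stable_like \<alpha> \<kappa>'"
    and diff: "\<And>\<xi>. \<bar>levy_exponent \<alpha> \<kappa> \<xi> - levy_exponent \<alpha> \<kappa>' \<xi>\<bar> \<le> \<delta>"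
  shows "\<bar>deriv (stable_like.heat_kernel \<alpha> \<kappa> 1) x - deriv (stable_like.heat_kernel \<alpha> \<kappa>' 1) x\<bar>
    \<le> \<delta> * (LBINT \<xi>. \<bar>\<xi>\<bar> * charac_bound \<alpha> \<xi>)"
proof -
  interpret A: stable_like \<alpha> \<kappa> by fact
  interpret B: stable_like \<alpha> \<kappa>' by fact
  have i: "integrable lborel (\<lambda>\<xi>. sin (\<xi> * x) * (\<xi> * A.charac 1 \<xi>))"
    "integrable lborel (\<lambda>\<xi>. sin (\<xi> * x) * (\<xi> * B.charac 1 \<xi>))"
    using integrable_bounded_mult[OF A.integrable_power_charac[of 1 1], of "\<lambda>\<xi>. sin (\<xi> * x)" 1]
      integrable_bounded_mult[OF B.integrable_power_charac[of 1 1], of "\<lambda>\<xi>. sin (\<xi> * x)" 1] by simp_all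
  have eq: "deriv (A.heat_kernel 1) x - deriv (B.heat_kernel 1) x =
      (LBINT \<xi>. sin (\<xi> * x) * (\<xi> * B.charac 1 \<xi>) - sin (\<xi> * x) * (\<xi> * A.charac 1 \<xi>)) / (2 * pi)"
    unfolding A.deriv_heat_kernel_eq B.deriv_heat_kernel_eq Bochner_Integration.integral_diff[OF i(2,1)]
    by (simp add: diff_divide_distrib)
  have "\<bar>LBINT \<xi>. sin (\<xi> * x) * (\<xi> * B.charac 1 \<xi>) - sin (\<xi> * x) * (\<xi> * A.charac 1 \<xi>)\<bar>
      \<le> (LBINT \<xi>. \<delta> * (\<bar>\<xi>\<bar> * charac_bound \<alpha> \<xi>))"
  proof (rule order_trans[OF integral_abs_bound], rule integral_mono)
    show "integrable lborel (\<lambda>\<xi>. \<bar>sin (\<xi> * x) * (\<xi> * B.charac 1 \<xi>) - sin (\<xi> * x) * (\<xi> * A.charac 1 \<xi>)\<bar>)"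
      by (rule integrable_abs[OF Bochner_Integration.integrable_diff[OF i(2,1)]])
    show "integrable lborel (\<lambda>\<xi>. \<delta> * (\<bar>\<xi>\<bar> * charac_bound \<alpha> \<xi>))"
      by (rule integrable_mult_right[OF integrable_charac_bound[OF A.alpha(1)]])
    fix \<xi>
    have "\<bar>exp (- (1 * B.psi \<xi>)) - exp (- (1 * A.psi \<xi>))\<bar> \<le> \<bar>1 * B.psi \<xi> - 1 * A.psi \<xi>\<bar> * charac_bound \<alpha> \<xi>"
      unfolding charac_bound_def using A.psi_ge[of \<xi>] B.psi_ge[of \<xi>] by (intro abs_exp_minus_diff_le) auto
    also have "\<dots> \<le> \<delta> * charac_bound \<alpha> \<xi>"
      using diff[of \<xi>] by (intro mult_right_mono) (auto simp: charac_bound_def)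
    finally have *: "\<bar>B.charac 1 \<xi> - A.charac 1 \<xi>\<bar> \<le> \<delta> * charac_bound \<alpha> \<xi>" .
    have "\<bar>sin (\<xi> * x) * (\<xi> * B.charac 1 \<xi>) - sin (\<xi> * x) * (\<xi> * A.charac 1 \<xi>)\<bar>
        = \<bar>sin (\<xi> * x)\<bar> * (\<bar>\<xi>\<bar> * \<bar>B.charac 1 \<xi> - A.charac 1 \<xi>\<bar>)"
      by (simp only: right_diff_distrib[symmetric] abs_mult)
    also have "\<dots> \<le> 1 * (\<bar>\<xi>\<bar> * (\<delta> * charac_bound \<alpha> \<xi>))"
      using * by (intro mult_mono mult_left_mono) auto
    finally show "\<bar>sin (\<xi> * x) * (\<xi> * B.charac 1 \<xi>) - sin (\<xi> * x) * (\<xi> * A.charac 1 \<xi>)\<bar>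
        \<le> \<delta> * (\<bar>\<xi>\<bar> * charac_bound \<alpha> \<xi>)" by (simp only: mult_1_left mult.left_commute)
  qed
  also have "\<dots> = \<delta> * (LBINT \<xi>. \<bar>\<xi>\<bar> * charac_bound \<alpha> \<xi>)" by (rule integral_mult_right_zero)
  finally have le: "\<bar>LBINT \<xi>. sin (\<xi> * x) * (\<xi> * B.charac 1 \<xi>) - sin (\<xi> * x) * (\<xi> * A.charac 1 \<xi>)\<bar>
      \<le> \<delta> * (LBINT \<xi>. \<bar>\<xi>\<bar> * charac_bound \<alpha> \<xi>)" .
  show ?thesis
    unfolding eq abs_divide
  proof (rule order_trans[OF _ le])
    have "\<bar>I\<bar> / \<bar>2 * pi\<bar> \<le> \<bar>I\<bar>" for I :: real
      using mult_left_mono[of 1 "2 * pi" "\<bar>I\<bar>"] pi_gt3 by (simp add: divide_le_eq)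
    then show "\<bar>LBINT \<xi>. sin (\<xi> * x) * (\<xi> * B.charac 1 \<xi>) - sin (\<xi> * x) * (\<xi> * A.charac 1 \<xi>)\<bar> / \<bar>2 * pi\<bar>
       \<le> \<bar>LBINT \<xi>. sin (\<xi> * x) * (\<xi> * B.charac 1 \<xi>) - sin (\<xi> * x) * (\<xi> * A.charac 1 \<xi>)\<bar>" .
  qed
qed

lemma powr_tail_tendsto_0:
  fixes s :: real
  assumes "s < -1"
  shows "((\<lambda>A. LBINT y. indicator {y. A \<le> \<bar>y\<bar>} y * \<bar>y\<bar> powr s) \<longlongrightarrow> 0) at_top"
    and "A > 1 \<Longrightarrow> integrable lborel (\<lambda>y. indicator {y. A \<le> \<bar>y\<bar>} y * \<bar>y\<bar> powr s)"
proof -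
  have le: "\<bar>indicator {y. A \<le> \<bar>y\<bar>} y * \<bar>y\<bar> powr s\<bar> \<le> indicator (-{-1..1}) y * \<bar>y\<bar> powr s" if "A > 1" for A y
    using that by (auto split: split_indicator)
  show "integrable lborel (\<lambda>y. indicator {y. A \<le> \<bar>y\<bar>} y * \<bar>y\<bar> powr s)" if "A > 1" for A
    by (rule integrable_dominated[OF integrable_powr_at_infinity[OF assms] _ le[OF that]]) measurable
  have "((\<lambda>A. LBINT y. indicator {y. A \<le> \<bar>y\<bar>} y * \<bar>y\<bar> powr s) \<longlongrightarrow> (LBINT y::real. 0)) at_top"
  proof (rule integral_dominated_convergence_at_top[where w = "\<lambda>y. indicator (-{-1..1}) y * \<bar>y\<bar> powr s"])
    show "integrable lborel (\<lambda>y. indicator (-{-1..1}) y * \<bar>y\<bar> powr s)"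
      by (rule integrable_powr_at_infinity[OF assms])
    show "AE y in lborel. ((\<lambda>A. indicator {y. A \<le> \<bar>y\<bar>} y * \<bar>y\<bar> powr s) \<longlongrightarrow> 0) at_top"
    proof (rule AE_I2)
      fix y :: real
      have "\<forall>\<^sub>F A in at_top. indicator {y. A \<le> \<bar>y\<bar>} y * \<bar>y\<bar> powr s = 0"
        using eventually_gt_at_top[of "\<bar>y\<bar>"] by eventually_elim simp
      then show "((\<lambda>A. indicator {y. A \<le> \<bar>y\<bar>} y * \<bar>y\<bar> powr s) \<longlongrightarrow> 0) at_top"
        by (rule tendsto_eventually)
    qed
    show "\<forall>\<^sub>F A in at_top. AE y in lborel. norm (indicator {y. A \<le> \<bar>y\<bar>} y * \<bar>y\<bar> powr s)
        \<le> indicator (-{-1..1}) y * \<bar>y\<bar> powr s"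
      using eventually_gt_at_top[of 1] by eventually_elim (simp only: real_norm_def le AE_I2)
  qed measurable
  then show "((\<lambda>A. LBINT y. indicator {y. A \<le> \<bar>y\<bar>} y * \<bar>y\<bar> powr s) \<longlongrightarrow> 0) at_top" by simp
qed

text \<open>The exponents differ by at most twice the mass of \<bar>y\<bar>^(-1-\<alpha>) beyond
  \<open>A\<close>, since 1 - cos \<le> 2 and two values in [1, 2] differ by at most 1. The order of
  quantifiers matters: \<open>A\<close> is fixed before the coefficients, so the estimate applies
  later to a limit coefficient that is still unknown when \<open>A\<close> is chosen.\<close>

lemma deriv_heat_kernel_stability:
  assumes "0 < \<alpha>" "0 < \<epsilon>"
  shows "\<exists>A. \<forall>\<kappa> \<kappa>' x. stable_like \<alpha> \<kappa> \<longrightarrow> stable_like \<alpha> \<kappa>' \<longrightarrow> (\<forall>y. \<bar>y\<bar> < A \<longrightarrow> \<kappa> y = \<kappa>' y) \<longrightarrow>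
    \<bar>deriv (stable_like.heat_kernel \<alpha> \<kappa> 1) x - deriv (stable_like.heat_kernel \<alpha> \<kappa>' 1) x\<bar> < \<epsilon>"
proof -
  define K where "K = (LBINT \<xi>. \<bar>\<xi>\<bar> * charac_bound \<alpha> \<xi>)"
  define T where "T A = (LBINT y. indicator {y. A \<le> \<bar>y\<bar>} y * \<bar>y\<bar> powr (-1-\<alpha>))" for A
  have "((\<lambda>A. (2 * T A) * K) \<longlongrightarrow> (2 * 0) * K) at_top"
    unfolding T_def using assms by (intro tendsto_intros powr_tail_tendsto_0) auto
  then have "\<forall>\<^sub>F A in at_top. (2 * T A) * K < \<epsilon>"
    using assms by (intro order_tendstoD(2)) auto
  from eventually_conj[OF this eventually_gt_at_top[of 1]]
  obtain A where A: "(2 * T A) * K < \<epsilon>" "A > 1"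
    by (auto simp: eventually_at_top_linorder)
  have "\<bar>deriv (stable_like.heat_kernel \<alpha> \<kappa> 1) x - deriv (stable_like.heat_kernel \<alpha> \<kappa>' 1) x\<bar> < \<epsilon>"
    if \<kappa>: "stable_like \<alpha> \<kappa>" "stable_like \<alpha> \<kappa>'" "\<And>y. \<bar>y\<bar> < A \<Longrightarrow> \<kappa> y = \<kappa>' y" for \<kappa> \<kappa>' x
  proof -
    interpret A: stable_like \<alpha> \<kappa> by fact
    interpret B: stable_like \<alpha> \<kappa>' by fact
    have "\<bar>A.psi \<xi> - B.psi \<xi>\<bar> \<le> 2 * T A" for \<xi>
    proof -
      have eq: "A.psi \<xi> - B.psi \<xi> = (LBINT y. (1 - cos (\<xi> * y)) * A.nu y - (1 - cos (\<xi> * y)) * B.nu y)"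
        unfolding levy_exponent_def
        by (rule Bochner_Integration.integral_diff[symmetric, OF A.integrable_levy B.integrable_levy])
      have "\<bar>A.psi \<xi> - B.psi \<xi>\<bar> \<le> (LBINT y. 2 * (indicator {y. A \<le> \<bar>y\<bar>} y * \<bar>y\<bar> powr (-1-\<alpha>)))"
        unfolding eq
      proof (rule order_trans[OF integral_abs_bound], rule integral_mono)
        show "integrable lborel (\<lambda>y. \<bar>(1 - cos (\<xi> * y)) * A.nu y - (1 - cos (\<xi> * y)) * B.nu y\<bar>)"
          by (rule integrable_abs[OF Bochner_Integration.integrable_diff[OF A.integrable_levy B.integrable_levy]])
        show "integrable lborel (\<lambda>y. 2 * (indicator {y. A \<le> \<bar>y\<bar>} y * \<bar>y\<bar> powr (-1-\<alpha>)))"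
          using assms A by (intro integrable_mult_right powr_tail_tendsto_0(2)) auto
        fix y
        show "\<bar>(1 - cos (\<xi> * y)) * A.nu y - (1 - cos (\<xi> * y)) * B.nu y\<bar>
            \<le> 2 * (indicator {y. A \<le> \<bar>y\<bar>} y * \<bar>y\<bar> powr (-1-\<alpha>))"
        proof (cases "\<bar>y\<bar> < A")
          case True
          then show ?thesis using \<kappa>(3)[of y] by simp
        next
          case False
          have p: "1 / \<bar>y\<bar> powr (1 + \<alpha>) = \<bar>y\<bar> powr (-1-\<alpha>)"
            using powr_minus_divide[of "\<bar>y\<bar>" "1 + \<alpha>"] by simp
          have "\<bar>(1 - cos (\<xi> * y)) * A.nu y - (1 - cos (\<xi> * y)) * B.nu y\<bar>
              = \<bar>1 - cos (\<xi> * y)\<bar> * (\<bar>\<kappa> y - \<kappa>' y\<bar> * (1 / \<bar>y\<bar> powr (1 + \<alpha>)))"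
            by (simp add: abs_mult flip: right_diff_distrib diff_divide_distrib)
          also have "\<dots> \<le> 2 * (1 * (1 / \<bar>y\<bar> powr (1 + \<alpha>)))"
            using one_minus_cos_bounds[of "\<xi> * y"] A.kappa_bounds[of y] B.kappa_bounds[of y]
            by (intro mult_mono) auto
          finally show ?thesis using False by (simp add: p)
        qed
      qed
      also have "\<dots> = 2 * T A" unfolding T_def by (rule integral_mult_right_zero)
      finally show ?thesis .
    qed
    from deriv_heat_kernel_diff_le[OF \<kappa>(1,2) this, of x] A(1) show ?thesis by (simp add: K_def)
  qed
  then show ?thesis by (intro exI[of _ A] allI impI) simp_all
qed

section \<open>Adding a bump\<close>

text \<open>The factor \<open>(\<bar>y\<bar> / (a + 1)) powr (1 + \<alpha>)\<close> makes the added Levy density constant on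
  \<open>a \<le> \<bar>y\<bar> \<le> a + 1\<close>, so that the change of the exponent is explicit.\<close>

definition bump :: "real \<Rightarrow> real \<Rightarrow> real \<Rightarrow> real" where
  "bump \<alpha> a y = (if a \<le> \<bar>y\<bar> \<and> \<bar>y\<bar> \<le> a + 1 then (\<bar>y\<bar> / (a + 1)) powr (1 + \<alpha>) else 0)"

text \<open>Normalising at the outer end a + 1 keeps \<open>bump\<close> at most 1, so that it fits
  into [1, 2] where \<kappa> = 1. The height is comparable to a^(-1-\<alpha>), the size of the
  derivative to be produced.\<close>

definition bump_height :: "real \<Rightarrow> real \<Rightarrow> real" where
  "bump_height \<alpha> a = 1 / (a + 1) powr (1 + \<alpha>)"

lemma bump_density:
  assumes "a > 0"
  shows "bump \<alpha> a y / \<bar>y\<bar> powr (1 + \<alpha>) = bump_height \<alpha> a * (indicator {a..a+1} y + indicator {-a-1..-a} y)"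
proof (cases "a \<le> \<bar>y\<bar> \<and> \<bar>y\<bar> \<le> a + 1")
  case True
  then have "\<bar>y\<bar> powr (1 + \<alpha>) \<noteq> 0" using assms by auto
  then have "bump \<alpha> a y / \<bar>y\<bar> powr (1 + \<alpha>) = bump_height \<alpha> a"
    using True assms by (simp add: bump_def bump_height_def powr_divide)
  moreover have "indicator {a..a+1} y + indicator {-a-1..-a} y = (1::real)"
    using True assms by (auto simp: abs_real_def split: split_indicator if_splits)
  ultimately show ?thesis by simp
next
  case False
  then show ?thesis using assms by (auto simp: bump_def split: split_indicator)
qed

context stable_like
begin

lemma add_bump:
  assumes a: "a > 0" and one: "\<And>y. a \<le> \<bar>y\<bar> \<Longrightarrow> \<kappa> y = 1"
  shows "stable_like \<alpha> (\<lambda>y. \<kappa> y + bump \<alpha> a y)"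
proof
  show "0 < \<alpha>" "\<alpha> < 2" by (fact alpha)+
  show "(\<lambda>y. \<kappa> y + bump \<alpha> a y) \<in> borel_measurable borel"
    unfolding bump_def by measurable
  fix y
  show "\<kappa> (- y) + bump \<alpha> a (- y) = \<kappa> y + bump \<alpha> a y"
    by (simp add: kappa_even bump_def)
  have "0 \<le> bump \<alpha> a y" by (simp add: bump_def)
  then show "1 \<le> \<kappa> y + bump \<alpha> a y" using kappa_bounds(1)[of y] by linarith
  show "\<kappa> y + bump \<alpha> a y \<le> 2"
  proof (cases "a \<le> \<bar>y\<bar> \<and> \<bar>y\<bar> \<le> a + 1")
    case True
    have "(\<bar>y\<bar> / (a + 1)) powr (1 + \<alpha>) \<le> 1 powr (1 + \<alpha>)"
      using True a alpha by (intro powr_mono2) auto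
    then show ?thesis using True one[of y] by (simp add: bump_def)
  next
    case False
    then show ?thesis using kappa_bounds(2)[of y] by (auto simp: bump_def)
  qed
qed

text \<open>The bump consists of two unit intervals and 1 - cos \<le> 2, whence the 4. The identity
  is stated for \<xi> \<eta>(\<xi>) since \<xi> (1 - cos (\<xi> y)) has the antiderivative \<xi> y -
  sin (\<xi> y), valid also at \<xi> = 0, and since the derivative of the kernel carries exactly
  this factor \<xi>.\<close>

lemma psi_add_bump:
  assumes a: "a > 0"
  defines "\<eta> \<equiv> \<lambda>\<xi>. levy_exponent \<alpha> (\<lambda>y. \<kappa> y + bump \<alpha> a y) \<xi> - psi \<xi>"
  shows "0 \<le> \<eta> \<xi>" "\<eta> \<xi> \<le> 4 * bump_height \<alpha> a"
    and "\<xi> * \<eta> \<xi> = 2 * bump_height \<alpha> a * (\<xi> - sin (\<xi> * (a + 1)) + sin (\<xi> * a))"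
proof -
  define \<omega> where "\<omega> = bump_height \<alpha> a"
  define J where "J y = (1 - cos (\<xi> * y)) * (indicator {a..a+1} y + indicator {-a-1..-a} y)" for y :: real
  have \<omega>: "0 \<le> \<omega>" by (simp add: \<omega>_def bump_height_def)
  have ind: "integrable lborel (\<lambda>y. indicator {a..a+1} y + indicator {-a-1..-a} y :: real)"
    by (intro Bochner_Integration.integrable_add integrable_real_indicator) auto
  have c2: "\<bar>1 - cos x\<bar> \<le> 2" for x :: real using one_minus_cos_bounds[of x] by simp
  have J: "integrable lborel J"
    unfolding J_def by (rule integrable_bounded_mult[OF ind _ c2]) simp
  have J_bounds: "0 \<le> J y" "J y \<le> 2 * (indicator {a..a+1} y + indicator {-a-1..-a} y)" for y
    unfolding J_def
    by (intro mult_nonneg_nonneg one_minus_cos_bounds, simp) (intro mult_right_mono one_minus_cos_bounds, simp)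
  have "levy_exponent \<alpha> (\<lambda>y. \<kappa> y + bump \<alpha> a y) \<xi> = (LBINT y. (1 - cos (\<xi> * y)) * nu y + \<omega> * J y)"
    unfolding levy_exponent_def add_divide_distrib bump_density[OF a] J_def \<omega>_def
    by (simp only: distrib_left mult.left_commute)
  also have "\<dots> = psi \<xi> + \<omega> * (LBINT y. J y)"
    unfolding levy_exponent_def
    by (subst Bochner_Integration.integral_add[OF integrable_levy integrable_mult_right[OF J]])
       (simp only: integral_mult_right_zero)
  finally have \<eta>: "\<eta> \<xi> = \<omega> * (LBINT y. J y)" by (simp add: \<eta>_def)
  show "0 \<le> \<eta> \<xi>" unfolding \<eta> using \<omega> J_bounds by (intro mult_nonneg_nonneg integral_nonneg_AE AE_I2)
  have "(LBINT y. J y) \<le> (LBINT y. 2 * (indicator {a..a+1} y + indicator {-a-1..-a} y))"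
    by (intro integral_mono J integrable_mult_right ind J_bounds)
  also have "\<dots> = 2 * ((LBINT y. indicator {a..a+1} y) + (LBINT y. indicator {-a-1..-a} y))"
    by (subst integral_mult_right_zero, subst Bochner_Integration.integral_add) (auto intro!: integrable_real_indicator)
  also have "\<dots> = 4" by simp
  finally have "\<omega> * (LBINT y. J y) \<le> \<omega> * 4" using \<omega> by (intro mult_left_mono)
  then show "\<eta> \<xi> \<le> 4 * bump_height \<alpha> a" unfolding \<eta> \<omega>_def by simp
  \<comment> \<open>Used with b = a and b = -a-1, the left ends of the two unit intervals.\<close>
  have FTC: "has_bochner_integral lborel (\<lambda>y. (\<xi> * (1 - cos (\<xi> * y))) * indicator {b..b+1} y)
      ((\<xi> * (b + 1) - sin (\<xi> * (b + 1))) - (\<xi> * b - sin (\<xi> * b)))" for b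
    by (rule has_bochner_integral_FTC_Icc_real) (auto intro!: derivative_eq_intros continuous_intros simp: algebra_simps)
  have "\<xi> * (LBINT y. J y) = (LBINT y. (\<xi> * (1 - cos (\<xi> * y))) * indicator {a..a+1} y
      + (\<xi> * (1 - cos (\<xi> * y))) * indicator {-a-1..-a-1+1} y)"
    unfolding J_def integral_mult_right_zero[symmetric] by (simp add: algebra_simps)
  also have "\<dots> = ((\<xi> * (a + 1) - sin (\<xi> * (a + 1))) - (\<xi> * a - sin (\<xi> * a)))
      + ((\<xi> * (-a-1 + 1) - sin (\<xi> * (-a-1 + 1))) - (\<xi> * (-a-1) - sin (\<xi> * (-a-1))))"
    by (rule has_bochner_integral_integral_eq[OF has_bochner_integral_add[OF FTC FTC]])
  also have "\<dots> = 2 * (\<xi> - sin (\<xi> * (a + 1)) + sin (\<xi> * a))"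
  proof -
    have "\<xi> * (-a-1) = - (\<xi> * (a + 1))" "\<xi> * (-a-1 + 1) = - (\<xi> * a)" by (simp_all add: algebra_simps)
    then show ?thesis by (simp only: sin_minus) (simp add: algebra_simps)
  qed
  finally have "\<xi> * (LBINT y. J y) = 2 * (\<xi> - sin (\<xi> * (a + 1)) + sin (\<xi> * a))" .
  then show "\<xi> * \<eta> \<xi> = 2 * bump_height \<alpha> a * (\<xi> - sin (\<xi> * (a + 1)) + sin (\<xi> * a))"
    unfolding \<eta> \<omega>_def[symmetric] by (metis mult.left_commute mult.assoc)
qed

text \<open>To first order in the height \<open>\<omega>\<close> of the bump, the derivative of the kernel at \<open>a\<close> changes by
  \<open>\<omega> (p(0) - p(1))\<close>: one jump of size between \<open>a\<close> and \<open>a + 1\<close> moves the profile of \<open>p\<close> near the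
  origin to \<open>a\<close>.\<close>

lemma deriv_heat_kernel_add_bump:
  assumes a: "a > 0" and one: "\<And>y. a \<le> \<bar>y\<bar> \<Longrightarrow> \<kappa> y = 1"
  defines "\<omega> \<equiv> bump_height \<alpha> a"
  shows "\<bar>deriv (stable_like.heat_kernel \<alpha> (\<lambda>y. \<kappa> y + bump \<alpha> a y) 1) a - deriv (heat_kernel 1) a
      - \<omega> * (heat_kernel 1 0 - heat_kernel 1 1)\<bar>
    \<le> \<omega> * (2 * \<bar>deriv (heat_kernel 1) a\<bar> + \<bar>heat_kernel 1 (2 * a)\<bar> + \<bar>heat_kernel 1 (2 * a + 1)\<bar>
        + \<omega> * (8 * exp 4 * (LBINT \<xi>. \<bar>\<xi>\<bar> * charac 1 \<xi>)))"
proof -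
  interpret B: stable_like \<alpha> "\<lambda>y. \<kappa> y + bump \<alpha> a y" by (rule add_bump[OF a one])
  define \<eta> where "\<eta> \<xi> = B.psi \<xi> - psi \<xi>" for \<xi>
  note \<eta> = psi_add_bump[OF a, folded \<eta>_def \<omega>_def]
  have \<omega>: "0 < \<omega>" "\<omega> \<le> 1"
    using a alpha by (auto simp: \<omega>_def bump_height_def ge_one_powr_ge_zero)
  have [measurable]: "\<eta> \<in> borel_measurable borel" unfolding \<eta>_def by measurable
  have G: "integrable lborel (charac 1)" "integrable lborel (\<lambda>\<xi>. \<xi> * charac 1 \<xi>)"
    using integrable_charac[of 1] integrable_power_charac[of 1 1] by simp_all
  have GB: "integrable lborel (\<lambda>\<xi>. \<xi> * B.charac 1 \<xi>)" using B.integrable_power_charac[of 1 1] by simp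
  have i: "integrable lborel (\<lambda>\<xi>. sin (\<xi> * a) * (\<xi> * charac 1 \<xi>))"
    "integrable lborel (\<lambda>\<xi>. sin (\<xi> * a) * (\<xi> * B.charac 1 \<xi>))"
    by (rule integrable_bounded_mult[OF G(2), where B = 1], simp_all)
       (rule integrable_bounded_mult[OF GB, where B = 1, simplified], simp_all)
  have c: "integrable lborel (\<lambda>\<xi>. cos (\<xi> * z) * charac 1 \<xi>)" for z
    by (rule integrable_cos_mult[OF G(1)]) simp
  \<comment> \<open>The first-order term sin (\<xi> a) \<xi> \<eta>(\<xi>) times the characteristic
    function, written by product-to-sum formulas; 0, 1, 2a and 2a + 1 are the differences and sums
    of a with a and a + 1.\<close>
  define M where "M \<xi> = \<omega> * (2 * (sin (\<xi> * a) * (\<xi> * charac 1 \<xi>)) + (cos (\<xi> * 0) * charac 1 \<xi> - cos (\<xi> * 1) * charac 1 \<xi>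
      - cos (\<xi> * (2 * a)) * charac 1 \<xi> + cos (\<xi> * (2 * a + 1)) * charac 1 \<xi>))" for \<xi>
  have M: "integrable lborel M" unfolding M_def
    by (intro integrable_mult_right Bochner_Integration.integrable_add Bochner_Integration.integrable_diff i c)
  \<comment> \<open>Read as convolutions: the total mass 2 \<omega> of the bump removes 2 \<omega>
    p'(a), its right half adds \<omega> (p(0) - p(1)), and its mirror image adds \<omega> (p(2a + 1)
    - p(2a)).\<close>
  have M_int: "(LBINT \<xi>. M \<xi>) / (2 * pi) = \<omega> * (- 2 * deriv (heat_kernel 1) a +
      (heat_kernel 1 0 - heat_kernel 1 1 - heat_kernel 1 (2 * a) + heat_kernel 1 (2 * a + 1)))"
  proof -
    have "(LBINT \<xi>. M \<xi>) = \<omega> * (2 * (LBINT \<xi>. sin (\<xi> * a) * (\<xi> * charac 1 \<xi>))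
        + ((LBINT \<xi>. cos (\<xi> * 0) * charac 1 \<xi>) - (LBINT \<xi>. cos (\<xi> * 1) * charac 1 \<xi>)
      - (LBINT \<xi>. cos (\<xi> * (2 * a)) * charac 1 \<xi>) + (LBINT \<xi>. cos (\<xi> * (2 * a + 1)) * charac 1 \<xi>)))"
      unfolding M_def
      by (simp only: integral_mult_right_zero Bochner_Integration.integral_add Bochner_Integration.integral_diff
          integrable_mult_right Bochner_Integration.integrable_add Bochner_Integration.integrable_diff i c)
    moreover have "\<omega> * (2 * S + (p - q - r + s)) / (2 * pi)
        = \<omega> * (- 2 * (- S / (2 * pi)) + (p / (2 * pi) - q / (2 * pi) - r / (2 * pi) + s / (2 * pi)))" for S p q r s
      by (simp add: field_simps)
    moreover have "heat_kernel 1 z = (LBINT \<xi>. cos (\<xi> * z) * charac 1 \<xi>) / (2 * pi)" for z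
      by (simp only: heat_kernel_def cos_transform_0)
    ultimately show ?thesis by (simp only: deriv_heat_kernel_eq)
  qed
  have trig: "sin (\<xi> * a) * (\<xi> * \<eta> \<xi>) * charac 1 \<xi> = M \<xi>" for \<xi>
  proof -
    have 1: "2 * (sin (\<xi> * a) * sin (\<xi> * a)) = 1 - cos (\<xi> * (2 * a))"
      using sin_times_sin[of "\<xi> * a" "\<xi> * a"] by (simp add: algebra_simps)
    have "\<xi> * (2 * a + 1) = \<xi> * a + \<xi> * (a + 1)" "\<xi> * 1 = \<xi> * (a + 1) - \<xi> * a" by (simp_all add: algebra_simps)
    then have 2: "2 * (sin (\<xi> * a) * sin (\<xi> * (a + 1))) = cos (\<xi> * 1) - cos (\<xi> * (2 * a + 1))"
      by (simp only: cos_add cos_diff) simp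
    have "sin (\<xi> * a) * (\<xi> * \<eta> \<xi>) = \<omega> * (2 * (\<xi> * sin (\<xi> * a)) - 2 * (sin (\<xi> * a) * sin (\<xi> * (a + 1))) + 2 * (sin (\<xi> * a) * sin (\<xi> * a)))"
      unfolding \<eta>(3) by (simp add: algebra_simps)
    also have "\<dots> = \<omega> * (2 * (\<xi> * sin (\<xi> * a)) - (cos (\<xi> * 1) - cos (\<xi> * (2 * a + 1))) + (1 - cos (\<xi> * (2 * a))))"
      by (simp only: 1 2)
    finally have *: "sin (\<xi> * a) * (\<xi> * \<eta> \<xi>) = \<omega> * (2 * (\<xi> * sin (\<xi> * a)) - (cos (\<xi> * 1) - cos (\<xi> * (2 * a + 1))) + (1 - cos (\<xi> * (2 * a))))" .
    show ?thesis unfolding * M_def by (simp add: algebra_simps)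
  qed
  \<comment> \<open>The error of replacing exp (-\<eta>) by 1 - \<eta>. As 0 \<le> \<eta> \<le> 4
    \<omega> \<le> 4, it is at most exp 4 / 2 times (4 \<omega>)^2, the source of
    \<open>8 * exp 4\<close>.\<close>
  define R where "R \<xi> = sin (\<xi> * a) * (\<xi> * charac 1 \<xi>) - sin (\<xi> * a) * (\<xi> * B.charac 1 \<xi>) - M \<xi>" for \<xi>
  have R: "integrable lborel R"
    unfolding R_def by (intro Bochner_Integration.integrable_diff i M)
  have "\<bar>R \<xi>\<bar> \<le> \<omega>\<^sup>2 * (8 * exp 4) * (\<bar>\<xi>\<bar> * charac 1 \<xi>)" for \<xi>
  proof -
    have B: "B.charac 1 \<xi> = charac 1 \<xi> * exp (- \<eta> \<xi>)" by (simp add: \<eta>_def flip: exp_add)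
    have "R \<xi> = sin (\<xi> * a) * (\<xi> * charac 1 \<xi>) * (- (exp (- \<eta> \<xi>) - 1 - (- \<eta> \<xi>)))"
      unfolding R_def trig[symmetric] B by (simp add: algebra_simps)
    also have "\<bar>\<dots>\<bar> = \<bar>sin (\<xi> * a)\<bar> * (\<bar>\<xi>\<bar> * charac 1 \<xi>) * \<bar>exp (- \<eta> \<xi>) - 1 - (- \<eta> \<xi>)\<bar>"
      by (simp only: abs_mult abs_minus_cancel abs_exp_cancel)
    also have "\<dots> \<le> 1 * (\<bar>\<xi>\<bar> * charac 1 \<xi>) * (exp 4 / 2 * (4 * \<omega>)\<^sup>2)"
    proof (intro mult_mono)
      have "exp \<bar>- \<eta> \<xi>\<bar> \<le> exp 4" using \<eta>(1,2)[of \<xi>] \<omega> by simp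
      moreover have "(- \<eta> \<xi>)\<^sup>2 \<le> (4 * \<omega>)\<^sup>2" unfolding power2_minus by (intro power_mono \<eta>)
      ultimately show "\<bar>exp (- \<eta> \<xi>) - 1 - (- \<eta> \<xi>)\<bar> \<le> exp 4 / 2 * (4 * \<omega>)\<^sup>2"
        by (intro order_trans[OF exp_quadratic_remainder] mult_mono divide_right_mono) auto
    qed auto
    also have "\<dots> = \<omega>\<^sup>2 * (8 * exp 4) * (\<bar>\<xi>\<bar> * charac 1 \<xi>)" by (simp add: power_mult_distrib)
    finally show ?thesis .
  qed
  then have "\<bar>LBINT \<xi>. R \<xi>\<bar> \<le> (LBINT \<xi>. \<omega>\<^sup>2 * (8 * exp 4) * (\<bar>\<xi>\<bar> * charac 1 \<xi>))"
    using integrable_abs[OF G(2)] R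
    by (intro order_trans[OF integral_abs_bound integral_mono] integrable_abs integrable_mult_right)
       (simp_all add: abs_mult)
  also have "\<dots> = \<omega> * (\<omega> * (8 * exp 4 * (LBINT \<xi>. \<bar>\<xi>\<bar> * charac 1 \<xi>)))"
    by (simp only: integral_mult_right_zero power2_eq_square mult.assoc)
  finally have "\<bar>LBINT \<xi>. R \<xi>\<bar> \<le> \<omega> * (\<omega> * (8 * exp 4 * (LBINT \<xi>. \<bar>\<xi>\<bar> * charac 1 \<xi>)))" .
  moreover have "\<bar>(LBINT \<xi>. R \<xi>) / (2 * pi)\<bar> \<le> \<bar>LBINT \<xi>. R \<xi>\<bar>"
    using mult_left_mono[of 1 "2 * pi" "\<bar>LBINT \<xi>. R \<xi>\<bar>"] pi_gt3 by (simp add: divide_le_eq)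
  ultimately have R_le: "\<bar>(LBINT \<xi>. R \<xi>) / (2 * pi)\<bar> \<le> \<omega> * (\<omega> * (8 * exp 4 * (LBINT \<xi>. \<bar>\<xi>\<bar> * charac 1 \<xi>)))"
    by linarith
  have "(LBINT \<xi>. R \<xi>) = (LBINT \<xi>. sin (\<xi> * a) * (\<xi> * charac 1 \<xi>)) - (LBINT \<xi>. sin (\<xi> * a) * (\<xi> * B.charac 1 \<xi>)) - (LBINT \<xi>. M \<xi>)"
    unfolding R_def
    by (simp only: Bochner_Integration.integral_diff Bochner_Integration.integrable_diff i M)
  then have "(LBINT \<xi>. R \<xi>) / (2 * pi) = deriv (B.heat_kernel 1) a - deriv (heat_kernel 1) a - (LBINT \<xi>. M \<xi>) / (2 * pi)"
    unfolding deriv_heat_kernel_eq B.deriv_heat_kernel_eq by (simp add: diff_divide_distrib)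
  then have "deriv (B.heat_kernel 1) a - deriv (heat_kernel 1) a - \<omega> * (heat_kernel 1 0 - heat_kernel 1 1)
      = (LBINT \<xi>. R \<xi>) / (2 * pi) + \<omega> * (- 2 * deriv (heat_kernel 1) a - heat_kernel 1 (2 * a) + heat_kernel 1 (2 * a + 1))"
    unfolding M_int by (simp add: algebra_simps)
  moreover have "\<bar>\<omega> * (- 2 * deriv (heat_kernel 1) a - heat_kernel 1 (2 * a) + heat_kernel 1 (2 * a + 1))\<bar>
      \<le> \<omega> * (2 * \<bar>deriv (heat_kernel 1) a\<bar> + \<bar>heat_kernel 1 (2 * a)\<bar> + \<bar>heat_kernel 1 (2 * a + 1)\<bar>)"
    unfolding abs_mult using \<omega> by (intro mult_mono) auto
  ultimately show ?thesis using R_le unfolding distrib_left by linarith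
qed

end

text \<open>The constant 20 bounds \<open>4 * (1 + \<xi>\<^sup>2)\<close> from \<open>psi_le\<close> on \<open>1 \<le> \<xi> \<le> 2\<close>.\<close>

definition gap :: "real \<Rightarrow> real" where
  "gap \<alpha> = (1 - cos 1) * exp (- (20 * (LBINT y. jump_size \<alpha> y / \<bar>y\<bar> powr (1 + \<alpha>)))) / (2 * pi)"

lemma gap_pos: "0 < gap \<alpha>"
proof -
  have "cos (1::real) < cos 0" using pi_gt3 by (intro cos_monotone_0_pi) auto
  then show ?thesis by (simp add: gap_def)
qed

section \<open>One bump forces a large derivative\<close>

context stable_like
begin

text \<open>The difference is the integral of (1 - cos \<xi>) times the characteristic function over
  2 pi. The integrand is nonnegative, so it may be restricted to [1, 2], where cos \<xi> \<le> cos 1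
  and \<open>psi_le\<close> bounds the exponent for every \<kappa>.\<close>

lemma heat_kernel_gap: "gap \<alpha> \<le> heat_kernel 1 0 - heat_kernel 1 1"
proof -
  define E where "E = exp (- (20 * (LBINT y. jump_size \<alpha> y / \<bar>y\<bar> powr (1 + \<alpha>))))"
  have c: "integrable lborel (\<lambda>\<xi>. cos (\<xi> * z) * charac 1 \<xi>)" for z
    by (rule integrable_cos_mult[OF integrable_charac[OF zero_less_one]]) simp
  have J: "0 \<le> (LBINT y. jump_size \<alpha> y / \<bar>y\<bar> powr (1 + \<alpha>))"
    by (intro integral_nonneg_AE AE_I2) (simp add: jump_size_nonneg)
  have "(1 - cos 1) * E = (LBINT \<xi>. (1 - cos 1) * E * indicator {1..2::real} \<xi>)" by simp
  also have "\<dots> \<le> (LBINT \<xi>. cos (\<xi> * 0) * charac 1 \<xi> - cos (\<xi> * 1) * charac 1 \<xi>)"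
  proof (rule integral_mono)
    show "integrable lborel (\<lambda>\<xi>. (1 - cos 1) * E * indicator {1..2::real} \<xi>)"
      by (intro integrable_mult_right integrable_real_indicator) auto
    show "integrable lborel (\<lambda>\<xi>. cos (\<xi> * 0) * charac 1 \<xi> - cos (\<xi> * 1) * charac 1 \<xi>)"
      by (intro Bochner_Integration.integrable_diff c)
    fix \<xi> :: real
    have eq: "cos (\<xi> * 0) * charac 1 \<xi> - cos (\<xi> * 1) * charac 1 \<xi> = (1 - cos \<xi>) * charac 1 \<xi>"
      by (simp add: left_diff_distrib)
    show "(1 - cos 1) * E * indicator {1..2} \<xi> \<le> cos (\<xi> * 0) * charac 1 \<xi> - cos (\<xi> * 1) * charac 1 \<xi>"
    proof (cases "\<xi> \<in> {1..2}")
      case True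
      have "cos \<xi> \<le> cos 1" using True pi_gt3 by (intro cos_monotone_0_pi_le) auto
      moreover have "E \<le> charac 1 \<xi>"
      proof -
        have "\<xi>\<^sup>2 \<le> 2\<^sup>2" using True by (intro power_mono) auto
        then have "4 * (LBINT y. jump_size \<alpha> y / \<bar>y\<bar> powr (1 + \<alpha>)) * (1 + \<xi>\<^sup>2)
            \<le> 4 * (LBINT y. jump_size \<alpha> y / \<bar>y\<bar> powr (1 + \<alpha>)) * 5"
          using J by (intro mult_left_mono) auto
        from order_trans[OF psi_le this] show ?thesis by (simp add: E_def)
      qed
      ultimately have "(1 - cos 1) * E \<le> (1 - cos \<xi>) * charac 1 \<xi>"
        using one_minus_cos_bounds(1) by (intro mult_mono) (auto simp: E_def)
      then show ?thesis unfolding eq using True by simp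
    next
      case False
      then show ?thesis unfolding eq using one_minus_cos_bounds(1)[of \<xi>] by simp
    qed
  qed
  also have "\<dots> = (LBINT \<xi>. cos (\<xi> * 0) * charac 1 \<xi>) - (LBINT \<xi>. cos (\<xi> * 1) * charac 1 \<xi>)"
    by (rule Bochner_Integration.integral_diff[OF c c])
  finally have "(1 - cos 1) * E / (2 * pi) \<le> ((LBINT \<xi>. cos (\<xi> * 0) * charac 1 \<xi>) - (LBINT \<xi>. cos (\<xi> * 1) * charac 1 \<xi>)) / (2 * pi)"
    by (rule divide_right_mono) simp
  then show ?thesis
    unfolding gap_def E_def[symmetric] heat_kernel_def cos_transform_0 by (simp only: diff_divide_distrib)
qed

text \<open>With h the bump height, the two derivatives differ by at least h gap - h gap / 2 once
  \<open>err\<close> is below gap / 2, so one of them is at least h gap / 4 in absolute value. The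
  derivative of the old kernel enters \<open>err\<close> only through its convergence to 0.\<close>

lemma bump_dichotomy:
  assumes one: "\<And>y. A \<le> \<bar>y\<bar> \<Longrightarrow> \<kappa> y = 1"
  shows "\<forall>\<^sub>F a in at_top.
    gap \<alpha> / 4 * bump_height \<alpha> a \<le> \<bar>deriv (heat_kernel 1) a\<bar> \<or>
    gap \<alpha> / 4 * bump_height \<alpha> a \<le> \<bar>deriv (stable_like.heat_kernel \<alpha> (\<lambda>y. \<kappa> y + bump \<alpha> a y) 1) a\<bar>"
proof -
  define K where "K = 8 * exp 4 * (LBINT \<xi>. \<bar>\<xi>\<bar> * charac 1 \<xi>)"
  define err where "err a = 2 * \<bar>deriv (heat_kernel 1) a\<bar> + \<bar>heat_kernel 1 (2 * a)\<bar> + \<bar>heat_kernel 1 (2 * a + 1)\<bar>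
      + bump_height \<alpha> a * K" for a
  have "((\<lambda>a. (a + 1) powr (- (1 + \<alpha>))) \<longlongrightarrow> 0) at_top"
    using alpha by (intro tendsto_neg_powr filterlim_tendsto_add_at_top[OF tendsto_const filterlim_ident, THEN filterlim_cong[THEN iffD1, rotated -1]]) (auto simp: add.commute)
  then have height: "(bump_height \<alpha> \<longlongrightarrow> 0) at_top"
    by (simp only: bump_height_def[abs_def] powr_minus_divide)
  have 2: "filterlim (\<lambda>a::real. 2 * a) at_top at_top" "filterlim (\<lambda>a::real. 2 * a + 1) at_top at_top"
    by real_asymp+
  have "(err \<longlongrightarrow> 2 * \<bar>0\<bar> + \<bar>0\<bar> + \<bar>0\<bar> + 0 * K) at_top"
    unfolding err_def
    by (intro tendsto_intros deriv_heat_kernel_tendsto_0 height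
        filterlim_compose[OF heat_kernel_tendsto_0 2(1)] filterlim_compose[OF heat_kernel_tendsto_0 2(2)])
  then have "\<forall>\<^sub>F a in at_top. err a < gap \<alpha> / 2"
    using gap_pos by (intro order_tendstoD(2)) auto
  with eventually_gt_at_top[of 0] eventually_ge_at_top[of A] show ?thesis
  proof eventually_elim
    case (elim a)
    have h: "0 < bump_height \<alpha> a" using elim by (simp add: bump_height_def)
    define p' where "p' = deriv (heat_kernel 1) a"
    define q' where "q' = deriv (stable_like.heat_kernel \<alpha> (\<lambda>y. \<kappa> y + bump \<alpha> a y) 1) a"
    have "\<bar>q' - p' - bump_height \<alpha> a * (heat_kernel 1 0 - heat_kernel 1 1)\<bar> \<le> bump_height \<alpha> a * err a"
      using deriv_heat_kernel_add_bump[OF elim(1) one] elim(2) unfolding p'_def q'_def err_def K_def by auto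
    moreover have "bump_height \<alpha> a * err a \<le> bump_height \<alpha> a * (gap \<alpha> / 2)"
      using h elim(3) by (intro mult_left_mono) auto
    moreover have "bump_height \<alpha> a * gap \<alpha> \<le> bump_height \<alpha> a * (heat_kernel 1 0 - heat_kernel 1 1)"
      using h heat_kernel_gap by (intro mult_left_mono) auto
    ultimately have "gap \<alpha> / 4 * bump_height \<alpha> a \<le> \<bar>p'\<bar> \<or> gap \<alpha> / 4 * bump_height \<alpha> a \<le> \<bar>q'\<bar>"
      by (simp add: mult.commute[of "bump_height \<alpha> a"]) argo
    then show ?case by (simp add: p'_def q'_def)
  qed
qed

text \<open>Whichever side of the dichotomy holds decides whether \<kappa> is kept or receives the
  bump. The 32 is 4 times 8, the 8 being the price of replacing (a + 1)^(1+\<alpha>) by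
  a^(1+\<alpha>).\<close>

lemma extend_with_large_derivative:
  assumes one: "\<forall>y. A \<le> \<bar>y\<bar> \<longrightarrow> \<kappa> y = 1"
  shows "\<exists>\<kappa>' a. stable_like \<alpha> \<kappa>' \<and> N \<le> a \<and> (\<forall>y. \<bar>y\<bar> < A \<longrightarrow> \<kappa>' y = \<kappa> y) \<and>
    (\<forall>y. a + 2 \<le> \<bar>y\<bar> \<longrightarrow> \<kappa>' y = 1) \<and>
    gap \<alpha> / 32 \<le> \<bar>a\<bar> powr (1 + \<alpha>) * \<bar>deriv (stable_like.heat_kernel \<alpha> \<kappa>' 1) a\<bar>"
proof -
  obtain a where a: "1 < a" "A \<le> a" "N \<le> a" and dich:
    "gap \<alpha> / 4 * bump_height \<alpha> a \<le> \<bar>deriv (heat_kernel 1) a\<bar> \<or>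
    gap \<alpha> / 4 * bump_height \<alpha> a \<le> \<bar>deriv (stable_like.heat_kernel \<alpha> (\<lambda>y. \<kappa> y + bump \<alpha> a y) 1) a\<bar>"
    using eventually_conj[OF bump_dichotomy[OF one[rule_format]] eventually_conj[OF eventually_gt_at_top[of 1]
          eventually_conj[OF eventually_ge_at_top[of A] eventually_ge_at_top[of N]]]]
    by (auto simp: eventually_at_top_linorder)
  have scale: "gap \<alpha> / 32 \<le> \<bar>a\<bar> powr (1 + \<alpha>) * d" if "gap \<alpha> / 4 * bump_height \<alpha> a \<le> d" for d
  proof -
    \<comment> \<open>For a > 1 the ratio a / (a + 1) exceeds 1/2, and the exponent 1 + \<alpha> is
      below 3.\<close>
    have "1 / 8 = (1 / 2) powr (3::real)" by (simp add: power3_eq_cube)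
    also have "\<dots> \<le> (1 / 2) powr (1 + \<alpha>)" using alpha by (intro powr_mono') auto
    also have "\<dots> \<le> (a / (a + 1)) powr (1 + \<alpha>)" using a alpha by (intro powr_mono2) (auto simp: field_simps)
    also have "\<dots> = a powr (1 + \<alpha>) * bump_height \<alpha> a" using a by (simp add: bump_height_def powr_divide)
    finally have "gap \<alpha> / 4 * (1 / 8) \<le> gap \<alpha> / 4 * (a powr (1 + \<alpha>) * bump_height \<alpha> a)"
      using gap_pos[of \<alpha>] by (intro mult_left_mono) auto
    also have "\<dots> = a powr (1 + \<alpha>) * (gap \<alpha> / 4 * bump_height \<alpha> a)" by simp
    also have "\<dots> \<le> a powr (1 + \<alpha>) * d" using that by (intro mult_left_mono) auto
    finally show ?thesis using a by simp
  qed
  from dich show ?thesis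
  proof
    assume *: "gap \<alpha> / 4 * bump_height \<alpha> a \<le> \<bar>deriv (heat_kernel 1) a\<bar>"
    have "\<forall>y. a + 2 \<le> \<bar>y\<bar> \<longrightarrow> \<kappa> y = 1" using a one by simp
    then show ?thesis
      by (intro exI[of _ "\<kappa>"] exI[of _ "a"] conjI stable_like_axioms a scale * ) simp_all
  next
    assume *: "gap \<alpha> / 4 * bump_height \<alpha> a \<le> \<bar>deriv (stable_like.heat_kernel \<alpha> (\<lambda>y. \<kappa> y + bump \<alpha> a y) 1) a\<bar>"
    have "stable_like \<alpha> (\<lambda>y. \<kappa> y + bump \<alpha> a y)" using a one by (intro add_bump) auto
    \<comment> \<open>The bump still equals 1 at \<bar>y\<bar> = a + 1, so the constant tail has to
      start strictly beyond that point; a + 2 does.\<close>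
    moreover have "\<forall>y. \<bar>y\<bar> < A \<longrightarrow> \<kappa> y + bump \<alpha> a y = \<kappa> y" "\<forall>y. a + 2 \<le> \<bar>y\<bar> \<longrightarrow> \<kappa> y + bump \<alpha> a y = 1"
      using a one by (auto simp: bump_def)
    ultimately show ?thesis using a(3) scale[OF *]
      by (intro exI[of _ "\<lambda>y. \<kappa> y + bump \<alpha> a y"] exI[of _ "a"]) simp
  qed
qed

end

lemma constant_stable_like: "0 < \<alpha> \<Longrightarrow> \<alpha> < 2 \<Longrightarrow> stable_like \<alpha> (\<lambda>_. 1)"
  by unfold_locales auto

section \<open>The limiting coefficient\<close>

text \<open>What a stage records about its point \<open>a\<close> holds for every admissible
  coefficient that agrees with the stage up to its radius. It can therefore be applied directly to
  the limit, without adding up the errors of later stages.\<close>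

lemma ex_large_derivative_coefficient:
  assumes \<alpha>: "0 < \<alpha>" "\<alpha> < 2"
  shows "\<exists>\<kappa>. stable_like \<alpha> \<kappa> \<and>
    (\<forall>n :: nat. \<exists>a \<ge> real n. gap \<alpha> / 64 \<le> \<bar>a\<bar> powr (1 + \<alpha>) * \<bar>deriv (stable_like.heat_kernel \<alpha> \<kappa> 1) a\<bar>)"
proof -
  \<comment> \<open>A state is a coefficient with a radius beyond which it is 1. Radius n being at
    least n, the radii exhaust the line.\<close>
  define P where "P n s \<longleftrightarrow> stable_like \<alpha> (fst s) \<and> (\<forall>y. snd s \<le> \<bar>y\<bar> \<longrightarrow> fst s y = 1) \<and> real n \<le> snd s"
    for n :: nat and s :: "(real \<Rightarrow> real) \<times> real"
  define Q where "Q n s s' \<longleftrightarrow> snd s \<le> snd s' \<and> (\<forall>y. \<bar>y\<bar> < snd s \<longrightarrow> fst s' y = fst s y) \<and>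
    (\<exists>a \<ge> real n. \<forall>\<kappa>. stable_like \<alpha> \<kappa> \<longrightarrow> (\<forall>y. \<bar>y\<bar> < snd s' \<longrightarrow> \<kappa> y = fst s' y) \<longrightarrow>
       gap \<alpha> / 64 \<le> \<bar>a\<bar> powr (1 + \<alpha>) * \<bar>deriv (stable_like.heat_kernel \<alpha> \<kappa> 1) a\<bar>)"
    for n :: nat and s s' :: "(real \<Rightarrow> real) \<times> real"
  have "\<exists>f. \<forall>n. P n (f n) \<and> Q n (f n) (f (Suc n))"
  proof (rule dependent_nat_choice)
    show "\<exists>s. P 0 s"
      using constant_stable_like[OF \<alpha>] by (intro exI[of _ "(\<lambda>_. 1, 0)"]) (simp add: P_def)
    fix s n assume s: "P n s"
    interpret stable_like \<alpha> "fst s" using s by (simp add: P_def)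
    have tail: "\<forall>y. snd s \<le> \<bar>y\<bar> \<longrightarrow> fst s y = 1" using s by (simp add: P_def)
    obtain \<kappa>' a where \<kappa>': "stable_like \<alpha> \<kappa>'" and a: "max 1 (max (real n) (snd s)) \<le> a"
      and agree: "\<forall>y. \<bar>y\<bar> < snd s \<longrightarrow> \<kappa>' y = fst s y" and one: "\<forall>y. a + 2 \<le> \<bar>y\<bar> \<longrightarrow> \<kappa>' y = 1"
      and large: "gap \<alpha> / 32 \<le> \<bar>a\<bar> powr (1 + \<alpha>) * \<bar>deriv (stable_like.heat_kernel \<alpha> \<kappa>' 1) a\<bar>"
      using extend_with_large_derivative[OF tail, of "max 1 (max (real n) (snd s))"]
      by (elim exE conjE)
    \<comment> \<open>Half of the lower bound gap / 32 may be lost to all later modifications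
      together.\<close>
    define \<epsilon> where "\<epsilon> = gap \<alpha> / 64 / \<bar>a\<bar> powr (1 + \<alpha>)"
    have ap: "0 < \<bar>a\<bar> powr (1 + \<alpha>)" using a by simp
    then have \<epsilon>: "0 < \<epsilon>" using gap_pos by (simp add: \<epsilon>_def)
    obtain B where B: "\<forall>\<kappa> \<kappa>' x. stable_like \<alpha> \<kappa> \<longrightarrow> stable_like \<alpha> \<kappa>' \<longrightarrow> (\<forall>y. \<bar>y\<bar> < B \<longrightarrow> \<kappa> y = \<kappa>' y) \<longrightarrow>
        \<bar>deriv (stable_like.heat_kernel \<alpha> \<kappa> 1) x - deriv (stable_like.heat_kernel \<alpha> \<kappa>' 1) x\<bar> < \<epsilon>"
      using deriv_heat_kernel_stability[OF \<alpha>(1) \<epsilon>] by (rule exE)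
    \<comment> \<open>\<open>B\<close> protects the derivative at \<open>a\<close>; from a + 2 on
      the new coefficient is 1 again. With a \<ge> n this also gives radius at least n + 1.\<close>
    define A' where "A' = max B (a + 2)"
    have *: "gap \<alpha> / 64 \<le> \<bar>a\<bar> powr (1 + \<alpha>) * \<bar>deriv (stable_like.heat_kernel \<alpha> \<kappa> 1) a\<bar>"
      if "stable_like \<alpha> \<kappa>" "\<forall>y. \<bar>y\<bar> < A' \<longrightarrow> \<kappa> y = \<kappa>' y" for \<kappa>
    proof -
      have "\<bar>deriv (stable_like.heat_kernel \<alpha> \<kappa> 1) a - deriv (stable_like.heat_kernel \<alpha> \<kappa>' 1) a\<bar> < \<epsilon>"
        by (rule B[rule_format, OF that(1) \<kappa>']) (use that(2) in \<open>simp add: A'_def\<close>)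
      then have "\<bar>deriv (stable_like.heat_kernel \<alpha> \<kappa>' 1) a\<bar> - \<epsilon> \<le> \<bar>deriv (stable_like.heat_kernel \<alpha> \<kappa> 1) a\<bar>"
        by linarith
      from mult_left_mono[OF this less_imp_le[OF ap]] large show ?thesis
        using ap by (simp add: right_diff_distrib \<epsilon>_def)
    qed
    have "P (Suc n) (\<kappa>', A') \<and> Q n s (\<kappa>', A')"
      unfolding P_def Q_def fst_conv snd_conv
    proof (intro conjI allI impI)
      show "\<exists>a \<ge> real n. \<forall>\<kappa>. stable_like \<alpha> \<kappa> \<longrightarrow> (\<forall>y. \<bar>y\<bar> < A' \<longrightarrow> \<kappa> y = \<kappa>' y) \<longrightarrow>
         gap \<alpha> / 64 \<le> \<bar>a\<bar> powr (1 + \<alpha>) * \<bar>deriv (stable_like.heat_kernel \<alpha> \<kappa> 1) a\<bar>"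
        using a by (intro exI[of _ a] conjI allI impI * ) auto
      show "real (Suc n) \<le> A'" "snd s \<le> A'" using a by (auto simp: A'_def)
    qed (use \<kappa>' agree one in \<open>simp_all add: A'_def\<close>)
    then show "\<exists>s'. P (Suc n) s' \<and> Q n s s'" by blast
  qed
  then obtain f where f: "\<forall>n. P n (f n) \<and> Q n (f n) (f (Suc n))" by (rule exE)
  have P: "P n (f n)" and Q: "Q n (f n) (f (Suc n))" for n using f by simp_all
  have mono: "snd (f m) \<le> snd (f n)" if "m \<le> n" for m n
  proof (rule lift_Suc_mono_le[of "\<lambda>n. snd (f n)", OF _ that])
    show "snd (f k) \<le> snd (f (Suc k))" for k using Q[of k] by (simp add: Q_def)
  qed
  have agree: "fst (f n) y = fst (f m) y" if "m \<le> n" "\<bar>y\<bar> < snd (f m)" for m n y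
    using that(1)
  proof (induction rule: dec_induct)
    case (step k)
    have "\<bar>y\<bar> < snd (f k)" using that(2) mono[OF step(1)] by linarith
    then show ?case using Q[of k] step by (simp add: Q_def)
  qed simp
  \<comment> \<open>The value at y is final from any state whose radius exceeds \<bar>y\<bar>; the +
    1 makes this inequality strict.\<close>
  define \<kappa> where "\<kappa> y = fst (f (nat \<lceil>\<bar>y\<bar>\<rceil> + 1)) y" for y
  have \<kappa>: "\<kappa> y = fst (f m) y" if "\<bar>y\<bar> < snd (f m)" for m y
  proof -
    define k where "k = nat \<lceil>\<bar>y\<bar>\<rceil> + 1"
    have "\<bar>y\<bar> < real k" unfolding k_def by linarith
    also have "real k \<le> snd (f k)" using P[of k] unfolding P_def by blast
    finally have k: "\<bar>y\<bar> < snd (f k)" .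
    have "fst (f k) y = fst (f m) y"
    proof (cases "m \<le> k")
      case True
      then show ?thesis by (rule agree[OF _ that])
    next
      case False
      then show ?thesis using agree[OF _ k, of m] by simp
    qed
    then show ?thesis by (simp only: \<kappa>_def k_def)
  qed
  have large_index: "\<exists>m. \<forall>n\<ge>m. \<bar>y\<bar> < snd (f n)" for y
  proof -
    obtain m :: nat where m: "\<bar>y\<bar> < real m" using reals_Archimedean2 by blast
    have "\<bar>y\<bar> < snd (f n)" if "m \<le> n" for n
    proof -
      have "real m \<le> snd (f m)" using P[of m] by (simp add: P_def)
      with m mono[OF that] show ?thesis by linarith
    qed
    then show ?thesis by blast
  qed
  have sl: "stable_like \<alpha> (fst (f n))" for n using P[of n] by (simp add: P_def)
  have sl_kappa: "stable_like \<alpha> \<kappa>"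
  proof
    show "0 < \<alpha>" "\<alpha> < 2" by fact+
    have lim: "(\<lambda>n. fst (f n) y) \<longlonglongrightarrow> \<kappa> y" for y
    proof -
      obtain m where "\<forall>n\<ge>m. \<bar>y\<bar> < snd (f n)" using large_index by blast
      then have "\<forall>\<^sub>F n in sequentially. fst (f n) y = \<kappa> y"
        by (intro eventually_sequentiallyI[of m]) (rule \<kappa>[symmetric], blast)
      then show ?thesis by (rule tendsto_eventually)
    qed
    show "\<kappa> \<in> borel_measurable borel"
      by (rule borel_measurable_LIMSEQ_real[where u = "\<lambda>n. fst (f n)"])
         (rule lim, rule stable_like.measurable_kappa[OF sl])
    fix y
    obtain m where "\<bar>y\<bar> < snd (f m)" using large_index[of y] by blast
    then have "\<kappa> y = fst (f m) y" "\<kappa> (- y) = fst (f m) (- y)" using \<kappa> by auto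
    then show "\<kappa> (- y) = \<kappa> y" "1 \<le> \<kappa> y" "\<kappa> y \<le> 2"
      by (simp_all only: stable_like.kappa_even[OF sl] stable_like.kappa_bounds[OF sl])
  qed
  have large: "\<exists>a \<ge> real n. gap \<alpha> / 64 \<le> \<bar>a\<bar> powr (1 + \<alpha>) * \<bar>deriv (stable_like.heat_kernel \<alpha> \<kappa> 1) a\<bar>" for n
  proof -
    obtain a where "real n \<le> a" and *: "\<forall>\<kappa>. stable_like \<alpha> \<kappa> \<longrightarrow> (\<forall>y. \<bar>y\<bar> < snd (f (Suc n)) \<longrightarrow> \<kappa> y = fst (f (Suc n)) y) \<longrightarrow>
       gap \<alpha> / 64 \<le> \<bar>a\<bar> powr (1 + \<alpha>) * \<bar>deriv (stable_like.heat_kernel \<alpha> \<kappa> 1) a\<bar>"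
      using Q[of n] unfolding Q_def by (elim exE conjE)
    have "gap \<alpha> / 64 \<le> \<bar>a\<bar> powr (1 + \<alpha>) * \<bar>deriv (stable_like.heat_kernel \<alpha> \<kappa> 1) a\<bar>"
      by (rule *[rule_format, OF sl_kappa \<kappa>])
    with \<open>real n \<le> a\<close> show ?thesis by blast
  qed
  show ?thesis by (rule exI[of _ \<kappa>], rule conjI[OF sl_kappa], rule allI, rule large)
qed

text \<open>\<open>at_infinity\<close> contains both ends of the line, so points going to plus
  infinity are enough for a lower bound.\<close>

lemma Limsup_at_infinity_ge:
  fixes g :: "real \<Rightarrow> real"
  assumes "\<And>n :: nat. \<exists>a \<ge> real n. c \<le> g a"
  shows "ereal c \<le> Limsup at_infinity (\<lambda>x. ereal (g x))"
proof (rule ccontr)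
  assume "\<not> ?thesis"
  then have "Limsup at_infinity (\<lambda>x. ereal (g x)) < ereal c" by simp
  from Limsup_lessD[OF this] obtain b where b: "\<And>x. b \<le> \<bar>x\<bar> \<Longrightarrow> g x < c"
    by (auto simp: eventually_at_infinity)
  obtain n :: nat where "b < real n" using reals_Archimedean2 by blast
  moreover obtain a where "real n \<le> a" "c \<le> g a" using assms by blast
  ultimately show False using b[of a] by linarith
qed

theorem theorem1p1:
  fixes \<alpha> :: real
  assumes "0 < \<alpha>" and "\<alpha> < 2"
  shows "\<exists>\<kappa> :: real \<Rightarrow> real.
           \<kappa> \<in> borel_measurable borel \<and> (\<forall>y. \<kappa> (- y) = \<kappa> y) \<and> (\<forall>y. \<kappa> y \<in> {1..2}) \<and>
           (\<exists>p. is_heat_kernel \<alpha> \<kappa> p \<and>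
              Limsup at_infinity (\<lambda>x. ereal (\<bar>x\<bar> powr (1 + \<alpha>) * \<bar>deriv (p 1) x\<bar>)) > 0)"
proof -
  obtain \<kappa> where \<kappa>: "stable_like \<alpha> \<kappa>" and large:
    "\<forall>n :: nat. \<exists>a \<ge> real n. gap \<alpha> / 64 \<le> \<bar>a\<bar> powr (1 + \<alpha>) * \<bar>deriv (stable_like.heat_kernel \<alpha> \<kappa> 1) a\<bar>"
    using ex_large_derivative_coefficient[OF assms] by (elim exE conjE)
  interpret stable_like \<alpha> \<kappa> by (rule \<kappa>)
  have "0 < ereal (gap \<alpha> / 64)" using gap_pos by simp
  moreover have "ereal (gap \<alpha> / 64) \<le> Limsup at_infinity (\<lambda>x. ereal (\<bar>x\<bar> powr (1 + \<alpha>) * \<bar>deriv (heat_kernel 1) x\<bar>))"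
    by (rule Limsup_at_infinity_ge) (rule large[rule_format])
  ultimately have pos: "Limsup at_infinity (\<lambda>x. ereal (\<bar>x\<bar> powr (1 + \<alpha>) * \<bar>deriv (heat_kernel 1) x\<bar>)) > 0"
    by (rule less_le_trans)
  show ?thesis
  proof (rule exI[of _ \<kappa>], intro conjI)
    show "\<exists>p. is_heat_kernel \<alpha> \<kappa> p \<and>
        Limsup at_infinity (\<lambda>x. ereal (\<bar>x\<bar> powr (1 + \<alpha>) * \<bar>deriv (p 1) x\<bar>)) > 0"
      by (rule exI[of _ heat_kernel], rule conjI[OF is_heat_kernel_heat_kernel pos])
    show "\<forall>y. \<kappa> (- y) = \<kappa> y" "\<forall>y. \<kappa> y \<in> {1..2}" by (simp_all add: kappa_even kappa_bounds)
    show "\<kappa> \<in> borel_measurable borel" by (rule measurable_kappa)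
  qed
qed

end
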